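(* For all positive integers $a, b$ with $a\ge 3$ and all real $\delta\in(0,\frac12)$, \[ A(a,b,\delta)=2\delta b+O\left(\sqrt{a}\,\log a+b\,a^{-\frac12+\frac{2+o(1)}{\sqrt{\log a}\,\log\log a}}\right), \] where the implied constant is absolute and $o(1)$ denotes a function of $a$ only that tends to $0$ as $a\to\infty$.
   Context: For real $t$, $\|t\|=\min_{n\in\mathbb{Z}}|t-n|$ is the distance from $t$ to the nearest integer. For positive integers $a,b$ and real $\delta>0$, $A(a,b,\delta)$ is the number of integers $x$ with $1\le x\le b$ and $\left\|\frac{x^2}{a}\right\|\le\delta$. $\log$ is the natural logarithm. The notation $f=O(g)$ means that there is a constant $C$ with $|f|\le C|g|$ for all admissible values of the parameters (here $a$, $b$, $\delta$). *)

theory Defs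
  imports Complex_Main
begin

definition nearest_int_dist :: "real \<Rightarrow> real" where
  "nearest_int_dist t = (INF n::int. \<bar>t - of_int n\<bar>)"

text \<open>The infimum above is a minimum, attained at \<open>round t\<close>.\<close>

lemma nearest_int_dist_eq_round: "nearest_int_dist t = \<bar>t - of_int (round t)\<bar>"
proof -
  have "Inf (range (\<lambda>n::int. \<bar>t - of_int n\<bar>)) = \<bar>t - of_int (round t)\<bar>"
    by (rule cInf_eq_minimum) (auto intro: round_diff_minimal)
  then show ?thesis
    by (simp add: nearest_int_dist_def)
qed

definition A :: "nat \<Rightarrow> nat \<Rightarrow> real \<Rightarrow> nat" where
  "A a b \<delta> = card {x::nat. 1 \<le> x \<and> x \<le> b \<and> nearest_int_dist ((real x)\<^sup>2 / real a) \<le> \<delta>}"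

end

theory Submission
  imports Defs "HOL-Complex_Analysis.Complex_Analysis" "HOL-Probability.Probability"
    "HOL-Number_Theory.Number_Theory" "HOL-Real_Asymp.Real_Asymp"
begin

text \<open>
  Detecting \<open>x\<^sup>2 \<equiv> m (mod a)\<close> with \<open>\<bar>m\<bar> \<le> \<delta> a\<close> by additive characters modulo \<open>a\<close>, the frequency \<open>0\<close>
  gives \<open>2 \<delta> b + O(b / a)\<close> and the frequency \<open>h\<close> contributes at most \<open>1 / h\<close> times the incomplete
  Gauss sum \<open>\<Sum>x\<le>b. e(h x\<^sup>2 / a)\<close>. With \<open>d = gcd h a\<close> the latter is
  \<open>O(b sqrt d / sqrt a + sqrt a / sqrt d)\<close>, without any logarithm: Mordell's integral gives a reciprocity
  formula that replaces \<open>p / q\<close> by \<open>- q / p\<close> and shortens the sum accordingly, and the Euclidean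
  algorithm finishes. Summing over \<open>h\<close> leaves
  \<open>sqrt a ln a + b / sqrt a \<cdot> ln a \<cdot> (\<Sum>d dvd a. 1 / sqrt d)\<close>.

  The last sum is at most \<open>exp ((2 + o(1)) sqrt (ln a) / ln (ln a))\<close>. The constant \<open>2\<close> needs the upper
  half of the prime number theorem, \<open>\<psi>(x) \<le> (1 + o(1)) x\<close>, which follows from \<open>\<zeta>(1 + i t) \<noteq> 0\<close> by the
  Wiener--Ikehara argument with the Fejer kernel.
\<close>

section \<open>Mordell integrals\<close>

text \<open>Completing the Gauss sums would cost a logarithm on top of the one from
  \<open>\<Sum> 1 / h\<close>, too much for the term \<open>sqrt a * ln a\<close>; this forces the
  detour through reciprocity.

  The exponent is the solution of an extremal problem. The prime factors of \<open>a\<close> satisfy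
  \<open>\<Sum> ln p \<le> ln a\<close>, and \<open>\<Sum> 1 / sqrt p\<close> is largest when they
  are the primes up to about \<open>ln a\<close>. By the prime number theorem it is then about
  \<open>2 * sqrt (ln a) / ln (ln a)\<close>, and division by \<open>ln a\<close> turns this into
  the exponent of \<open>a\<close>. A Chebyshev bound \<open>psi x \<le> K * x\<close> with
  \<open>K > 1\<close> would spoil the constant. The divisor sum is only bounded from above, so a
  one-sided Tauberian argument with a nonnegative kernel is enough.

  The factor \<open>ln a\<close> in front of the divisor sum disappears in the \<open>o(1)\<close>,
  because the square of \<open>ln (ln a)\<close> is small compared with
  \<open>sqrt (ln a)\<close>.\<close>

lemma
  fixes c :: real and \<kappa> :: complex
  assumes c: "c > 0"
  shows gaussian_integrable: "integrable lborel (\<lambda>t::real. exp (\<kappa> * t - c * t\<^sup>2))"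
    and gaussian_integral: "(\<integral>t. exp (\<kappa> * complex_of_real t - c * t\<^sup>2) \<partial>lborel)
          = sqrt (pi / c) * exp (\<kappa>\<^sup>2 / (4 * c))"
proof -
  \<comment> \<open>Centering at \<open>u\<close> and scaling by \<open>1 / s\<close> absorbs the
    real part of \<kappa>. What remains is the standard normal density times a character of
    frequency \<open>w\<close>, so the value comes from the characteristic function of the normal
    distribution.\<close>
  define s where "s = sqrt (2 * c)"
  define u where "u = Re \<kappa> / (2 * c)"
  define w where "w = Im \<kappa> / s"
  define f where "f = (\<lambda>t::real. exp (\<kappa> * complex_of_real t - c * t\<^sup>2))"
  define g where "g = (\<lambda>x::real. std_normal_density x *\<^sub>R iexp (w * x))"
  have s: "s > 0" "s\<^sup>2 = 2 * c" using c by (auto simp: s_def)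
  have s': "complex_of_real s * complex_of_real s = 2 * c"
    using s(2) by (metis of_real_mult power2_eq_square of_real_numeral)
  have int_g: "integrable lborel g"
    unfolding g_def
    by (rule Bochner_Integration.integrable_bound[OF integrable_normal_density[of 1 0]])
       (auto simp: norm_mult)
  have "(CLINT x|std_normal_distribution. iexp (w * x)) = exp (- (w\<^sup>2) / 2)"
    using char_std_normal_distribution unfolding char_def by metis
  then have int_g_eq: "(\<integral>x. g x \<partial>lborel) = complex_of_real (exp (- (w\<^sup>2) / 2))"
    unfolding g_def by (subst (asm) integral_density) (auto simp: exp_of_real)
  have eq: "f (u + (1 / s) * x) = (sqrt (2 * pi) * exp (\<kappa> * u - c * u\<^sup>2)) * g x" for x
  proof -
    have "\<kappa> * complex_of_real (u + (1 / s) * x) - c * (u + (1 / s) * x)\<^sup>2 =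
       (\<kappa> * u - c * u\<^sup>2) + (- (x\<^sup>2) / 2) + \<i> * (w * x)"
      using s c s' by (simp add: u_def w_def complex_eq_iff power2_eq_square field_simps)
    then have "f (u + (1 / s) * x) = exp (\<kappa> * u - c * u\<^sup>2) * exp (complex_of_real (- (x\<^sup>2) / 2)) * iexp (w * x)"
      unfolding f_def by (simp only: exp_add)
    also have "exp (complex_of_real (- (x\<^sup>2) / 2)) = sqrt (2 * pi) * std_normal_density x"
      by (subst exp_of_real) (simp add: std_normal_density_def)
    finally show ?thesis
      by (simp add: g_def scaleR_conv_of_real)
  qed
  have "integrable lborel (\<lambda>x. f (u + (1 / s) * x))"
    unfolding eq using int_g by (intro integrable_mult_right) auto
  then show int_f: "integrable lborel (\<lambda>t::real. exp (\<kappa> * t - c * t\<^sup>2))"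
    using s lborel_integrable_real_affine_iff[of "1/s" f u] unfolding f_def by simp
  have "(\<integral>t. f t \<partial>lborel) = \<bar>1 / s\<bar> *\<^sub>R (\<integral>x. f (u + (1 / s) * x) \<partial>lborel)"
    by (rule lborel_integral_real_affine) (use s in auto)
  also have "\<dots> = (1 / s) * ((sqrt (2 * pi) * exp (\<kappa> * u - c * u\<^sup>2)) * complex_of_real (exp (- (w\<^sup>2) / 2)))"
    unfolding eq using s int_g_eq by (simp add: scaleR_conv_of_real exp_of_real[symmetric])
  also have "\<dots> = (sqrt (2 * pi) / s) * (exp (\<kappa> * u - c * u\<^sup>2) * complex_of_real (exp (- (w\<^sup>2) / 2)))"
    by simp
  also have "sqrt (2 * pi) / s = sqrt (pi / c)"
    by (simp add: s_def real_sqrt_mult real_sqrt_divide)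
  also have "exp (\<kappa> * u - c * u\<^sup>2) * complex_of_real (exp (- (w\<^sup>2) / 2)) = exp (\<kappa>\<^sup>2 / (4 * c))"
  proof -
    have "w\<^sup>2 = (Im \<kappa>)\<^sup>2 / (2 * c)" by (simp add: w_def power_divide s)
    then have "complex_of_real (exp (- (w\<^sup>2) / 2)) = exp (complex_of_real (- ((Im \<kappa>)\<^sup>2 / (4 * c))))"
      by (subst exp_of_real) simp
    moreover have "\<kappa> * u - c * u\<^sup>2 - (Im \<kappa>)\<^sup>2 / (4 * c) = \<kappa>\<^sup>2 / (4 * c)"
      using c by (simp add: u_def complex_eq_iff power2_eq_square field_simps)
    ultimately show ?thesis by (simp only: exp_add[symmetric] diff_conv_add_uminus of_real_minus)
  qed
  finally show "(\<integral>t. exp (\<kappa> * complex_of_real t - c * t\<^sup>2) \<partial>lborel)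
          = sqrt (pi / c) * exp (\<kappa>\<^sup>2 / (4 * c))"
    unfolding f_def by simp
qed

text \<open>The line through \<open>- 1 / 2\<close> in direction \<open>1 + \<i>\<close> avoids the poles, and \<open>exp (\<pi> \<i> \<theta> z\<^sup>2)\<close> decays
  along it like a Gaussian.\<close>

definition mordell_line :: "real \<Rightarrow> complex" where
  "mordell_line t = - 1 / 2 + (1 + \<i>) * t"

definition quad_exp :: "real \<Rightarrow> real \<Rightarrow> complex \<Rightarrow> complex" where
  "quad_exp \<theta> \<beta> z = exp (pi * \<i> * \<theta> * z\<^sup>2 + 2 * pi * \<i> * \<beta> * z)"

text \<open>The denominator puts a simple pole at each integer \<open>n\<close>, with residue
  \<open>quad_exp \<theta> \<beta> n / (2 * pi * \<i>)\<close>: the terms of a Gauss sum are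
  residues of this function.\<close>

definition mordell_fun :: "real \<Rightarrow> real \<Rightarrow> complex \<Rightarrow> complex" where
  "mordell_fun \<theta> \<beta> z = quad_exp \<theta> \<beta> z / (exp (2 * pi * \<i> * z) - 1)"

definition mordell :: "real \<Rightarrow> real \<Rightarrow> complex" where
  "mordell \<theta> \<beta> = (\<integral>t. mordell_fun \<theta> \<beta> (mordell_line t) * (1 + \<i>) \<partial>lborel)"

text \<open>Because \<open>(1 + \<i>)\<^sup>2 = 2 * \<i>\<close>, the quadratic part of the exponent
  becomes real and negative on the line.\<close>

lemma quad_exp_line:
  "quad_exp \<theta> \<beta> (mordell_line t) = exp (pi * \<i> * (\<theta> / 4 - \<beta>)) *
     exp ((1 + \<i>) * pi * \<i> * (2 * \<beta> - \<theta>) * complex_of_real t - (2 * pi * \<theta>) * t\<^sup>2)"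
  unfolding quad_exp_def mordell_line_def exp_add[symmetric]
  by (rule arg_cong[where f = exp]) (simp add: complex_eq_iff power2_eq_square field_simps)

lemma norm_quad_exp: "norm (quad_exp \<theta> \<beta> z) = exp (- 2 * pi * Im z * (\<theta> * Re z + \<beta>))"
  by (simp add: quad_exp_def power2_eq_square algebra_simps)

lemma quad_exp_line_integrable:
  assumes "\<theta> > 0"
  shows "integrable lborel (\<lambda>t. quad_exp \<theta> \<beta> (mordell_line t))"
  unfolding quad_exp_line using gaussian_integrable[of "2 * pi * \<theta>"] assms
  by (intro integrable_mult_right) simp

lemma quad_exp_line_integral:
  assumes "\<theta> > 0"
  shows "(\<integral>t. quad_exp \<theta> \<beta> (mordell_line t) * (1 + \<i>) \<partial>lborel)
    = (1 + \<i>) / sqrt 2 * exp (- pi * \<i> * \<beta>\<^sup>2 / \<theta>) / sqrt \<theta>"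
proof -
  have "(\<integral>t. quad_exp \<theta> \<beta> (mordell_line t) * (1 + \<i>) \<partial>lborel) =
     exp (pi * \<i> * (\<theta> / 4 - \<beta>)) * (sqrt (pi / (2 * pi * \<theta>)) * exp (((1 + \<i>) * pi * \<i> * (2 * \<beta> - \<theta>))\<^sup>2 / (4 * (2 * pi * \<theta>)))) * (1 + \<i>)"
    unfolding quad_exp_line using gaussian_integral[of "2 * pi * \<theta>" "(1 + \<i>) * pi * \<i> * (2 * \<beta> - \<theta>)"] assms
    by simp
  also have "\<dots> = (1 + \<i>) * sqrt (1 / (2 * \<theta>)) * (exp (pi * \<i> * (\<theta> / 4 - \<beta>)) * exp (((1 + \<i>) * pi * \<i> * (2 * \<beta> - \<theta>))\<^sup>2 / (4 * (2 * pi * \<theta>))))"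
    by simp
  also have "exp (pi * \<i> * (\<theta> / 4 - \<beta>)) * exp (((1 + \<i>) * pi * \<i> * (2 * \<beta> - \<theta>))\<^sup>2 / (4 * (2 * pi * \<theta>)))
     = exp (- pi * \<i> * \<beta>\<^sup>2 / \<theta>)"
    unfolding exp_add[symmetric]
    by (rule arg_cong[where f = exp]) (use assms in \<open>simp add: complex_eq_iff power2_eq_square field_simps\<close>)
  finally show ?thesis
    by (simp add: real_sqrt_divide real_sqrt_mult)
qed

lemma exp_line: "exp (2 * pi * \<i> * mordell_line t) = - (exp (- 2 * pi * t) *\<^sub>R cis (2 * pi * t))"
proof -
  have "2 * pi * \<i> * mordell_line t = - (pi * \<i>) + (complex_of_real (- 2 * pi * t) + \<i> * (2 * pi * t))"
    by (simp add: mordell_line_def complex_eq_iff algebra_simps)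
  then show ?thesis
    by (simp only: exp_add exp_of_real cis_conv_exp scaleR_conv_of_real exp_minus exp_pi_i) simp
qed

text \<open>With \<open>r = exp (- 2 * pi * t)\<close> the denominator has the size of
  \<open>1 + r *\<^sub>R cis (2 * pi * t)\<close>. For \<open>\<bar>t\<bar> \<le> 1 / 4\<close> the
  second summand has nonnegative real part, so nothing cancels; otherwise \<open>r\<close> is at
  most \<open>1 / 2\<close> or at least \<open>2\<close>, and the triangle inequality is
  enough.\<close>

lemma norm_denominator_ge:
  "norm (exp (2 * pi * \<i> * mordell_line t) - 1) \<ge> max 1 (exp (- 2 * pi * t)) / 2"
proof -
  define r where "r = exp (- 2 * pi * t)"
  have r: "r > 0" by (simp add: r_def)
  have big: "exp (pi / 2) \<ge> 2"
    using exp_ge_add_one_self[of "pi / 2"] pi_gt3 by linarith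
  have eq: "norm (exp (2 * pi * \<i> * mordell_line t) - 1) = norm (1 + r *\<^sub>R cis (2 * pi * t))"
    unfolding exp_line r_def by (metis add.commute minus_add_distrib norm_minus_cancel uminus_add_conv_diff)
  consider "\<bar>t\<bar> \<le> 1 / 4" | "t > 1 / 4" | "t < - 1 / 4" by linarith
  then have "norm (1 + r *\<^sub>R cis (2 * pi * t)) \<ge> max 1 r / 2"
  proof cases
    case 1
    have "\<bar>2 * pi * t\<bar> = 2 * pi * \<bar>t\<bar>" by (simp add: abs_mult)
    also have "\<dots> \<le> 2 * pi * (1 / 4)" using 1 by (intro mult_left_mono) auto
    finally have "cos (2 * pi * t) \<ge> 0"
      by (intro cos_ge_zero) linarith+
    then have "(norm (1 + r *\<^sub>R cis (2 * pi * t)))\<^sup>2 \<ge> 1 + r\<^sup>2"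
      using r unfolding cmod_power2 by (simp add: power2_eq_square algebra_simps)
       (smt (verit, best) mult_nonneg_nonneg sin_cos_squared_add3 distrib_left mult.assoc mult.left_commute mult_cancel_left1)
    moreover have "1 + r\<^sup>2 \<ge> (max 1 r)\<^sup>2" by (auto simp: max_def)
    ultimately have "norm (1 + r *\<^sub>R cis (2 * pi * t)) \<ge> max 1 r"
      by (meson norm_ge_zero order_trans power2_le_imp_le)
    then show ?thesis using r by (auto simp: max_def)
  next
    case 2
    have "r \<le> exp (- (pi / 2))" unfolding r_def using 2 pi_gt_zero by (simp add: field_simps)
    also have "\<dots> \<le> 1 / 2" using big by (simp add: exp_minus field_simps)
    finally have "r \<le> 1 / 2" .
    then show ?thesis
      using norm_triangle_ineq4[of "1 + r *\<^sub>R cis (2 * pi * t)" "r *\<^sub>R cis (2 * pi * t)"] r by simp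
  next
    case 3
    have "2 \<le> exp (pi / 2)" by (rule big)
    also have "\<dots> \<le> r" unfolding r_def using mult_strict_left_mono[OF 3 pi_gt_zero] by simp
    finally have "r \<ge> 2" .
    then show ?thesis
      using norm_triangle_ineq4[of "1 + r *\<^sub>R cis (2 * pi * t)" "1"] r by simp
  qed
  then show ?thesis by (simp only: eq) (simp only: r_def)
qed

lemma denominator_nonzero: "exp (2 * pi * \<i> * mordell_line t) \<noteq> 1"
  using norm_denominator_ge[of t] by (auto simp: max_def split: if_splits)

lemma norm_mordell_fun_le:
  "norm (mordell_fun \<theta> \<beta> (mordell_line t)) \<le> 2 * min 1 (exp (2 * pi * t)) * norm (quad_exp \<theta> \<beta> (mordell_line t))"
proof -
  have pos: "0 < max 1 (exp (- 2 * pi * t)) / 2" by (simp add: less_max_iff_disj)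
  have "norm (mordell_fun \<theta> \<beta> (mordell_line t)) \<le> norm (quad_exp \<theta> \<beta> (mordell_line t)) / (max 1 (exp (- 2 * pi * t)) / 2)"
    unfolding mordell_fun_def norm_divide
    by (intro divide_left_mono norm_denominator_ge mult_pos_pos pos order.strict_trans2[OF pos]) auto
  also have "\<dots> = 2 * min 1 (exp (2 * pi * t)) * norm (quad_exp \<theta> \<beta> (mordell_line t))"
    by (auto simp: max_def min_def exp_minus field_simps)
  finally show ?thesis .
qed

lemma continuous_mordell_line [continuous_intros]: "continuous_on S mordell_line"
  unfolding mordell_line_def by (intro continuous_intros)

lemma mordell_integrable:
  assumes "\<theta> > 0"
  shows "integrable lborel (\<lambda>t. mordell_fun \<theta> \<beta> (mordell_line t) * (1 + \<i>))"
proof (rule Bochner_Integration.integrable_bound)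
  show "integrable lborel (\<lambda>t. 4 * quad_exp \<theta> \<beta> (mordell_line t))"
    using quad_exp_line_integrable[OF assms] by (intro integrable_mult_right)
  have "continuous_on UNIV (\<lambda>t. mordell_fun \<theta> \<beta> (mordell_line t) * (1 + \<i>))"
    unfolding mordell_fun_def quad_exp_def
    by (intro continuous_intros) (use denominator_nonzero in auto)
  then show "(\<lambda>t. mordell_fun \<theta> \<beta> (mordell_line t) * (1 + \<i>)) \<in> borel_measurable lborel"
    by (simp add: borel_measurable_continuous_onI)
  show "AE t in lborel. norm (mordell_fun \<theta> \<beta> (mordell_line t) * (1 + \<i>)) \<le> norm (4 * quad_exp \<theta> \<beta> (mordell_line t))"
  proof (intro AE_I2)
    fix t
    have "norm (1 + \<i>) \<le> 2" by (simp add: cmod_def real_le_lsqrt)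
    moreover have "norm (mordell_fun \<theta> \<beta> (mordell_line t)) \<le> 2 * norm (quad_exp \<theta> \<beta> (mordell_line t))"
      by (rule order.trans[OF norm_mordell_fun_le], intro mult_right_mono) auto
    ultimately have "norm (mordell_fun \<theta> \<beta> (mordell_line t)) * norm (1 + \<i>) \<le> (2 * norm (quad_exp \<theta> \<beta> (mordell_line t))) * 2"
      by (intro mult_mono) auto
    then show "norm (mordell_fun \<theta> \<beta> (mordell_line t) * (1 + \<i>)) \<le> norm (4 * quad_exp \<theta> \<beta> (mordell_line t))"
      by (simp add: norm_mult)
  qed
qed

text \<open>Raising \<beta> by 1 multiplies the numerator by \<open>exp (2 * pi * \<i> * z)\<close>,
  which is the denominator plus 1. The difference of the two integrals is therefore a pure Gaussian
  integral.\<close>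

lemma mordell_shift_int:
  assumes "\<theta> > 0"
  shows "mordell \<theta> (\<beta> + 1) = mordell \<theta> \<beta> + (1 + \<i>) / sqrt 2 * exp (- pi * \<i> * \<beta>\<^sup>2 / \<theta>) / sqrt \<theta>"
proof -
  have "mordell_fun \<theta> (\<beta> + 1) (mordell_line t) = mordell_fun \<theta> \<beta> (mordell_line t) + quad_exp \<theta> \<beta> (mordell_line t)" for t
  proof -
    have "quad_exp \<theta> (\<beta> + 1) z = quad_exp \<theta> \<beta> z * exp (2 * pi * \<i> * z)" for z
      by (simp add: quad_exp_def exp_add[symmetric] algebra_simps)
    then show ?thesis
      using denominator_nonzero[of t] by (simp add: mordell_fun_def field_simps)
  qed
  then have "mordell \<theta> (\<beta> + 1) = (\<integral>t. mordell_fun \<theta> \<beta> (mordell_line t) * (1 + \<i>) + quad_exp \<theta> \<beta> (mordell_line t) * (1 + \<i>) \<partial>lborel)"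
    unfolding mordell_def by (simp only: distrib_right)
  also have "\<dots> = mordell \<theta> \<beta> + (\<integral>t. quad_exp \<theta> \<beta> (mordell_line t) * (1 + \<i>) \<partial>lborel)"
    unfolding mordell_def
    by (intro Bochner_Integration.integral_add mordell_integrable assms integrable_mult_left quad_exp_line_integrable)
  finally show ?thesis by (simp only: quad_exp_line_integral[OF assms])
qed

text \<open>The range of \<beta> is what makes the bound uniform: on the line the factor
  \<open>exp (- 2 * pi * \<beta> * t)\<close> is at most 1 for \<open>t \<ge> 0\<close>, and for
  \<open>t < 0\<close> it is compensated by the factor \<open>exp (2 * pi * t)\<close> from the
  denominator. A real Gaussian integral remains, and
  \<open>2 * exp (pi * \<theta> / 8) \<le> 4\<close>.\<close>

lemma norm_mordell_le:
  assumes \<theta>: "0 < \<theta>" "\<theta> \<le> 1" and \<beta>: "0 \<le> \<beta>" "\<beta> \<le> 1"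
  shows "norm (mordell \<theta> \<beta>) \<le> 4 / sqrt \<theta>"
proof -
  have R: "integrable lborel (\<lambda>t. exp (pi * \<theta> * t - 2 * pi * \<theta> * t\<^sup>2))"
     "(\<integral>t. exp (pi * \<theta> * t - 2 * pi * \<theta> * t\<^sup>2) \<partial>lborel) = sqrt (1 / (2 * \<theta>)) * exp (pi * \<theta> / 8)"
  proof -
    have c: "2 * pi * \<theta> > 0" using \<theta> by simp
    have eq: "exp (complex_of_real (pi * \<theta>) * complex_of_real t - complex_of_real (2 * pi * \<theta> * t\<^sup>2))
        = complex_of_real (exp (pi * \<theta> * t - 2 * pi * \<theta> * t\<^sup>2))" for t
      by (subst exp_of_real[symmetric]) simp
    have sq: "sqrt (pi / (2 * pi * \<theta>)) = sqrt (1 / (2 * \<theta>))" by simp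
    have ex: "exp ((complex_of_real (pi * \<theta>))\<^sup>2 / complex_of_real (4 * (2 * pi * \<theta>))) = complex_of_real (exp (pi * \<theta> / 8))"
      by (subst exp_of_real[symmetric], rule arg_cong[where f = exp]) (use \<theta> in \<open>simp add: power2_eq_square field_simps\<close>)
    show "integrable lborel (\<lambda>t. exp (pi * \<theta> * t - 2 * pi * \<theta> * t\<^sup>2))"
      using gaussian_integrable[OF c, of "complex_of_real (pi * \<theta>)"] unfolding eq complex_of_real_integrable_eq by simp
    have "complex_of_real (\<integral>t. exp (pi * \<theta> * t - 2 * pi * \<theta> * t\<^sup>2) \<partial>lborel) = complex_of_real (sqrt (1 / (2 * \<theta>)) * exp (pi * \<theta> / 8))"
      using gaussian_integral[OF c, of "complex_of_real (pi * \<theta>)"] unfolding eq sq ex integral_complex_of_real unfolding of_real_mult[symmetric] .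
    then show "(\<integral>t. exp (pi * \<theta> * t - 2 * pi * \<theta> * t\<^sup>2) \<partial>lborel) = sqrt (1 / (2 * \<theta>)) * exp (pi * \<theta> / 8)"
      using of_real_eq_iff by blast
  qed
  have n1: "norm (1 + \<i>) = sqrt 2" by (simp add: cmod_def)
  have "norm (mordell \<theta> \<beta>) \<le> (\<integral>t. norm (mordell_fun \<theta> \<beta> (mordell_line t) * (1 + \<i>)) \<partial>lborel)"
    unfolding mordell_def by (rule integral_norm_bound)
  also have "\<dots> \<le> (\<integral>t. 2 * sqrt 2 * exp (pi * \<theta> * t - 2 * pi * \<theta> * t\<^sup>2) \<partial>lborel)"
  proof (rule integral_mono)
    show "integrable lborel (\<lambda>t. norm (mordell_fun \<theta> \<beta> (mordell_line t) * (1 + \<i>)))"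
      using mordell_integrable[OF \<theta>(1)] by (rule integrable_norm)
    show "integrable lborel (\<lambda>t. 2 * sqrt 2 * exp (pi * \<theta> * t - 2 * pi * \<theta> * t\<^sup>2))"
      using R(1) by (rule integrable_mult_right)
    fix t :: real
    have "norm (mordell_fun \<theta> \<beta> (mordell_line t)) \<le> 2 * exp (pi * \<theta> * t - 2 * pi * \<theta> * t\<^sup>2)"
    proof -
      have "norm (quad_exp \<theta> \<beta> (mordell_line t)) = exp (pi * \<theta> * t - 2 * pi * \<theta> * t\<^sup>2 - 2 * pi * \<beta> * t)"
        by (simp add: norm_quad_exp mordell_line_def power2_eq_square algebra_simps)
      then have "norm (mordell_fun \<theta> \<beta> (mordell_line t)) \<le> 2 * (min 1 (exp (2 * pi * t)) * exp (pi * \<theta> * t - 2 * pi * \<theta> * t\<^sup>2 - 2 * pi * \<beta> * t))"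
        using norm_mordell_fun_le[of \<theta> \<beta> t] by simp
      also have "min 1 (exp (2 * pi * t)) * exp (pi * \<theta> * t - 2 * pi * \<theta> * t\<^sup>2 - 2 * pi * \<beta> * t) \<le> exp (pi * \<theta> * t - 2 * pi * \<theta> * t\<^sup>2)"
      proof (cases "t \<ge> 0")
        case True
        then show ?thesis using \<beta> by (simp add: min_def)
      next
        case False
        then have "2 * pi * t \<le> 2 * pi * \<beta> * t"
          using \<beta> mult_right_mono_neg[of \<beta> 1 "2 * pi * t"] by (simp add: mult_ac mult_nonneg_nonpos)
        have "min 1 (exp (2 * pi * t)) * exp (pi * \<theta> * t - 2 * pi * \<theta> * t\<^sup>2 - 2 * pi * \<beta> * t)
            \<le> exp (2 * pi * t) * exp (pi * \<theta> * t - 2 * pi * \<theta> * t\<^sup>2 - 2 * pi * \<beta> * t)"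
          by (intro mult_right_mono) auto
        also have "\<dots> \<le> exp (pi * \<theta> * t - 2 * pi * \<theta> * t\<^sup>2)"
          unfolding exp_add[symmetric] exp_le_cancel_iff using \<open>2 * pi * t \<le> 2 * pi * \<beta> * t\<close> by linarith
        finally show ?thesis .
      qed
      finally show ?thesis by simp
    qed
    then show "norm (mordell_fun \<theta> \<beta> (mordell_line t) * (1 + \<i>)) \<le> 2 * sqrt 2 * exp (pi * \<theta> * t - 2 * pi * \<theta> * t\<^sup>2)"
      by (simp add: norm_mult n1)
  qed
  also have "\<dots> = 2 * sqrt 2 * (sqrt (1 / (2 * \<theta>)) * exp (pi * \<theta> / 8))"
    using R(2) by simp
  also have "\<dots> = 2 * exp (pi * \<theta> / 8) / sqrt \<theta>"
    by (simp add: real_sqrt_divide real_sqrt_mult)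
  also have "\<dots> \<le> 4 / sqrt \<theta>"
  proof (intro divide_right_mono)
    have "pi * \<theta> \<le> 4 * 1" using pi_less_4 \<theta> by (intro mult_mono) auto
    then have "exp (pi * \<theta> / 8) \<le> exp (1 / 2)" by simp
    also have "exp (1 / 2 :: real) \<le> 2" by (rule exp_half_le2)
    finally show "2 * exp (pi * \<theta> / 8) \<le> 4" by simp
  qed (use \<theta> in auto)
  finally show ?thesis .
qed

section \<open>Moving the line of integration across the pole at 0\<close>

definition mordell_strip :: "complex set" where
  "mordell_strip = {z. Re z - Im z < 1} \<inter> {z. Re z - Im z > -1}"

lemma mordell_strip: "convex mordell_strip" "open mordell_strip"
proof -
  have eq: "{z. Re z - Im z < 1} = {z. inner (1 - \<i>) z < 1}" "{z. Re z - Im z > - 1} = {z. inner (1 - \<i>) z > -1}"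
    by (auto simp: inner_complex_def)
  show "convex mordell_strip" "open mordell_strip"
    unfolding mordell_strip_def eq
    by (auto intro!: convex_Int convex_halfspace_lt convex_halfspace_gt open_Int open_halfspace_lt open_halfspace_gt)
qed

text \<open>\<open>Re z - Im z\<close> is \<open>- 1 / 2\<close> on \<open>mordell_line\<close> and
  \<open>1 / 2\<close> on its translate by 1, so both lines lie in the strip. Among the integers,
  the zeros of the denominator, only 0 satisfies the bound.\<close>

lemma exp_2pi_eq_1_strip:
  assumes "z \<in> mordell_strip" "exp (2 * pi * \<i> * z) = 1"
  shows "z = 0"
proof -
  have "2 * pi * Im z = 0" "\<exists>n::int. 2 * pi * Re z = of_int (2 * n) * pi"
    using assms(2) unfolding exp_eq_1 by auto
  then obtain n :: int where n: "Im z = 0" "Re z = of_int n" by auto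
  then have "of_int \<bar>n\<bar> < (1::real)" using assms(1) by (auto simp: mordell_strip_def)
  then have "n = 0" by linarith
  then show ?thesis using n by (simp add: complex_eq_iff)
qed

text \<open>This is \<open>z * mordell_fun \<theta> \<beta> z\<close> with the singularity at 0
  removed. The difference quotient is spelled out in the form that \<open>pole_lemma\<close> treats,
  so that the residue at 0 can be read off from Cauchy's integral formula.\<close>

definition mordell_reg :: "real \<Rightarrow> real \<Rightarrow> complex \<Rightarrow> complex" where
  "mordell_reg \<theta> \<beta> z = quad_exp \<theta> \<beta> z / (if z = 0 then deriv (\<lambda>z. exp (2 * pi * \<i> * z)) 0 else (exp (2 * pi * \<i> * z) - exp (2 * pi * \<i> * 0)) / (z - 0))"

lemma deriv_exp_2pi: "deriv (\<lambda>z. exp (2 * complex_of_real pi * \<i> * z)) 0 = 2 * pi * \<i>"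
  by (rule DERIV_imp_deriv) (auto intro!: derivative_eq_intros)

lemma mordell_reg_0: "mordell_reg \<theta> \<beta> 0 = 1 / (2 * pi * \<i>)"
  by (simp add: mordell_reg_def deriv_exp_2pi quad_exp_def)

lemma mordell_reg_holomorphic: "mordell_reg \<theta> \<beta> holomorphic_on mordell_strip"
proof -
  have "(\<lambda>z. if z = 0 then deriv (\<lambda>z. exp (2 * pi * \<i> * z)) 0 else (exp (2 * pi * \<i> * z) - exp (2 * pi * \<i> * 0)) / (z - 0)) holomorphic_on mordell_strip"
  proof (rule pole_lemma)
    show "0 \<in> interior mordell_strip"
      using mordell_strip(2) by (simp add: interior_open) (simp add: mordell_strip_def)
  qed (intro holomorphic_intros)
  moreover have "quad_exp \<theta> \<beta> holomorphic_on mordell_strip"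
    unfolding quad_exp_def by (intro holomorphic_intros)
  ultimately show ?thesis
    unfolding mordell_reg_def
    by (intro holomorphic_on_divide)
      (use exp_2pi_eq_1_strip in \<open>auto simp: deriv_exp_2pi\<close>)
qed

lemma mordell_fun_eq_reg: "z \<noteq> 0 \<Longrightarrow> mordell_fun \<theta> \<beta> z = mordell_reg \<theta> \<beta> z / (z - 0)"
  by (simp add: mordell_fun_def mordell_reg_def)

lemma mordell_fun_holomorphic: "mordell_fun \<theta> \<beta> holomorphic_on (mordell_strip - {0})"
  unfolding mordell_fun_def quad_exp_def
  by (intro holomorphic_intros) (use exp_2pi_eq_1_strip in auto)

text \<open>The heights \<open>T\<close> and \<open>T + 1\<close> differ so that the pole \<open>0\<close> does not lie on the diagonal that
  cuts the parallelogram into two triangles.\<close>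

lemma mordell_contour:
  fixes T :: real
  assumes T: "T > 0"
  defines "S \<equiv> T + 1"
  defines "a \<equiv> mordell_line (- S)" and "b \<equiv> mordell_line (- S) + 1"
    and "c \<equiv> mordell_line T + 1" and "d \<equiv> mordell_line T"
  shows "contour_integral (linepath a b) (mordell_fun \<theta> \<beta>) + contour_integral (linepath b c) (mordell_fun \<theta> \<beta>)
    = contour_integral (linepath a d) (mordell_fun \<theta> \<beta>) + contour_integral (linepath d c) (mordell_fun \<theta> \<beta>) + 1"
proof -
  let ?f = "mordell_fun \<theta> \<beta>"
  \<comment> \<open>\<open>g\<close> is constantly \<open>1 / 2\<close> on the diagonal from
    \<open>a\<close> to \<open>c\<close> and 0 at the pole. So the triangle \<open>a b c\<close>
    lies in the half plane \<open>g z > 0\<close> and contributes nothing, and the pole is left to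
    the triangle \<open>a c d\<close>.\<close>
  define g where "g = (\<lambda>z::complex. (2 * T + 1) * Re z - (2 * T + 2) * Im z)"
  have g_lin: "g = (\<lambda>z. inner (Complex (2 * T + 1) (- (2 * T + 2))) z)"
    by (auto simp: g_def inner_complex_def algebra_simps)
  have conv: "convex {z. g z > 0}" "convex {z. g z < 1}"
    unfolding g_lin by (rule convex_halfspace_gt convex_halfspace_lt)+
  have coords: "Re a = - 1 / 2 - S" "Im a = - S" "Re b = 1 / 2 - S" "Im b = - S" "Re c = 1 / 2 + T" "Im c = T"
    "Re d = - 1 / 2 + T" "Im d = T"
    by (simp_all add: a_def b_def c_def d_def mordell_line_def)
  have strip: "a \<in> mordell_strip" "b \<in> mordell_strip" "c \<in> mordell_strip" "d \<in> mordell_strip"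
    by (simp_all add: mordell_strip_def coords)
  have gpos: "g a > 0" "g b > 0" "g c > 0"
    unfolding g_def coords S_def using T by (simp_all add: algebra_simps)
  have seg: "closed_segment x y \<subseteq> K" if "x \<in> K" "y \<in> K" "convex K" for x y and K :: "complex set"
    using that by (rule closed_segment_subset)
  have hol: "?f holomorphic_on (mordell_strip \<inter> {z. g z > 0})"
    by (rule holomorphic_on_subset[OF mordell_fun_holomorphic]) (auto simp: g_def)
  have "convex (mordell_strip \<inter> {z. g z > 0})"
    by (intro convex_Int mordell_strip conv)
  then have tri1: "(?f has_contour_integral 0) (linepath a b +++ linepath b c +++ linepath c a)"
  proof (intro Cauchy_theorem_convex_simple[OF hol])
    assume C: "convex (mordell_strip \<inter> {z. g z > 0})"
    show "path_image (linepath a b +++ linepath b c +++ linepath c a) \<subseteq> mordell_strip \<inter> {z. g z > 0}"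
      using seg[OF _ _ C, of a b] seg[OF _ _ C, of b c] seg[OF _ _ C, of c a] strip gpos
      by (simp add: path_image_join)
  qed auto
  have cont: "?f contour_integrable_on (linepath x y)" if "0 \<notin> closed_segment x y" "x \<in> mordell_strip" "y \<in> mordell_strip" for x y
  proof (rule contour_integrable_continuous_linepath)
    show "continuous_on (closed_segment x y) ?f"
      using that seg[OF that(2,3) mordell_strip(1)]
      by (intro continuous_on_subset[OF holomorphic_on_imp_continuous_on[OF mordell_fun_holomorphic]]) blast
  qed
  have nz1: "0 \<notin> closed_segment x y" if "g x > 0" "g y > 0" for x y
    using seg[of x "{z. g z > 0}" y] that conv by (auto simp: g_def)
  \<comment> \<open>\<open>x\<close>, \<open>1 / 2\<close> and \<open>z\<close> are the barycentric
    coordinates of the pole 0 with respect to \<open>a\<close>, \<open>c\<close> and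
    \<open>d\<close>; being positive, they put it in the interior of that triangle.\<close>
  define x where "x = T / (2 * T + 1)"
  define z where "z = 1 / (2 * (2 * T + 1))"
  have xz: "x > 0" "z > 0" "x + 1/2 + z = 1" using T by (auto simp: x_def z_def field_simps)
  have comb: "x *\<^sub>R a + (1/2) *\<^sub>R c + z *\<^sub>R d = 0"
  proof -
    have "x * (2 * T + 1) = T" using T by (simp add: x_def)
    then have "x * T * 2 + x = T" by (simp add: algebra_simps)
    moreover have z: "z = 1 / 2 - x" using xz(3) by simp
    ultimately show ?thesis
      unfolding z by (simp add: complex_eq_iff coords S_def algebra_simps)
  qed
  have noncol: "\<not> collinear {a, c, d}"
  proof
    assume "collinear {a, c, d}"
    then have "collinear {0, c - a, d - a}"
      using collinear_3[of c a d] by (simp add: insert_commute)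
    then have "c - a = 0 \<or> d - a = 0 \<or> (\<exists>k. d - a = k *\<^sub>R (c - a))"
      unfolding collinear_lemma by blast
    then show False
    proof (elim disjE exE)
      assume "c - a = 0"
      then have "Im c - Im a = 0" by simp
      then show False using T by (simp add: coords S_def)
    next
      assume "d - a = 0"
      then have "Im d - Im a = 0" by simp
      then show False using T by (simp add: coords S_def)
    next
      fix k assume eq: "d - a = k *\<^sub>R (c - a)"
      have "Im d - Im a = k * (Im c - Im a)" "Re d - Re a = k * (Re c - Re a)"
        using arg_cong[OF eq, of Im] arg_cong[OF eq, of Re] by simp_all
      then have k: "2 * T + 1 = k * (2 * T + 1)" "2 * T + 1 = k * (2 * T + 2)"
        unfolding coords S_def by (simp_all add: algebra_simps)
      have "k = 1" using k(1) T by auto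
      then show False using k(2) by simp
    qed
  qed
  have int: "0 \<in> interior (convex hull {a, c, d})"
    unfolding interior_convex_hull_3_minimal[OF noncol, simplified] mem_Collect_eq
    using xz comb half_gt_zero[OF zero_less_one] by blast
  have wn: "winding_number (linepath a c +++ linepath c d +++ linepath d a) 0 = 1"
  proof -
    have "Im ((c - a) * cnj (c - 0)) > 0"
      unfolding S_def[symmetric] using T by (simp add: coords S_def algebra_simps)
    then show ?thesis using winding_number_triangle[OF int] by simp
  qed
  have nz2: "0 \<notin> closed_segment a c" "0 \<notin> closed_segment c d" "0 \<notin> closed_segment d a"
  proof -
    show "0 \<notin> closed_segment a c" by (rule nz1) (use gpos in auto)
    have "closed_segment c d \<subseteq> {z. Im z > 0}"
      by (rule seg) (use T in \<open>auto simp: coords convex_halfspace_Im_gt\<close>)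
    moreover have "closed_segment d a \<subseteq> {z. inner (1 - \<i>) z < 0}"
      by (rule seg) (auto simp: coords inner_complex_def intro: convex_halfspace_lt[of "1 - \<i>" 0, unfolded inner_complex_def, simplified])
    ultimately show "0 \<notin> closed_segment c d" "0 \<notin> closed_segment d a" by auto
  qed
  have "((\<lambda>w. mordell_reg \<theta> \<beta> w / (w - 0)) has_contour_integral 2 * pi * \<i> *
      winding_number (linepath a c +++ linepath c d +++ linepath d a) 0 * mordell_reg \<theta> \<beta> 0)
      (linepath a c +++ linepath c d +++ linepath d a)"
  proof (rule Cauchy_integral_formula_convex_simple[OF mordell_strip(1) mordell_reg_holomorphic])
    show "0 \<in> interior mordell_strip"
      unfolding interior_open[OF mordell_strip(2)] by (simp add: mordell_strip_def)
    show "path_image (linepath a c +++ linepath c d +++ linepath d a) \<subseteq> mordell_strip - {0}"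
      using seg[OF strip(1,3) mordell_strip(1)] seg[OF strip(3,4) mordell_strip(1)] seg[OF strip(4,1) mordell_strip(1)] nz2
      by (simp add: path_image_join) blast
  qed auto
  then have "((\<lambda>w. mordell_reg \<theta> \<beta> w / (w - 0)) has_contour_integral 1)
      (linepath a c +++ linepath c d +++ linepath d a)"
    unfolding wn mordell_reg_0 by simp
  then have tri2: "(?f has_contour_integral 1) (linepath a c +++ linepath c d +++ linepath d a)"
  proof (rule has_contour_integral_eq)
    fix x assume "x \<in> path_image (linepath a c +++ linepath c d +++ linepath d a)"
    then have "x \<noteq> 0" using nz2 by (auto simp: path_image_join)
    then show "mordell_reg \<theta> \<beta> x / (x - 0) = ?f x" using mordell_fun_eq_reg[of x] by simp
  qed
  define I where "I = (\<lambda>x y. contour_integral (linepath x y) ?f)"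
  have rev: "I x y = - I y x" for x y
    unfolding I_def by (metis contour_integral_reversepath reversepath_linepath valid_path_linepath)
  have hasI: "(?f has_contour_integral I x y) (linepath x y)" if "0 \<notin> closed_segment x y" "x \<in> mordell_strip" "y \<in> mordell_strip" for x y
    unfolding I_def by (rule has_contour_integral_integral[OF cont[OF that]])
  have hasI1: "(?f has_contour_integral I x y) (linepath x y)" if "g x > 0" "g y > 0" "x \<in> mordell_strip" "y \<in> mordell_strip" for x y
    by (rule hasI[OF nz1[OF that(1,2)] that(3,4)])
  have "(?f has_contour_integral (I a b + (I b c + I c a))) (linepath a b +++ linepath b c +++ linepath c a)"
    by (intro has_contour_integral_join hasI1 strip gpos) auto
  from contour_integral_unique[OF this] contour_integral_unique[OF tri1]
  have 1: "I a b + (I b c + I c a) = 0" by simp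
  have "(?f has_contour_integral (I a c + (I c d + I d a))) (linepath a c +++ linepath c d +++ linepath d a)"
    by (intro has_contour_integral_join hasI nz2 strip) auto
  from contour_integral_unique[OF this] contour_integral_unique[OF tri2]
  have 2: "I a c + (I c d + I d a) = 1" by simp
  have "I a b + I b c = I a d + I d c + 1"
    using 1 2 rev[of c a] rev[of d a] rev[of d c] by (simp add: algebra_simps)
  then show ?thesis unfolding I_def .
qed

lemma contour_integral_linepath_affine:
  fixes f :: "complex \<Rightarrow> complex" and a b :: real
  assumes ab: "a < b" and cont: "continuous_on {a..b} (\<lambda>t. f (p + v * t))"
  shows "contour_integral (linepath (p + v * a) (p + v * b)) f = (LBINT t:{a..b}. f (p + v * t) * v)"
proof -
  let ?k = "\<lambda>t::real. f (p + v * t) * v"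
  have ck: "continuous_on {a..b} ?k" by (intro continuous_intros cont)
  have "(?k has_integral integral {a..b} ?k) (cbox a b)"
    using integrable_integral[OF integrable_continuous_real[OF ck]] by simp
  from has_integral_affinity'[OF this, of "b - a" a]
  have "((\<lambda>x. ?k ((b - a) * x + a)) has_integral (integral {a..b} ?k /\<^sub>R (b - a))) {0..1}"
    using ab by simp
  then have "((\<lambda>x. (b - a) *\<^sub>R ?k ((b - a) * x + a)) has_integral (b - a) *\<^sub>R (integral {a..b} ?k /\<^sub>R (b - a))) {0..1}"
    by (rule has_integral_cmul)
  then have "((\<lambda>x. (b - a) *\<^sub>R ?k ((b - a) * x + a)) has_integral integral {a..b} ?k) {0..1}"
    using ab by simp
  moreover have "(b - a) *\<^sub>R ?k ((b - a) * x + a) = f (linepath (p + v * a) (p + v * b) x) * ((p + v * b) - (p + v * a))" for x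
    by (simp add: linepath_def scaleR_conv_of_real algebra_simps)
  ultimately have "(f has_contour_integral integral {a..b} ?k) (linepath (p + v * a) (p + v * b))"
    unfolding has_contour_integral_linepath by simp
  moreover have "(LBINT t:{a..b}. ?k t) = integral {a..b} ?k"
    by (intro set_borel_integral_eq_integral borel_integrable_atLeastAtMost' ck)
  ultimately show ?thesis by (metis contour_integral_unique)
qed

text \<open>The asymmetric interval matches the heights \<open>- (T + 1)\<close> and
  \<open>T\<close> of the parallelogram in \<open>mordell_contour\<close> for
  \<open>T = n + 1\<close>.\<close>

lemma integral_exhausting_tendsto:
  fixes k :: "real \<Rightarrow> complex"
  assumes "integrable lborel k"
  shows "(\<lambda>n. LBINT t:{- real (n + 2)..real (n + 1)}. k t) \<longlonglongrightarrow> (\<integral>t. k t \<partial>lborel)"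
  unfolding set_lebesgue_integral_def
proof (rule integral_dominated_convergence[where w = "\<lambda>t. norm (k t)"])
  show "AE t in lborel. (\<lambda>n. indicat_real {- real (n + 2)..real (n + 1)} t *\<^sub>R k t) \<longlonglongrightarrow> k t"
  proof (intro AE_I2 tendsto_eventually)
    fix t :: real
    obtain N where N: "real N > \<bar>t\<bar>" using reals_Archimedean2 by blast
    show "\<forall>\<^sub>F n in sequentially. indicat_real {- real (n + 2)..real (n + 1)} t *\<^sub>R k t = k t"
      using eventually_ge_at_top[of N] by eventually_elim (use N in \<open>auto simp: indicator_def\<close>)
  qed
qed (use assms in \<open>auto intro!: AE_I2 split: split_indicator\<close>)

lemma quad_exp_shift:
  "quad_exp \<theta> \<beta> (z + 1) = exp (pi * \<i> * \<theta> + 2 * pi * \<i> * \<beta>) * quad_exp \<theta> (\<beta> + \<theta>) z"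
  unfolding quad_exp_def exp_add[symmetric]
  by (rule arg_cong[where f = exp]) (simp add: power2_eq_square algebra_simps)

lemma mordell_fun_shift:
  "mordell_fun \<theta> \<beta> (z + 1) = exp (pi * \<i> * \<theta> + 2 * pi * \<i> * \<beta>) * mordell_fun \<theta> (\<beta> + \<theta>) z"
proof -
  have "exp (2 * pi * \<i> * (z + 1)) = exp (2 * pi * \<i> * z)"
    by (simp add: ring_distribs exp_add)
  then show ?thesis
    by (simp only: mordell_fun_def quad_exp_shift times_divide_eq_right)
qed

lemma norm_denominator_ge':
  "norm (exp (2 * pi * \<i> * z) - 1) \<ge> \<bar>exp (- 2 * pi * Im z) - 1\<bar>"
  using norm_triangle_ineq3[of "exp (2 * pi * \<i> * z)" 1] by simp

text \<open>Meant for the horizontal sides of the parallelogram. There \<open>Re z\<close> and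
  \<open>Im z\<close> have the same sign and a product of order \<open>Y\<^sup>2\<close>, so the
  quadratic part of the exponent beats the linear one, and \<open>exp (2 * pi * \<i> * z)\<close>
  has modulus at most \<open>1 / 2\<close> or at least \<open>2\<close>.\<close>

lemma mordell_fun_horizontal_bound:
  assumes Y: "Y \<ge> 1" and z: "\<bar>Im z\<bar> = Y" "Re z * Im z \<ge> (Y - 1 / 2) * Y" and "\<theta> > 0"
  shows "norm (mordell_fun \<theta> \<beta> z) \<le> 2 * exp (- 2 * pi * Y * (\<theta> * (Y - 1 / 2) - \<bar>\<beta>\<bar>))"
proof -
  have big: "exp (2 * pi * Y) \<ge> 2"
  proof -
    have "1 \<le> 2 * pi * Y" using Y pi_gt3 mult_mono[of 1 "2 * pi" 1 Y] by simp
    then show ?thesis using exp_ge_add_one_self[of "2 * pi * Y"] by linarith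
  qed
  have "\<bar>exp (- 2 * pi * Im z) - 1\<bar> \<ge> 1 / 2"
  proof (cases "Im z \<ge> 0")
    case True
    then have "exp (- 2 * pi * Im z) \<le> 1 / 2" using z big by (simp add: exp_minus field_simps)
    then show ?thesis by linarith
  next
    case False
    then have "Im z = - Y" using z by linarith
    then have "exp (- 2 * pi * Im z) \<ge> 2" using big by simp
    then show ?thesis by linarith
  qed
  then have den: "norm (exp (2 * pi * \<i> * z) - 1) \<ge> 1 / 2"
    using norm_denominator_ge'[of z] by linarith
  have "norm (quad_exp \<theta> \<beta> z) \<le> exp (- 2 * pi * Y * (\<theta> * (Y - 1 / 2) - \<bar>\<beta>\<bar>))"
  proof -
    have "- Im z * \<beta> \<le> Y * \<bar>\<beta>\<bar>"
      using z abs_ge_self[of "- Im z * \<beta>"] by (simp add: abs_mult)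
    moreover have "\<theta> * ((Y - 1 / 2) * Y) \<le> \<theta> * (Re z * Im z)"
      using assms by (intro mult_left_mono) auto
    ultimately have "- Im z * (\<theta> * Re z + \<beta>) \<le> - Y * (\<theta> * (Y - 1 / 2) - \<bar>\<beta>\<bar>)"
      by (simp add: algebra_simps)
    then have "2 * pi * (- Im z * (\<theta> * Re z + \<beta>)) \<le> 2 * pi * (- Y * (\<theta> * (Y - 1 / 2) - \<bar>\<beta>\<bar>))"
      by (intro mult_left_mono) auto
    then show ?thesis unfolding norm_quad_exp by (simp add: mult.assoc)
  qed
  then have "norm (quad_exp \<theta> \<beta> z) / norm (exp (2 * pi * \<i> * z) - 1) \<le> exp (- 2 * pi * Y * (\<theta> * (Y - 1 / 2) - \<bar>\<beta>\<bar>)) / (1 / 2)"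
    using den by (intro frac_le) auto
  then show ?thesis by (simp add: mordell_fun_def norm_divide)
qed

text \<open>Moving the line by \<open>1\<close> crosses the pole at \<open>0\<close>, and translating it back turns \<open>\<beta>\<close> into \<open>\<beta> + \<theta>\<close>.\<close>

lemma mordell_shift_theta:
  assumes \<theta>: "\<theta> > 0"
  shows "exp (pi * \<i> * \<theta> + 2 * pi * \<i> * \<beta>) * mordell \<theta> (\<beta> + \<theta>) = mordell \<theta> \<beta> + 1"
proof -
  define w where "w = exp (pi * \<i> * \<theta> + 2 * pi * \<i> * \<beta>)"
  define B where "B = (\<lambda>Y. 2 * exp (- 2 * pi * Y * (\<theta> * (Y - 1 / 2) - \<bar>\<beta>\<bar>)))"
  define k where "k = (\<lambda>\<beta> t. mordell_fun \<theta> \<beta> (mordell_line t) * (1 + \<i>))"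
  define hb where "hb = (\<lambda>n. contour_integral (linepath (mordell_line (- real (n + 2))) (mordell_line (- real (n + 2)) + 1)) (mordell_fun \<theta> \<beta>))"
  define ht where "ht = (\<lambda>n. contour_integral (linepath (mordell_line (real (n + 1))) (mordell_line (real (n + 1)) + 1)) (mordell_fun \<theta> \<beta>))"
  define IR where "IR = (\<lambda>\<beta> n. LBINT t:{- real (n + 2)..real (n + 1)}. k \<beta> t)"
  have contF: "continuous_on S (\<lambda>t. mordell_fun \<theta> \<beta> (mordell_line t))" for S \<beta>
    unfolding mordell_fun_def quad_exp_def
    by (intro continuous_intros) (use denominator_nonzero in auto)
  have left: "contour_integral (linepath (mordell_line (- real (n + 2))) (mordell_line (real (n + 1)))) (mordell_fun \<theta> \<beta>) = IR \<beta> n" for n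
    using contour_integral_linepath_affine[of "- real (n + 2)" "real (n + 1)" "mordell_fun \<theta> \<beta>" "- 1 / 2" "1 + \<i>"]
      contF[of _ \<beta>] unfolding mordell_line_def[symmetric] IR_def k_def by simp
  have shift: "mordell_fun \<theta> \<beta> (mordell_line t + 1) = w * mordell_fun \<theta> (\<beta> + \<theta>) (mordell_line t)" for t
    by (simp only: mordell_fun_shift w_def)
  have right: "contour_integral (linepath (mordell_line (- real (n + 2)) + 1) (mordell_line (real (n + 1)) + 1)) (mordell_fun \<theta> \<beta>) = w * IR (\<beta> + \<theta>) n" for n
  proof -
    have line: "1 / 2 + (1 + \<i>) * complex_of_real t = mordell_line t + 1" for t
      by (simp add: mordell_line_def)
    have "continuous_on {- real (n + 2)..real (n + 1)} (\<lambda>t. mordell_fun \<theta> \<beta> (mordell_line t + 1))"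
      unfolding shift by (intro continuous_intros contF)
    then have "contour_integral (linepath (mordell_line (- real (n + 2)) + 1) (mordell_line (real (n + 1)) + 1)) (mordell_fun \<theta> \<beta>)
       = (LBINT t:{- real (n + 2)..real (n + 1)}. w * k (\<beta> + \<theta>) t)"
      using contour_integral_linepath_affine[of "- real (n + 2)" "real (n + 1)" "mordell_fun \<theta> \<beta>" "1 / 2" "1 + \<i>"]
      unfolding line shift k_def by (simp add: mult.assoc)
    then show ?thesis
      unfolding IR_def set_lebesgue_integral_def by (simp add: mult_scaleR_right[symmetric] del: mult_scaleR_right)
  qed
  have lim: "IR \<beta>' \<longlonglongrightarrow> mordell \<theta> \<beta>'" for \<beta>'
    unfolding IR_def mordell_def k_def by (intro integral_exhausting_tendsto mordell_integrable \<theta>)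
  have eq: "hb n + w * IR (\<beta> + \<theta>) n = IR \<beta> n + ht n + 1" for n
    using mordell_contour[of "real (n + 1)" \<theta> \<beta>] left[of n] right[of n]
    unfolding hb_def ht_def by (simp add: algebra_simps)
  have hint: "norm (contour_integral (linepath (mordell_line s) (mordell_line s + 1)) (mordell_fun \<theta> \<beta>)) \<le> B \<bar>s\<bar>"
    if s: "\<bar>s\<bar> \<ge> 1" for s
  proof -
    let ?p = "linepath (mordell_line s) (mordell_line s + 1)"
    have seg: "\<bar>Im z\<bar> = \<bar>s\<bar>" "Re z * Im z \<ge> (\<bar>s\<bar> - 1 / 2) * \<bar>s\<bar>" if z: "z \<in> closed_segment (mordell_line s) (mordell_line s + 1)" for z
    proof -
      obtain u :: real where u: "0 \<le> u" "u \<le> 1" "z = mordell_line s + u"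
        using z unfolding closed_segment_def
        by (auto simp: scaleR_conv_of_real algebra_simps intro: that)
      then have reim: "Re z = s - 1 / 2 + u" "Im z = s" by (auto simp: mordell_line_def)
      then show "\<bar>Im z\<bar> = \<bar>s\<bar>" by simp
      show "Re z * Im z \<ge> (\<bar>s\<bar> - 1 / 2) * \<bar>s\<bar>"
        using u(1,2) mult_nonneg_nonneg[of s u] mult_nonpos_nonneg[of s "1 - u"] unfolding reim by (cases "s \<ge> 0") (auto simp: algebra_simps)
    qed
    have "continuous_on (closed_segment (mordell_line s) (mordell_line s + 1)) (mordell_fun \<theta> \<beta>)"
      unfolding mordell_fun_def quad_exp_def
    proof (intro continuous_intros ballI)
      fix z assume z: "z \<in> closed_segment (mordell_line s) (mordell_line s + 1)"
      have "\<bar>Im z\<bar> > 0" using seg(1)[OF z] s by linarith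
      then have "exp (- 2 * pi * Im z) \<noteq> 1" by simp
      then show "exp (complex_of_real (2 * pi) * \<i> * z) - 1 \<noteq> 0"
        using norm_denominator_ge'[of z] by force
    qed
    then have "(mordell_fun \<theta> \<beta> has_contour_integral contour_integral ?p (mordell_fun \<theta> \<beta>)) ?p"
      by (intro has_contour_integral_integral contour_integrable_continuous_linepath)
    then have "norm (contour_integral ?p (mordell_fun \<theta> \<beta>)) \<le> B \<bar>s\<bar> * norm (mordell_line s + 1 - mordell_line s)"
      unfolding B_def
      by (rule has_contour_integral_bound_linepath)
         (use mordell_fun_horizontal_bound[OF s seg \<theta>] in auto)
    then show ?thesis by simp
  qed
  have B0: "(\<lambda>n. B (real (n + m))) \<longlonglongrightarrow> 0" for m
    unfolding B_def using \<theta> by real_asymp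
  have "hb \<longlonglongrightarrow> 0"
    by (rule Lim_null_comparison[OF _ B0[of 2]]) (use hint[of "- real (_ + 2)"] in \<open>auto simp: hb_def add_ac intro!: always_eventually\<close>)
  moreover have "ht \<longlonglongrightarrow> 0"
    by (rule Lim_null_comparison[OF _ B0[of 1]]) (use hint[of "real (_ + 1)"] in \<open>auto simp: ht_def add_ac intro!: always_eventually\<close>)
  ultimately have "(\<lambda>n. hb n + w * IR (\<beta> + \<theta>) n) \<longlonglongrightarrow> 0 + w * mordell \<theta> (\<beta> + \<theta>)"
    "(\<lambda>n. IR \<beta> n + ht n + 1) \<longlonglongrightarrow> mordell \<theta> \<beta> + 0 + 1"
    by (intro tendsto_intros lim; simp)+
  then have "0 + w * mordell \<theta> (\<beta> + \<theta>) = mordell \<theta> \<beta> + 0 + 1"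
    unfolding eq by (rule LIMSEQ_unique)
  then show ?thesis unfolding w_def by simp
qed

section \<open>Incomplete quadratic Gauss sums\<close>

text \<open>The linear phase \<beta> is kept arbitrary because reciprocity does not preserve any
  particular value of it; the final bound is uniform in \<beta>.\<close>

definition quad_sum :: "real \<Rightarrow> real \<Rightarrow> nat \<Rightarrow> complex" where
  "quad_sum \<theta> \<beta> N = (\<Sum>n<N. quad_exp \<theta> \<beta> (of_nat n))"

lemma quad_exp_Suc:
  "quad_exp \<theta> \<beta> (of_nat (Suc n)) = quad_exp \<theta> \<beta> (of_nat n) * exp (pi * \<i> * \<theta> + 2 * pi * \<i> * (\<beta> + n * \<theta>))"
  unfolding quad_exp_def exp_add[symmetric]
  by (rule arg_cong[where f = exp]) (simp add: power2_eq_square algebra_simps)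

lemma norm_quad_exp_of_nat [simp]: "norm (quad_exp \<theta> \<beta> (of_nat n)) = 1"
  by (simp add: norm_quad_exp)

lemma norm_quad_sum_le: "norm (quad_sum \<theta> \<beta> N) \<le> N"
  unfolding quad_sum_def by (rule order.trans[OF sum_norm_le[where g = "\<lambda>_. 1"]]) auto

text \<open>Each shift of \<beta> by \<theta> crosses one pole and adds 1; the phases accumulated by
  the earlier shifts turn these ones into the terms of the Gauss sum.\<close>

lemma mordell_shift_theta_iterate:
  assumes "\<theta> > 0"
  shows "quad_exp \<theta> \<beta> (of_nat N) * mordell \<theta> (\<beta> + N * \<theta>) = mordell \<theta> \<beta> + quad_sum \<theta> \<beta> N"
proof (induction N)
  case 0
  then show ?case by (simp add: quad_sum_def quad_exp_def)
next
  case (Suc N)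
  have "quad_exp \<theta> \<beta> (of_nat (Suc N)) * mordell \<theta> (\<beta> + Suc N * \<theta>)
    = quad_exp \<theta> \<beta> (of_nat N) * (exp (pi * \<i> * \<theta> + 2 * pi * \<i> * (\<beta> + N * \<theta>)) * mordell \<theta> (\<beta> + N * \<theta> + \<theta>))"
    unfolding quad_exp_Suc by (simp add: algebra_simps)
  also have "\<dots> = quad_exp \<theta> \<beta> (of_nat N) * mordell \<theta> (\<beta> + N * \<theta>) + quad_exp \<theta> \<beta> (of_nat N)"
    using mordell_shift_theta[OF assms, of "\<beta> + N * \<theta>"] by (simp add: distrib_left)
  finally show ?case using Suc by (simp add: quad_sum_def)
qed

text \<open>Integer shifts of \<beta> produce the terms of the dual sum, with
  \<open>- 1 / \<theta>\<close> in place of \<theta>. Together with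
  \<open>mordell_shift_theta_iterate\<close> this evaluates one Mordell integral in two ways, and
  that is the reciprocity.\<close>

lemma mordell_shift_int_iterate:
  assumes "\<theta> > 0"
  shows "mordell \<theta> (\<beta> + real m) = mordell \<theta> \<beta>
    + (1 + \<i>) / sqrt 2 * exp (- pi * \<i> * \<beta>\<^sup>2 / \<theta>) / sqrt \<theta> * quad_sum (- 1 / \<theta>) (- \<beta> / \<theta>) m"
proof (induction m)
  case 0
  then show ?case by (simp add: quad_sum_def)
next
  case (Suc m)
  have "exp (- pi * \<i> * (\<beta> + real m)\<^sup>2 / \<theta>) = exp (- pi * \<i> * \<beta>\<^sup>2 / \<theta>) * quad_exp (- 1 / \<theta>) (- \<beta> / \<theta>) (of_nat m)"
    unfolding quad_exp_def exp_add[symmetric]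
    by (rule arg_cong[where f = exp]) (use assms in \<open>simp add: power2_eq_square field_simps\<close>)
  then have "mordell \<theta> (\<beta> + real m + 1) = mordell \<theta> (\<beta> + real m) +
    (1 + \<i>) / sqrt 2 * (exp (- pi * \<i> * \<beta>\<^sup>2 / \<theta>) * quad_exp (- 1 / \<theta>) (- \<beta> / \<theta>) (of_nat m)) / sqrt \<theta>"
    using mordell_shift_int[OF assms, of "\<beta> + real m"] by (simp only: of_real_power)
  also have "\<dots> = mordell \<theta> (\<beta> + real m) + (1 + \<i>) / sqrt 2 * exp (- pi * \<i> * \<beta>\<^sup>2 / \<theta>) / sqrt \<theta> * quad_exp (- 1 / \<theta>) (- \<beta> / \<theta>) (of_nat m)"
    by simp
  finally have "mordell \<theta> (\<beta> + real m + 1) = \<dots>" .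
  moreover have "\<beta> + real (Suc m) = \<beta> + real m + 1" by simp
  ultimately show ?case unfolding Suc
    by (simp only: quad_sum_def sum.lessThan_Suc distrib_left add.assoc of_real_power)
qed

lemma norm_mordell_shift_int_le:
  assumes "\<theta> > 0"
  shows "norm (mordell \<theta> (\<beta> + real m)) \<le> norm (mordell \<theta> \<beta>) + norm (quad_sum (- 1 / \<theta>) (- \<beta> / \<theta>) m) / sqrt \<theta>"
proof -
  have "norm ((1 + \<i>) / complex_of_real (sqrt 2)) = 1" unfolding norm_divide by (simp add: cmod_def)
  moreover have "norm (exp (- pi * \<i> * \<beta>\<^sup>2 / \<theta>)) = 1" by simp
  ultimately have "norm ((1 + \<i>) / sqrt 2 * exp (- pi * \<i> * \<beta>\<^sup>2 / \<theta>) / sqrt \<theta> * quad_sum (- 1 / \<theta>) (- \<beta> / \<theta>) m)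
     = norm (quad_sum (- 1 / \<theta>) (- \<beta> / \<theta>) m) / sqrt \<theta>"
    using assms by (simp only: norm_mult norm_divide[of _ "complex_of_real (sqrt \<theta>)"]) simp
  then show ?thesis
    unfolding mordell_shift_int_iterate[OF assms] of_real_power
    by (metis norm_triangle_ineq)
qed

lemma quad_exp_add_int: "quad_exp \<theta> (\<beta> + of_int k) (of_nat n) = quad_exp \<theta> \<beta> (of_nat n)"
proof -
  have "quad_exp \<theta> (\<beta> + of_int k) (of_nat n) = quad_exp \<theta> \<beta> (of_nat n) * exp (2 * pi * \<i> * of_int (k * int n))"
    unfolding quad_exp_def exp_add[symmetric]
    by (rule arg_cong[where f = exp]) (simp add: algebra_simps)
  also have "exp (2 * pi * \<i> * of_int (k * int n)) = 1"
    unfolding exp_eq_1 by (auto intro!: exI[of _ "k * int n"])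
  finally show ?thesis by simp
qed

lemma quad_sum_add_int: "quad_sum \<theta> (\<beta> + of_int k) N = quad_sum \<theta> \<beta> N"
  by (simp add: quad_sum_def quad_exp_add_int)

text \<open>Since \<open>n\<^sup>2\<close> and \<open>n\<close> have the same parity, an integer
  part \<open>k\<close> of \<theta> acts like the linear phase \<open>k / 2\<close>.\<close>

lemma quad_sum_theta_add_int: "quad_sum (\<theta> + of_int k) \<beta> N = quad_sum \<theta> (\<beta> + of_int k / 2) N"
proof -
  have "quad_exp (\<theta> + of_int k) \<beta> (of_nat n) = quad_exp \<theta> (\<beta> + of_int k / 2) (of_nat n)" for n
  proof -
    have "even (int n * (int n - 1))" by simp
    then obtain j where j: "int n * (int n - 1) = 2 * j" by (elim evenE)
    then have "of_int (int n * (int n - 1)) = (of_int (2 * j) :: complex)" by (rule arg_cong)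
    then have j': "of_nat n * (of_nat n - 1) = 2 * complex_of_int j" by simp
    have "pi * \<i> * of_int k * (of_nat n * (of_nat n - 1)) = 2 * pi * \<i> * of_int (k * j)"
      unfolding j' by simp
    then have "quad_exp (\<theta> + of_int k) \<beta> (of_nat n) = quad_exp \<theta> (\<beta> + of_int k / 2) (of_nat n) * exp (2 * pi * \<i> * of_int (k * j))"
      unfolding quad_exp_def exp_add[symmetric]
      by (intro arg_cong[where f = exp]) (simp add: power2_eq_square algebra_simps)
    also have "exp (2 * pi * \<i> * of_int (k * j)) = 1"
      unfolding exp_eq_1 by (auto intro!: exI[of _ "k * j"])
    finally show ?thesis by simp
  qed
  then show ?thesis by (simp add: quad_sum_def)
qed

lemma cnj_quad_sum: "cnj (quad_sum \<theta> \<beta> N) = quad_sum (- \<theta>) (- \<beta>) N"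
  unfolding quad_sum_def quad_exp_def cnj_sum
  by (intro sum.cong refl) (simp add: exp_cnj algebra_simps)

text \<open>After reduction of \<beta> modulo 1, write
  \<open>\<beta>1 + N * \<theta> = \<beta>2 + m\<close> with an integer \<open>m\<close> and a
  fractional part \<open>\<beta>2\<close>. Shifts by \<theta> lead from \<open>\<beta>1\<close> to
  this point, integer shifts from \<open>\<beta>2\<close>. The two Mordell integrals left over have
  their phase in \<open>[0, 1]\<close> and cost \<open>4 / sqrt \<theta>\<close> each.\<close>

lemma quad_sum_reciprocity:
  assumes \<theta>: "0 < \<theta>" "\<theta> \<le> 1"
  obtains \<beta>' m where "real m \<le> \<theta> * N + 1"
    "norm (quad_sum \<theta> \<beta> N) \<le> (8 + norm (quad_sum (- 1 / \<theta>) \<beta>' m)) / sqrt \<theta>"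
proof -
  define \<beta>1 where "\<beta>1 = frac \<beta>"
  define m where "m = nat \<lfloor>\<beta>1 + N * \<theta>\<rfloor>"
  define \<beta>2 where "\<beta>2 = frac (\<beta>1 + N * \<theta>)"
  have \<beta>1: "0 \<le> \<beta>1" "\<beta>1 \<le> 1" by (simp_all add: \<beta>1_def frac_lt_1 less_imp_le)
  have \<beta>2: "0 \<le> \<beta>2" "\<beta>2 \<le> 1" by (simp_all add: \<beta>2_def frac_lt_1 less_imp_le)
  have "0 \<le> \<beta>1 + N * \<theta>" using \<beta>1 \<theta> by simp
  then have m: "\<beta>1 + N * \<theta> = \<beta>2 + real m" by (simp add: \<beta>2_def m_def frac_def)
  have m_le: "real m \<le> \<theta> * N + 1" using m \<beta>1 \<beta>2 by (simp add: mult.commute)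
  have "quad_sum \<theta> \<beta> N = quad_sum \<theta> \<beta>1 N"
    using quad_sum_add_int[of \<theta> \<beta>1 "\<lfloor>\<beta>\<rfloor>" N] by (simp add: \<beta>1_def frac_def)
  also have "\<dots> = quad_exp \<theta> \<beta>1 (of_nat N) * mordell \<theta> (\<beta>1 + N * \<theta>) - mordell \<theta> \<beta>1"
    using mordell_shift_theta_iterate[OF \<theta>(1), of \<beta>1 N] by simp
  also have "norm \<dots> \<le> norm (mordell \<theta> (\<beta>2 + real m)) + norm (mordell \<theta> \<beta>1)"
    unfolding m by (rule order.trans[OF norm_triangle_ineq4]) (simp add: norm_mult)
  also have "\<dots> \<le> norm (mordell \<theta> \<beta>2) + norm (quad_sum (- 1 / \<theta>) (- \<beta>2 / \<theta>) m) / sqrt \<theta> + norm (mordell \<theta> \<beta>1)"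
    using norm_mordell_shift_int_le[OF \<theta>(1)] by (intro add_right_mono)
  also have "\<dots> \<le> 4 / sqrt \<theta> + norm (quad_sum (- 1 / \<theta>) (- \<beta>2 / \<theta>) m) / sqrt \<theta> + 4 / sqrt \<theta>"
    using norm_mordell_le[OF \<theta>] \<beta>1 \<beta>2 by (intro add_mono) auto
  also have "\<dots> = (8 + norm (quad_sum (- 1 / \<theta>) (- \<beta>2 / \<theta>) m)) / sqrt \<theta>"
    by (simp add: add_divide_distrib)
  finally show ?thesis using that m_le by blast
qed

text \<open>The numerator is the denominator of the next reciprocity step. Periodicity in \<theta>
  and complex conjugation bring it down to at most half of \<open>q\<close>, so that the
  denominators at least halve.\<close>

lemma quad_sum_reduce:
  fixes p :: int and q :: nat
  assumes "q > 1" "coprime p (int q)"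
  obtains r :: nat and \<beta>' where "0 < r" "2 * r \<le> q" "coprime r q"
    "norm (quad_sum (p / q) \<beta> N) = norm (quad_sum (r / q) \<beta>' N)"
proof -
  define s where "s = p mod int q"
  define k where "k = p div int q"
  have p: "p = s + k * int q" by (simp add: s_def k_def)
  have cop: "coprime s (int q)" using assms(2) unfolding s_def using assms(1) by simp
  have s: "0 \<le> s" "s < int q" using assms by (simp_all add: s_def)
  have "s \<noteq> 0" using cop assms(1) by auto
  have eq: "real_of_int p / real q = s / q + of_int k"
    using assms(1) unfolding p by (simp add: field_simps)
  have n1: "quad_sum (p / q) \<beta> N = quad_sum (s / q) (\<beta> + of_int k / 2) N"
    unfolding eq quad_sum_theta_add_int ..
  show ?thesis
  proof (cases "2 * s \<le> int q")
    case True
    then show ?thesis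
    proof (intro that[of "nat s" "\<beta> + of_int k / 2"])
      have "coprime (int (nat s)) (int q)" using s cop by simp
      then show "coprime (nat s) q" by (simp only: coprime_int_iff)
    qed (use n1 s \<open>s \<noteq> 0\<close> True in auto)
  next
    case False
    define r where "r = nat (int q - s)"
    have r: "int r = int q - s" using s by (simp add: r_def)
    have "real r = real_of_int (int q - s)" using r by (metis of_int_of_nat_eq)
    then have eq2: "real_of_int s / real q = - (r / q) + of_int 1"
      using assms(1) by (simp add: field_simps)
    have "quad_sum (s / q) (\<beta> + of_int k / 2) N = quad_sum (- (r / q)) (- (- (\<beta> + of_int k / 2 + of_int 1 / 2))) N"
      unfolding eq2 quad_sum_theta_add_int by (simp only: minus_minus)
    also have "\<dots> = cnj (quad_sum (r / q) (- (\<beta> + of_int k / 2 + of_int 1 / 2)) N)"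
      unfolding cnj_quad_sum ..
    finally have "norm (quad_sum (p / q) \<beta> N) = norm (quad_sum (r / q) (- (\<beta> + of_int k / 2 + of_int 1 / 2)) N)"
      unfolding n1 by simp
    moreover have "coprime r q"
    proof -
      have "coprime (int q - s) (int q)" using cop
        by (metis coprime_commute coprime_iff_gcd_eq_1 gcd.commute gcd_diff2)
      then show ?thesis unfolding r[symmetric] by (simp only: coprime_int_iff)
    qed
    ultimately show ?thesis
      using r s False by (intro that[of r]) auto
  qed
qed

text \<open>The term \<open>- 32\<close> makes the induction work: a reciprocity step multiplies it by at least \<open>sqrt 2\<close>,
  which pays for the errors of that step.\<close>

theorem norm_quad_sum_rational_le:
  fixes p :: int and q :: nat
  assumes "q > 0" "coprime p (int q)"
  shows "norm (quad_sum (p / q) \<beta> N) \<le> N / sqrt q + 32 * sqrt q - 32"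
  using assms
proof (induction q arbitrary: p \<beta> N rule: less_induct)
  case (less q)
  show ?case
  proof (cases "q = 1")
    \<comment> \<open>For \<open>q = 1\<close> the constants cancel, \<open>32 - 32 = 0\<close>, and
      the claim is the trivial bound \<open>N\<close>.\<close>
    case True
    then show ?thesis using norm_quad_sum_le[of "p / q" \<beta> N] by simp
  next
    case False
    then have q1: "q > 1" using less.prems by simp
    obtain r \<beta>1 where r: "0 < r" "2 * r \<le> q" "coprime r q"
      "norm (quad_sum (p / q) \<beta> N) = norm (quad_sum (r / q) \<beta>1 N)"
      by (rule quad_sum_reduce[OF q1 less.prems(2)])
    have \<theta>: "0 < real r / real q" "real r / real q \<le> 1" using r less.prems by auto
    obtain \<beta>2 m where m: "real m \<le> r / q * N + 1"
      "norm (quad_sum (r / q) \<beta>1 N) \<le> (8 + norm (quad_sum (- 1 / (r / q)) \<beta>2 m)) / sqrt (r / q)"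
      by (rule quad_sum_reciprocity[OF \<theta>])
    have "coprime (- int q) (int r)" using r(3) by (simp add: coprime_commute)
    then have "norm (quad_sum (of_int (- int q) / r) \<beta>2 m) \<le> m / sqrt r + 32 * sqrt r - 32"
      using r by (intro less.IH) auto
    then have IH: "norm (quad_sum (- 1 / (r / q)) \<beta>2 m) \<le> m / sqrt r + 32 * sqrt r - 32"
      by simp
    define x where "x = sqrt r"
    define y where "y = sqrt q"
    have xy: "x > 0" "y > 0" "x\<^sup>2 = r" "y\<^sup>2 = q" "x \<ge> 1" using r less.prems by (auto simp: x_def y_def)
    \<comment> \<open>The number of terms \<open>m\<close> exceeds \<open>r / q * N\<close> by at
      most 1. With the 8 from reciprocity and the \<open>- 32\<close> of the induction hypothesis
      this leaves \<open>(8 - 32 + 1) * (y / x)\<close>, which has to be at most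
      \<open>- 32\<close>. The ratio is at least \<open>sqrt 2\<close>, and \<open>32 / 23\<close>
      lies just below that.\<close>
    have yx: "y / x \<ge> 32 / 23"
    proof -
      have "2 * real r \<le> real q" using r(2) by linarith
      then have "2 * x\<^sup>2 \<le> y\<^sup>2" unfolding xy(3,4) .
      then have "1024 * x\<^sup>2 \<le> 529 * y\<^sup>2" using zero_le_power2[of x] by linarith
      then have "(32 * x)\<^sup>2 \<le> (23 * y)\<^sup>2" by (simp only: power_mult_distrib) simp
      then have "32 * x \<le> 23 * y" by (rule power2_le_imp_le) (use xy(2) in simp)
      then show ?thesis using xy(1) by (simp add: pos_le_divide_eq)
    qed
    have "norm (quad_sum (p / q) \<beta> N) \<le> (8 + norm (quad_sum (- 1 / (r / q)) \<beta>2 m)) / sqrt (r / q)"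
      using r(4) m(2) by simp
    also have "\<dots> \<le> (8 + (m / x + 32 * x - 32)) / (x / y)"
    proof -
      have "sqrt (r / q) = x / y" by (simp add: real_sqrt_divide x_def y_def)
      moreover have "8 + norm (quad_sum (- 1 / (r / q)) \<beta>2 m) \<le> 8 + (m / x + 32 * x - 32)"
        using IH unfolding x_def by linarith
      ultimately show ?thesis using xy(1,2) by (simp only: divide_right_mono divide_nonneg_nonneg less_imp_le)
    qed
    also have "\<dots> \<le> (8 + ((r / q * N + 1) / x + 32 * x - 32)) / (x / y)"
    proof (rule divide_right_mono)
      have "m / x \<le> (r / q * N + 1) / x" using m(1) xy(1) by (simp only: divide_right_mono less_imp_le)
      then show "8 + (m / x + 32 * x - 32) \<le> 8 + ((r / q * N + 1) / x + 32 * x - 32)" by linarith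
      show "0 \<le> x / y" using xy(1,2) by simp
    qed
    also have "\<dots> = N / y + 32 * y - 24 * (y / x) + y / x / x"
    proof -
      have "real r / real q * N + 1 = x * x / (y * y) * N + 1"
        unfolding xy(3,4)[symmetric] by (simp add: power2_eq_square)
      then have "(real r / real q * N + 1) / x / (x / y) = x * x / (y * y) * N / x / (x / y) + 1 / x / (x / y)"
        by (simp only: add_divide_distrib)
      also have "x * x / (y * y) * N / x / (x / y) = N / y"
        using xy(1,2) by (simp add: divide_simps)
      also have "1 / x / (x / y) = y / x / x" by simp
      finally have 1: "(real r / real q * N + 1) / x / (x / y) = N / y + y / x / x" .
      have 2: "32 * x / (x / y) = 32 * y" "24 / (x / y) = 24 * (y / x)" using xy(1,2) by simp_all
      have 3: "(8 + (u + v - 32)) / c = u / c + v / c - 24 / c" for u v c :: real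
        by (simp add: divide_inverse algebra_simps)
      show ?thesis unfolding 3 1 2 by linarith
    qed
    also have "\<dots> \<le> N / y + 32 * y - 24 * (y / x) + y / x"
    proof -
      have "y / x / x \<le> y / x / 1" using xy(1,2,5) by (intro divide_left_mono) auto
      then show ?thesis by simp
    qed
    also have "\<dots> \<le> N / y + 32 * y - 32" using yx by linarith
    finally show ?thesis unfolding y_def .
  qed
qed

section \<open>Discrete Fourier analysis of the counting function\<close>

text \<open>The lower bound has this shape because
  \<open>1 / (t * (1 - t)) = 1 / t + 1 / (1 - t)\<close>, which separates the two ends of the
  frequency range.\<close>

lemma sin_pi_ge:
  assumes "0 \<le> t" "t \<le> 1"
  shows "sin (pi * t) \<ge> t * (1 - t)"
proof -
  \<comment> \<open>For \<open>x = pi * s < 1.6\<close> one has \<open>x\<^sup>2 \<le> 3\<close>, so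
    the cubic Taylor bound gives \<open>sin x \<ge> x / 2\<close>, and \<open>x / 2 \<ge> s\<close>
    because \<open>pi \<ge> 2\<close>.\<close>
  have *: "sin (pi * s) \<ge> s" if "0 \<le> s" "s \<le> 1 / 2" for s
  proof -
    define x where "x = pi * s"
    have x: "0 \<le> x" "x \<le> pi * (1 / 2)" "s \<le> x / 2"
      using that pi_ge_two mult_right_mono[OF pi_ge_two, of s] mult_left_mono[of s "1/2" pi] by (simp_all add: x_def)
    have x2: "x < 1.6" using x(2) pi_less_4 pi_approx by simp
    then have "x\<^sup>2 \<le> 1.6\<^sup>2" using x(1) by (intro power_mono) auto
    then have "x\<^sup>2 \<le> 3" by (simp add: power2_eq_square)
    have "\<bar>sin x - (\<Sum>m<3. sin_coeff m * x ^ m)\<bar> \<le> inverse (fact 3) * \<bar>x\<bar> ^ 3"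
      by (rule Maclaurin_sin_bound)
    then have "\<bar>sin x - x\<bar> \<le> x ^ 3 / 6"
      using x(1) by (simp add: numeral_3_eq_3 sin_coeff_def fact_numeral)
    moreover have "x ^ 3 / 6 \<le> x / 2"
    proof -
      have "x * x\<^sup>2 \<le> x * 3" using \<open>x\<^sup>2 \<le> 3\<close> x(1) by (rule mult_left_mono)
      then show ?thesis by (simp add: power3_eq_cube power2_eq_square)
    qed
    ultimately show ?thesis using x(3) unfolding x_def[symmetric] by linarith
  qed
  show ?thesis
  proof (cases "t \<le> 1 / 2")
    case True
    have "t * (1 - t) \<le> t * 1" using assms by (intro mult_left_mono) auto
    then show ?thesis using *[of t] True assms by simp
  next
    case False
    have "sin (pi * (1 - t)) = sin (pi * t)" by (simp add: right_diff_distrib sin_diff)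
    moreover have "t * (1 - t) \<le> 1 * (1 - t)" using assms by (intro mult_right_mono) auto
    ultimately show ?thesis using *[of "1 - t"] False assms by simp
  qed
qed

abbreviation e_circ :: "real \<Rightarrow> complex" where
  "e_circ t \<equiv> cis (2 * pi * t)"

lemma norm_one_minus_e_circ: "norm (1 - e_circ t) = 2 * \<bar>sin (pi * t)\<bar>"
proof -
  have "(norm (1 - e_circ t))\<^sup>2 = (2 * sin (pi * t))\<^sup>2"
    using cos_double_sin[of "pi * t"] sin_cos_squared_add[of "2 * (pi * t)"]
    unfolding cmod_power2 by (simp add: power2_eq_square algebra_simps)
  then have "\<bar>norm (1 - e_circ t)\<bar> = \<bar>2 * sin (pi * t)\<bar>" by (simp only: power2_eq_iff abs_eq_iff)
  then show ?thesis by (simp add: abs_mult)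
qed

lemma e_circ_int: "t \<in> \<int> \<Longrightarrow> e_circ t = 1"
  by (rule cis_multiple_2pi)

lemma e_circ_add: "e_circ (s + t) = e_circ s * e_circ t"
  by (simp add: cis_mult ring_distribs)

lemma e_circ_power: "e_circ t ^ n = e_circ (n * t)"
  by (subst Complex.DeMoivre) (simp only: mult_ac)

lemma sum_e_circ_residues:
  fixes a :: nat and k :: int
  assumes "a > 0"
  shows "(\<Sum>h<a. e_circ (real h * of_int k / a)) = (if int a dvd k then of_nat a else 0)"
proof (cases "int a dvd k")
  case True
  then obtain j where "k = int a * j" by blast
  then have "e_circ (real h * k / a) = 1" for h using assms by (intro e_circ_int) simp
  then show ?thesis using True by simp
next
  case False
  define z where "z = e_circ (k / a)"
  have nz: "z \<noteq> 1"
  proof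
    assume "z = 1"
    then have "cos (2 * pi * (k / a)) = 1" unfolding z_def by (metis cis.sel(1) one_complex.sel(1))
    then obtain n :: int where "2 * pi * (k / a) = of_int n * 2 * pi" using cos_one_2pi_int by blast
    then have "real_of_int k = of_int n * of_int (int a)" using assms by (simp add: field_simps)
    then have "k = n * int a" by (metis of_int_eq_iff of_int_mult)
    then show False using False by simp
  qed
  have "e_circ (real h * of_int k / a) = z ^ h" for h unfolding z_def e_circ_power by simp
  then have "(\<Sum>h<a. e_circ (real h * of_int k / a)) = (\<Sum>h<a. z ^ h)" by simp
  also have "\<dots> = (z ^ a - 1) / (z - 1)" by (rule geometric_sum[OF nz])
  also have "z ^ a = 1" unfolding z_def e_circ_power using assms by (intro e_circ_int) simp
  finally show ?thesis using False by simp
qed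

lemma norm_sum_e_circ_interval:
  fixes N :: nat
  assumes t: "0 < t" "t < 1"
  shows "norm (\<Sum>n<N. e_circ (c + real n * t)) \<le> 1 / t + 1 / (1 - t)"
proof -
  define z where "z = e_circ t"
  have "sin (pi * t) \<ge> t * (1 - t)" using sin_pi_ge t by simp
  moreover have "t * (1 - t) > 0" using t by simp
  ultimately have ge: "norm (1 - z) \<ge> 2 * (t * (1 - t))" "norm (1 - z) > 0"
    unfolding z_def norm_one_minus_e_circ by linarith+
  then have nz: "z \<noteq> 1" by auto
  have "(\<Sum>n<N. e_circ (c + real n * t)) = e_circ c * (\<Sum>n<N. z ^ n)"
    unfolding z_def e_circ_power sum_distrib_left e_circ_add ..
  also have "(\<Sum>n<N. z ^ n) = (z ^ N - 1) / (z - 1)" by (rule geometric_sum[OF nz])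
  finally have "norm (\<Sum>n<N. e_circ (c + real n * t)) = norm (z ^ N - 1) / norm (1 - z)"
    by (simp add: norm_mult norm_divide norm_minus_commute)
  also have "\<dots> \<le> 2 / (2 * (t * (1 - t)))"
  proof (rule frac_le)
    have "norm (z ^ N - 1) \<le> norm (z ^ N) + norm (1::complex)" by (rule norm_triangle_ineq4)
    then show "norm (z ^ N - 1) \<le> 2" by (simp add: z_def norm_power)
  qed (use ge \<open>t * (1 - t) > 0\<close> in auto)
  also have "\<dots> = 1 / t + 1 / (1 - t)" using t by (simp add: field_simps)
  finally show ?thesis .
qed

lemma nearest_int_dist_le_iff:
  fixes x a :: nat
  assumes a: "a > 0"
  shows "nearest_int_dist ((real x)\<^sup>2 / real a) \<le> \<delta> \<longleftrightarrow> (\<exists>m::int. \<bar>of_int m\<bar> \<le> \<delta> * a \<and> int a dvd (int x)\<^sup>2 - m)"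
    (is "?L \<longleftrightarrow> ?R")
proof
  assume L: ?L
  define n where "n = round ((real x)\<^sup>2 / real a)"
  define m where "m = (int x)\<^sup>2 - int a * n"
  have "\<bar>(real x)\<^sup>2 / real a - n\<bar> \<le> \<delta>" using L by (simp add: nearest_int_dist_eq_round n_def)
  then have "\<bar>(real x)\<^sup>2 / real a - n\<bar> * a \<le> \<delta> * a" by (intro mult_right_mono) auto
  moreover have "\<bar>(real x)\<^sup>2 / real a - n\<bar> * a = \<bar>((real x)\<^sup>2 / real a - n) * a\<bar>" by (simp add: abs_mult)
  moreover have "((real x)\<^sup>2 / real a - n) * a = of_int m" using a by (simp add: m_def field_simps)
  ultimately have "\<bar>of_int m\<bar> \<le> \<delta> * a" by simp
  then show ?R by (intro exI[of _ m]) (simp add: m_def)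
next
  assume ?R
  then obtain m k where m: "\<bar>of_int m\<bar> \<le> \<delta> * a" "(int x)\<^sup>2 - m = int a * k" unfolding dvd_def by blast
  have "(real x)\<^sup>2 = of_int ((int x)\<^sup>2)" by simp
  also have "(int x)\<^sup>2 = m + int a * k" using m(2) by simp
  finally have "(real x)\<^sup>2 / a - k = m / a" using a by (simp add: field_simps)
  then have "\<bar>(real x)\<^sup>2 / a - k\<bar> = \<bar>of_int m\<bar> / a" by simp
  also have "\<dots> \<le> \<delta>" using m(1) a by (simp add: divide_le_eq)
  finally have "\<bar>(real x)\<^sup>2 / a - k\<bar> \<le> \<delta>" .
  then show ?L unfolding nearest_int_dist_eq_round
    using round_diff_minimal[of "(real x)\<^sup>2 / a" k] by linarith
qed

definition square_sum :: "nat \<Rightarrow> nat \<Rightarrow> nat \<Rightarrow> complex" where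
  "square_sum a h b = (\<Sum>x=1..b. e_circ (h * (real x)\<^sup>2 / a))"

text \<open>Since \<delta> is below \<open>1 / 2\<close>, the \<open>2 * M + 1\<close> integers of
  absolute value at most \<open>\<delta> * a\<close> are incongruent modulo \<open>a\<close>. Hence
  each admissible \<open>x\<close> has exactly one \<open>m\<close> with
  \<open>int a dvd (int x)\<^sup>2 - m\<close>, and orthogonality counts it once.\<close>

lemma A_fourier:
  fixes M :: nat
  assumes a: "a > 0" and \<delta>: "0 < \<delta>" "\<delta> < 1 / 2" and M: "M = nat \<lfloor>\<delta> * a\<rfloor>"
  shows "of_nat a * of_nat (A a b \<delta>) =
    (\<Sum>h<a. square_sum a h b * (\<Sum>m=-int M..int M. e_circ (- (real h * of_int m / a))))"
proof -
  have M_le: "real M \<le> \<delta> * a" using \<delta> by (simp add: M)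
  have mem: "\<bar>of_int m\<bar> \<le> \<delta> * a \<longleftrightarrow> m \<in> {-int M..int M}" for m
  proof -
    have "\<bar>of_int m\<bar> \<le> \<delta> * a \<longleftrightarrow> \<bar>m\<bar> \<le> \<lfloor>\<delta> * a\<rfloor>" by (simp add: le_floor_iff)
    moreover have "\<lfloor>\<delta> * a\<rfloor> = int M" using \<delta> by (simp add: M)
    ultimately show ?thesis by auto
  qed
  define P where "P = (\<lambda>x::nat. \<exists>m\<in>{-int M..int M}. int a dvd (int x)\<^sup>2 - m)"
  have P: "nearest_int_dist ((real x)\<^sup>2 / real a) \<le> \<delta> \<longleftrightarrow> P x" for x
    unfolding nearest_int_dist_le_iff[OF a] mem P_def by blast
  have inner: "(\<Sum>m=-int M..int M. \<Sum>h<a. e_circ (real h * of_int ((int x)\<^sup>2 - m) / a)) = (if P x then of_nat a else 0)" for x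
  proof -
    have "(\<Sum>m=-int M..int M. \<Sum>h<a. e_circ (real h * of_int ((int x)\<^sup>2 - m) / a))
       = (\<Sum>m\<in>{-int M..int M}. if int a dvd (int x)\<^sup>2 - m then of_nat a else 0)"
      by (intro sum.cong refl sum_e_circ_residues a)
    also have "\<dots> = of_nat a * of_nat (card {m\<in>{-int M..int M}. int a dvd (int x)\<^sup>2 - m})"
      by (subst sum.If_cases) (auto simp: Int_def mult.commute)
    also have "card {m\<in>{-int M..int M}. int a dvd (int x)\<^sup>2 - m} = (if P x then 1 else 0)"
    proof (cases "P x")
      case True
      then obtain m where m: "m \<in> {-int M..int M}" "int a dvd (int x)\<^sup>2 - m" by (auto simp: P_def)
      have "m' = m" if m': "m' \<in> {-int M..int M}" "int a dvd (int x)\<^sup>2 - m'" for m'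
      proof -
        have "int a dvd ((int x)\<^sup>2 - m) - ((int x)\<^sup>2 - m')" by (rule dvd_diff[OF m(2) m'(2)])
        then have d: "int a dvd m' - m" by simp
        have "2 * \<delta> * a < a" using a \<delta> by simp
        then have "real (2 * M) < real a" using M_le by simp
        then have "2 * M < a" by (simp only: of_nat_less_iff)
        then have "\<bar>m' - m\<bar> < int a" using m m' by auto
        then have "m' - m = 0" using d zdvd_not_zless[of "\<bar>m' - m\<bar>" "int a"] by fastforce
        then show ?thesis by simp
      qed
      then have "{m\<in>{-int M..int M}. int a dvd (int x)\<^sup>2 - m} = {m}" using m by blast
      then show ?thesis using True by simp
    next
      case False
      then have "{m\<in>{-int M..int M}. int a dvd (int x)\<^sup>2 - m} = {}" by (auto simp: P_def)
      then show ?thesis using False by (simp only: card.empty if_False)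
    qed
    finally show ?thesis by simp
  qed
  have "{x::nat. 1 \<le> x \<and> x \<le> b \<and> nearest_int_dist ((real x)\<^sup>2 / real a) \<le> \<delta>} = {x\<in>{1..b}. P x}"
    using P by auto
  then have "of_nat a * of_nat (A a b \<delta>) = (\<Sum>x=1..b. if P x then of_nat a else (0::complex))"
    unfolding A_def by (subst sum.If_cases) (auto simp: Int_def mult.commute)
  also have "\<dots> = (\<Sum>x=1..b. \<Sum>m=-int M..int M. \<Sum>h<a. e_circ (real h * of_int ((int x)\<^sup>2 - m) / a))"
    by (simp only: inner)
  also have "\<dots> = (\<Sum>x=1..b. \<Sum>h<a. \<Sum>m=-int M..int M. e_circ (real h * of_int ((int x)\<^sup>2 - m) / a))"
    by (intro sum.cong refl sum.swap)
  also have "\<dots> = (\<Sum>h<a. \<Sum>x=1..b. \<Sum>m=-int M..int M. e_circ (real h * of_int ((int x)\<^sup>2 - m) / a))"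
    by (rule sum.swap)
  also have "\<dots> = (\<Sum>h<a. square_sum a h b * (\<Sum>m=-int M..int M. e_circ (- (real h * of_int m / a))))"
  proof (intro sum.cong refl)
    fix h
    have "e_circ (real h * of_int ((int x)\<^sup>2 - m) / a) = e_circ (h * (real x)\<^sup>2 / a) * e_circ (- (real h * of_int m / a))" for x m
      unfolding e_circ_add[symmetric] by (simp add: diff_divide_distrib right_diff_distrib)
    then show "(\<Sum>x=1..b. \<Sum>m=-int M..int M. e_circ (real h * of_int ((int x)\<^sup>2 - m) / a)) = square_sum a h b * (\<Sum>m=-int M..int M. e_circ (- (real h * of_int m / a)))"
      by (simp only: square_sum_def sum_product)
  qed
  finally show ?thesis .
qed

text \<open>\<open>quad_exp\<close> carries \<open>pi\<close> where \<open>e_circ\<close> carries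
  \<open>2 * pi\<close>, so the relevant fraction is \<open>2 * h / a\<close>, with reduced
  denominator \<open>a div gcd (2 * h) a\<close>. Passing to \<open>gcd h a\<close> changes the gcd
  by a factor of at most 2.\<close>

lemma norm_square_sum_le:
  assumes a: "a > 0" and h: "h > 0"
  shows "norm (square_sum a h b) \<le> 32 * (b * sqrt (real (gcd h a)) / sqrt a + sqrt a / sqrt (real (gcd h a)))"
proof -
  define g where "g = gcd (2 * h) a"
  define d where "d = gcd h a"
  have g: "g > 0" "d > 0" using a h by (simp_all add: g_def d_def)
  have "d dvd g" unfolding g_def d_def by (simp add: gcd_greatest_iff dvd_mult)
  then have dg: "d \<le> g" using g by (rule_tac dvd_imp_le)
  have "gcd (2 * h) a dvd gcd (2 * h) (2 * a)" by (simp add: gcd_greatest_iff dvd_mult)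
  then have "g dvd 2 * d" unfolding g_def d_def gcd_mult_distrib_nat .
  then have gd: "g \<le> 2 * d" using g by (rule_tac dvd_imp_le) auto
  define p where "p = 2 * h div g"
  define q where "q = a div g"
  have pq: "2 * h = p * g" "a = q * g" by (simp_all add: p_def q_def g_def)
  have q0: "q > 0" using a pq by (cases q) auto
  have cop: "coprime p q" unfolding p_def q_def g_def by (rule div_gcd_coprime) (use a in auto)
  have "real (2 * h) / real a = real p / real q" using g unfolding pq by simp
  then have frac: "2 * real h / real a = real p / real q" by simp
  \<comment> \<open>The sum over \<open>x\<close> starts at 1 and \<open>quad_sum\<close> at 0; the
    substitution \<open>x = n + 1\<close> creates the linear phase
    \<open>\<beta> = \<theta> = p / q\<close>.\<close>
  have summand: "e_circ (h * (real (Suc n))\<^sup>2 / a) = e_circ (h / a) * quad_exp (p / q) (p / q) (of_nat n)" for n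
  proof -
    have "e_circ (h * (real (Suc n))\<^sup>2 / a) = cis (pi * (2 * real h / real a) * (real (Suc n))\<^sup>2)"
      by (simp add: mult_ac)
    also have "\<dots> = cis (pi * (2 * real h / real a)) * cis (pi * (p / q) * (real n)\<^sup>2 + 2 * pi * (p / q) * real n)"
      unfolding frac cis_mult by (rule arg_cong[where f = cis]) (simp add: power2_eq_square algebra_simps)
    also have "cis (pi * (p / q) * (real n)\<^sup>2 + 2 * pi * (p / q) * real n) = quad_exp (p / q) (p / q) (of_nat n)"
      unfolding cis_conv_exp quad_exp_def by (rule arg_cong[where f = exp]) (simp add: algebra_simps)
    finally show ?thesis by (simp add: mult_ac)
  qed
  have "square_sum a h b = (\<Sum>n<b. e_circ (h * (real (Suc n))\<^sup>2 / a))"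
    unfolding square_sum_def by (rule sum.reindex_bij_witness[of _ Suc "\<lambda>x. x - 1"]) auto
  also have "\<dots> = e_circ (h / a) * quad_sum (p / q) (p / q) b"
    unfolding summand quad_sum_def sum_distrib_left ..
  finally have "norm (square_sum a h b) = norm (quad_sum (of_int (int p) / q) (p / q) b)"
    by (simp add: norm_mult)
  also have "\<dots> \<le> b / sqrt q + 32 * sqrt q - 32"
    by (rule norm_quad_sum_rational_le) (use q0 cop in auto)
  also have "\<dots> \<le> b / sqrt q + 32 * sqrt q" by simp
  also have "\<dots> = b * sqrt g / sqrt a + 32 * (sqrt a / sqrt g)"
    using g q0 unfolding pq(2) by (simp add: real_sqrt_mult)
  also have "\<dots> \<le> b * (2 * sqrt d) / sqrt a + 32 * (sqrt a / sqrt d)"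
  proof (intro add_mono mult_left_mono divide_right_mono divide_left_mono)
    have "sqrt g \<le> sqrt (4 * d)" using gd by (intro real_sqrt_le_mono) linarith
    then show "sqrt g \<le> 2 * sqrt d" by (simp add: real_sqrt_mult)
  qed (use dg g in auto)
  also have "\<dots> \<le> 32 * (b * sqrt d / sqrt a + sqrt a / sqrt d)"
  proof -
    have "0 \<le> b * sqrt d / sqrt a" by simp
    moreover have "2 * U + 32 * V \<le> 32 * (U + V)" if "U \<ge> 0" for U V :: real
      using that by simp
    ultimately have "2 * (b * sqrt d / sqrt a) + 32 * (sqrt a / sqrt d) \<le> 32 * (b * sqrt d / sqrt a + sqrt a / sqrt d)"
      by blast
    moreover have "b * (2 * sqrt d) / sqrt a = 2 * (b * sqrt d / sqrt a)" by simp
    ultimately show ?thesis by (simp only:)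
  qed
  finally show ?thesis unfolding d_def .
qed

lemma norm_square_sum_reflect:
  assumes "h < a"
  shows "norm (square_sum a (a - h) b) = norm (square_sum a h b)"
proof -
  have "e_circ ((a - h) * (real x)\<^sup>2 / a) = cnj (e_circ (h * (real x)\<^sup>2 / a))" for x
  proof -
    have "e_circ ((a - h) * (real x)\<^sup>2 / a) = e_circ ((real x)\<^sup>2 + - (h * (real x)\<^sup>2 / a))"
      using assms by (intro arg_cong[where f = e_circ]) (simp add: of_nat_diff field_simps)
    also have "\<dots> = e_circ (- (h * (real x)\<^sup>2 / a))"
      unfolding e_circ_add by (subst e_circ_int) (auto intro: Ints_power)
    finally show ?thesis by (simp add: cis_cnj)
  qed
  then have "square_sum a (a - h) b = cnj (square_sum a h b)"
    unfolding square_sum_def cnj_sum by (intro sum.cong refl)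
  then show ?thesis by simp
qed

text \<open>Frequency 0 contributes \<open>b * (2 * M + 1) / a\<close> with
  \<open>M \<le> \<delta> * a < M + 1\<close>, which is within \<open>b / a\<close> of
  \<open>2 * \<delta> * b\<close>. The interval sum at frequency \<open>h\<close> is at most
  \<open>a / h + a / (a - h)\<close>, and the reflection of \<open>h\<close> to \<open>a - h\<close>
  turns the second part into the first, whence the factor 2.\<close>

lemma A_discrepancy_square_sum:
  assumes a: "a > 0" and \<delta>: "0 < \<delta>" "\<delta> < 1 / 2"
  shows "\<bar>real (A a b \<delta>) - 2 * \<delta> * b\<bar> \<le> b / a + 2 * (\<Sum>h=1..<a. norm (square_sum a h b) / h)"
proof -
  let ?T = "\<Sum>h=1..<a. norm (square_sum a h b) / h"
  define M where "M = nat \<lfloor>\<delta> * a\<rfloor>"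
  define D where "D = (\<lambda>h::nat. \<Sum>m=-int M..int M. e_circ (- (real h * of_int m / a)))"
  have M: "real M \<le> \<delta> * a" "\<delta> * a < real M + 1" using \<delta> by (simp_all add: M_def)
  have D_le: "norm (D h) \<le> a / h + a / (a - h)" if h: "0 < h" "h < a" for h
  proof -
    have "D h = (\<Sum>n<2 * M + 1. e_circ (- (real h * M / a) + real n * (h / a)))"
      unfolding D_def
    proof (rule sum.reindex_bij_witness[of _ "\<lambda>n. int M - int n" "\<lambda>m. nat (int M - m)"])
      fix m assume m: "m \<in> {- int M..int M}"
      then have "real (nat (int M - m)) = real M - of_int m" by simp
      then show "e_circ (- (real h * M / a) + real (nat (int M - m)) * (h / a)) = e_circ (- (real h * of_int m / a))"
        by (intro arg_cong[where f = e_circ]) (simp add: algebra_simps diff_divide_distrib)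
    qed auto
    also have "norm \<dots> \<le> 1 / (h / a) + 1 / (1 - h / a)"
      by (rule norm_sum_e_circ_interval) (use h in auto)
    also have "\<dots> = a / h + a / (a - h)" using h by (simp add: field_simps of_nat_diff)
    finally show ?thesis .
  qed
  have D0: "D 0 = of_nat (2 * M + 1)" by (simp add: D_def)
  have S0: "square_sum a 0 b = of_nat b" by (simp add: square_sum_def)
  have "of_nat a * of_nat (A a b \<delta>) = (\<Sum>h<a. square_sum a h b * D h)"
    unfolding D_def by (rule A_fourier[OF a \<delta> M_def])
  moreover have "{..<a} = insert 0 {1..<a}" using a by auto
  ultimately have "of_nat a * of_nat (A a b \<delta>) = of_nat b * of_nat (2 * M + 1) + (\<Sum>h=1..<a. square_sum a h b * D h)"
    by (simp add: D0 S0)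
  then have "of_nat a * of_nat (A a b \<delta>) - of_nat b * of_nat (2 * M + 1) = (\<Sum>h=1..<a. square_sum a h b * D h)"
    by simp
  then have "norm (of_real (real a * real (A a b \<delta>) - real b * real (2 * M + 1)) :: complex) = norm (\<Sum>h=1..<a. square_sum a h b * D h)"
    by simp
  then have "\<bar>real a * real (A a b \<delta>) - real b * real (2 * M + 1)\<bar> = norm (\<Sum>h=1..<a. square_sum a h b * D h)"
    by (simp only: norm_of_real)
  also have "\<dots> \<le> (\<Sum>h=1..<a. norm (square_sum a h b) * (a / h + a / (a - h)))"
    by (rule sum_norm_le) (simp only: norm_mult, intro mult_left_mono D_le, auto)
  also have "\<dots> = (\<Sum>h=1..<a. norm (square_sum a h b) * (a / h)) + (\<Sum>h=1..<a. norm (square_sum a h b) * (a / (a - h)))"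
    by (simp add: distrib_left sum.distrib)
  also have "(\<Sum>h=1..<a. norm (square_sum a h b) * (a / (a - h))) = (\<Sum>h=1..<a. norm (square_sum a h b) * (a / h))"
    by (rule sum.reindex_bij_witness[of _ "\<lambda>h. a - h" "\<lambda>h. a - h"]) (auto simp: norm_square_sum_reflect)
  also have "(\<Sum>h=1..<a. norm (square_sum a h b) * (a / h)) + (\<Sum>h=1..<a. norm (square_sum a h b) * (a / h))
     = a * (2 * ?T)"
    by (simp add: sum_distrib_left mult_ac)
  finally have "\<bar>real a * real (A a b \<delta>) - real b * real (2 * M + 1)\<bar> \<le> a * (2 * ?T)" .
  moreover have "\<bar>real b * real (2 * M + 1) - 2 * \<delta> * b * a\<bar> \<le> b"
  proof -
    have "real b * real (2 * M + 1) - 2 * \<delta> * b * a = real b * (real (2 * M + 1) - 2 * (\<delta> * a))"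
      by (simp add: algebra_simps)
    then have "\<bar>real b * real (2 * M + 1) - 2 * \<delta> * b * a\<bar> = real b * \<bar>real (2 * M + 1) - 2 * (\<delta> * a)\<bar>"
      by (simp add: abs_mult)
    also have "\<dots> \<le> real b * 1" using M by (intro mult_left_mono) auto
    finally show ?thesis by simp
  qed
  ultimately have "\<bar>real a * real (A a b \<delta>) - 2 * \<delta> * b * a\<bar> \<le> b + a * (2 * ?T)"
    by linarith
  moreover have "\<bar>real a * real (A a b \<delta>) - 2 * \<delta> * b * a\<bar> = a * \<bar>real (A a b \<delta>) - 2 * \<delta> * b\<bar>"
  proof -
    have "real a * real (A a b \<delta>) - 2 * \<delta> * b * a = a * (real (A a b \<delta>) - 2 * \<delta> * b)"
      by (simp add: algebra_simps)
    then show ?thesis by (simp only: abs_mult abs_of_nat)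
  qed
  moreover have "b + a * (2 * ?T) = a * (b / a + 2 * ?T)"
    using a by (simp add: field_simps)
  ultimately show ?thesis using a by simp
qed

text \<open>Writing \<open>h = d * k\<close> with \<open>d = gcd h a\<close> separates the variables
  once \<open>k\<close> is allowed to run over all of \<open>{1..a}\<close>; nonnegativity makes
  this an upper bound.\<close>

lemma sum_gcd_le:
  fixes f :: "nat \<Rightarrow> real"
  assumes f: "\<And>d. f d \<ge> 0" and a: "a > 0"
  shows "(\<Sum>h=1..<a. f (gcd h a) / h) \<le> harm a * (\<Sum>d | d dvd a. f d / d)"
proof -
  have fin: "finite {d. d dvd a}" using a by simp
  have "(\<Sum>h=1..<a. f (gcd h a) / h) = (\<Sum>(d, k)\<in>(\<lambda>h. (gcd h a, h div gcd h a)) ` {1..<a}. f d / (d * k))"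
  proof (subst sum.reindex)
    show "inj_on (\<lambda>h. (gcd h a, h div gcd h a)) {1..<a}"
      by (rule inj_onI) (metis Pair_inject dvd_div_mult_self gcd_dvd1)
    show "(\<Sum>h=1..<a. f (gcd h a) / h) = sum ((\<lambda>(d, k). f d / (d * k)) \<circ> (\<lambda>h. (gcd h a, h div gcd h a))) {1..<a}"
      by (intro sum.cong refl) (simp add: of_nat_mult[symmetric] del: of_nat_mult)
  qed
  also have "\<dots> \<le> (\<Sum>(d, k)\<in>{d. d dvd a} \<times> {1..a}. f d / (d * k))"
  proof (rule sum_mono2)
    show "(\<lambda>h. (gcd h a, h div gcd h a)) ` {1..<a} \<subseteq> {d. d dvd a} \<times> {1..a}"
    proof clarsimp
      fix h assume h: "Suc 0 \<le> h" "h < a"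
      then have "h div gcd h a \<noteq> 0" by (simp add: dvd_div_eq_0_iff)
      moreover have "h div gcd h a \<le> h" by (rule div_le_dividend)
      ultimately show "Suc 0 \<le> h div gcd h a \<and> h div gcd h a \<le> a" using h by linarith
    qed
  qed (use fin f in \<open>auto intro!: divide_nonneg_nonneg\<close>)
  also have "\<dots> = (\<Sum>d | d dvd a. \<Sum>k=1..a. f d / (d * k))"
    by (subst sum.cartesian_product) simp
  also have "\<dots> = harm a * (\<Sum>d | d dvd a. f d / d)"
    unfolding harm_def sum_product by (subst sum.swap) (simp add: field_simps)
  finally show ?thesis .
qed

lemma harm_le_ln: "a \<ge> 3 \<Longrightarrow> harm a \<le> 2 * ln (real a)"
proof -
  assume a: "a \<ge> 3"
  have "harm (Suc (a - 1)) - ln (Suc (a - 1)) \<le> harm (Suc 0) - ln (real (Suc 0))"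
    using decseqD[OF decseq_harm_diff_ln, of 0 "a - 1"] by simp
  then have "harm a - ln (real a) \<le> 1" using a by (simp add: harm_def)
  moreover have "1 \<le> ln (real a)"
    using a exp_le by (subst ln_ge_iff) auto
  ultimately show ?thesis by linarith
qed

text \<open>The divisor function of exponent \<open>- 1 / 2\<close>.\<close>

definition sigma_half :: "nat \<Rightarrow> real" where
  "sigma_half a = (\<Sum>d::nat | d dvd a. 1 / sqrt (real d))"

lemma sigma_half_ge_1: "a > 0 \<Longrightarrow> sigma_half a \<ge> 1"
  unfolding sigma_half_def using member_le_sum[of 1 "{d. d dvd a}" "\<lambda>d. 1 / sqrt d"] by simp

text \<open>The two terms of the Gauss sum bound behave differently under \<open>sum_gcd_le\<close>.
  The factor \<open>sqrt d\<close> leads to \<open>\<Sum> 1 / sqrt d\<close>, which is unbounded and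
  goes with \<open>b\<close>; the factor \<open>1 / sqrt d\<close> leads to part of a convergent
  series, so that \<open>sqrt a * ln a\<close> gets only a constant.\<close>

theorem A_discrepancy:
  obtains C :: real where "C > 0"
    "\<And>a b \<delta>. a \<ge> 3 \<Longrightarrow> 0 < \<delta> \<Longrightarrow> \<delta> < 1 / 2 \<Longrightarrow>
       \<bar>real (A a b \<delta>) - 2 * \<delta> * b\<bar> \<le> C * (sqrt a * ln a + b / sqrt a * (ln a * sigma_half a))"
proof -
  \<comment> \<open>This is \<zeta>(3/2); the term for \<open>n = 0\<close> is 0, as
    \<open>0 powr x = 0\<close>.\<close>
  define Z where "Z = (\<Sum>n. real n powr (- 3 / 2))"
  have sm: "summable (\<lambda>n. real n powr (- 3 / 2))" by (simp add: summable_real_powr_iff)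
  have Z0: "Z \<ge> 0" unfolding Z_def by (rule suminf_nonneg[OF sm]) simp
  have three: "(\<Sum>d::nat | d dvd a. 1 / sqrt (real d) / real d) \<le> Z" if "a > 0" for a :: nat
  proof -
    have "1 / sqrt (real d) / real d = real d powr (- 3 / 2)" for d :: nat
    proof (cases "d = 0")
      case False
      have "real d powr (- 3 / 2) = real d powr (- (1 / 2) + - 1)" by simp
      also have "\<dots> = real d powr (- (1 / 2)) * real d powr - 1" by (rule powr_add)
      finally show ?thesis using False by (simp add: powr_minus powr_half_sqrt field_simps)
    qed simp
    then show ?thesis unfolding Z_def using that
      by (simp only:) (rule sum_le_suminf[OF sm], auto)
  qed
  \<comment> \<open>The proof arrives at \<open>129 * X + 128 * (Y * Z)\<close>: here 128 is the
    product of 32 from the Gauss sums, 2 from \<open>harm_le_ln\<close> and 2 from folding the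
    frequencies, and one more \<open>X\<close> pays for \<open>b / a\<close>.\<close>
  define C where "C = 129 + 128 * Z"
  show ?thesis
  proof (rule that)
    show "C > 0" using Z0 by (simp add: C_def)
    fix a b :: nat and \<delta> :: real
    assume a: "a \<ge> 3" and \<delta>: "0 < \<delta>" "\<delta> < 1 / 2"
    have a0: "a > 0" using a by simp
    have lna: "ln a \<ge> 1" using a exp_le by (subst ln_ge_iff) auto
    define X where "X = b / sqrt a * (ln a * sigma_half a)"
    define Y where "Y = sqrt a * ln a"
    have X0: "X \<ge> 0" "Y \<ge> 0" using sigma_half_ge_1[OF a0] lna by (simp_all add: X_def Y_def)
    define f1 where "f1 = (\<lambda>d::nat. sqrt d)"
    define f2 where "f2 = (\<lambda>d::nat. 1 / sqrt d)"
    have "(\<Sum>h=1..<a. norm (square_sum a h b) / h) \<le> (\<Sum>h=1..<a. 32 * (b / sqrt a * (f1 (gcd h a) / h) + sqrt a * (f2 (gcd h a) / h)))"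
    proof (rule sum_mono)
      fix h assume h: "h \<in> {1..<a}"
      then have "norm (square_sum a h b) / h \<le> 32 * (b * sqrt (real (gcd h a)) / sqrt a + sqrt a / sqrt (real (gcd h a))) / h"
        by (intro divide_right_mono norm_square_sum_le a0) auto
      then show "norm (square_sum a h b) / h \<le> 32 * (b / sqrt a * (f1 (gcd h a) / h) + sqrt a * (f2 (gcd h a) / h))"
        by (simp add: f1_def f2_def add_divide_distrib)
    qed
    also have "\<dots> = 32 * (b / sqrt a * (\<Sum>h=1..<a. f1 (gcd h a) / h) + sqrt a * (\<Sum>h=1..<a. f2 (gcd h a) / h))"
      by (simp only: sum_distrib_left[symmetric] sum.distrib)
    also have "\<dots> \<le> 32 * (b / sqrt a * (harm a * (\<Sum>d | d dvd a. f1 d / d)) + sqrt a * (harm a * (\<Sum>d | d dvd a. f2 d / d)))"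
      by (intro mult_left_mono add_mono sum_gcd_le a0) (auto simp: f1_def f2_def)
    also have "(\<Sum>d | d dvd a. f1 d / d) = sigma_half a"
      unfolding sigma_half_def f1_def by (intro sum.cong refl) (simp add: real_div_sqrt sqrt_divide_self_eq inverse_eq_divide)
    also have "(\<Sum>d | d dvd a. f2 d / d) \<le> Z" unfolding f2_def by (rule three[OF a0])
    also have "32 * (b / sqrt a * (harm a * sigma_half a) + sqrt a * (harm a * Z))
      \<le> 32 * (b / sqrt a * (2 * ln a * sigma_half a) + sqrt a * (2 * ln a * Z))"
      using sigma_half_ge_1[OF a0] harm_le_ln[OF a] Z0 by (intro mult_left_mono add_mono mult_right_mono) auto
    also have "\<dots> = 64 * X + 64 * (Y * Z)" by (simp add: X_def Y_def)
    finally have main: "(\<Sum>h=1..<a. norm (square_sum a h b) / h) \<le> 64 * X + 64 * (Y * Z)"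
      using a0 Z0 harm_nonneg by (simp add: mult_left_mono)
    have "b / a \<le> X"
    proof -
      have "1 * 1 \<le> ln a * sigma_half a" using lna sigma_half_ge_1[OF a0] by (intro mult_mono) auto
      then have "b / sqrt a * 1 \<le> X" unfolding X_def by (intro mult_left_mono) auto
      moreover have "sqrt a \<le> a" using a0 by (simp add: real_le_lsqrt sqrt_le_D real_sqrt_le_iff power2_eq_square)
      then have "b / a \<le> b / sqrt a" using a0 by (intro divide_left_mono) auto
      ultimately show ?thesis by simp
    qed
    then have "\<bar>real (A a b \<delta>) - 2 * \<delta> * b\<bar> \<le> X + 2 * (64 * X + 64 * (Y * Z))"
      by (intro order.trans[OF A_discrepancy_square_sum[OF a0 \<delta>, of b]] add_mono mult_left_mono main) auto
    also have "\<dots> \<le> C * (Y + X)"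
      using X0 Z0 mult_nonneg_nonneg[OF X0(1) Z0] by (simp add: C_def algebra_simps)
    finally show "\<bar>real (A a b \<delta>) - 2 * \<delta> * b\<bar> \<le> C * (sqrt a * ln a + b / sqrt a * (ln a * sigma_half a))"
      unfolding X_def Y_def .
  qed
qed

section \<open>The zeta function\<close>

text \<open>The Dirichlet monomial with exponent \<open>- s\<close>, written with the real logarithm
  so that it is visibly entire in \<open>s\<close>; the value 0 at \<open>n = 0\<close> lets series
  run over all natural numbers.\<close>

definition nat_power :: "nat \<Rightarrow> complex \<Rightarrow> complex" where
  "nat_power n s = (if n = 0 then 0 else exp (- (s * of_real (ln (real n)))))"

lemma nat_power_0 [simp]: "nat_power 0 s = 0"
  by (simp add: nat_power_def)

lemma nat_power_1 [simp]: "nat_power (Suc 0) s = 1"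
  by (simp add: nat_power_def)

lemma norm_nat_power: "norm (nat_power n s) = real n powr (- Re s)"
  by (simp add: nat_power_def powr_def)

lemma nat_power_mult: "nat_power (m * n) s = nat_power m s * nat_power n s"
  by (simp add: nat_power_def ln_mult exp_add[symmetric] algebra_simps)

lemma nat_power_DERIV:
  "(nat_power n has_field_derivative (- of_real (ln (real n)) * nat_power n s)) (at s)"
proof (cases "n = 0")
  case True
  then show ?thesis by (simp add: nat_power_def[abs_def])
next
  case False
  then show ?thesis unfolding nat_power_def[abs_def] by (auto intro!: derivative_eq_intros)
qed

lemma summable_nat_powr: "\<sigma> > 1 \<Longrightarrow> summable (\<lambda>n. real n powr (- \<sigma>))"
  by (subst summable_real_powr_iff) auto

lemma ln_le_powr:
  assumes "e > 0" "n > 0"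
  shows "ln (real n) \<le> real n powr e / e"
proof -
  have "e * ln (real n) \<le> exp (e * ln (real n))"
    using exp_ge_add_one_self[of "e * ln (real n)"] by linarith
  then show ?thesis using assms by (simp add: powr_def field_simps)
qed

lemma summable_mangoldt_powr:
  assumes "\<sigma> > 1"
  shows "summable (\<lambda>n. mangoldt n * real n powr (- \<sigma>))"
proof (rule summable_comparison_test')
  define e where "e = (\<sigma> - 1) / 2"
  have e: "e > 0" "\<sigma> - e > 1" using assms by (simp_all add: e_def field_simps)
  show "summable (\<lambda>n. (1 / e) * real n powr (- (\<sigma> - e)))"
    using summable_nat_powr[OF e(2)] by (rule summable_mult)
  fix n :: nat assume "n \<ge> 1"
  then have "mangoldt n \<le> real n powr e / e"
    using mangoldt_le[of n] ln_le_powr[OF e(1), of n] by simp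
  then have "mangoldt n * real n powr (- \<sigma>) \<le> real n powr e / e * real n powr (- \<sigma>)"
    by (intro mult_right_mono) auto
  also have "\<dots> = (1 / e) * real n powr (- (\<sigma> - e))"
    by (simp add: powr_add[symmetric])
  finally show "norm (mangoldt n * real n powr (- \<sigma>)) \<le> (1 / e) * real n powr (- (\<sigma> - e))"
    by (simp add: mangoldt_nonneg abs_mult)
qed

text \<open>The negative logarithmic derivative of \<zeta> in the half plane
  \<open>Re s > 1\<close>.\<close>

definition mangoldt_series :: "complex \<Rightarrow> complex" where
  "mangoldt_series s = (\<Sum>n. mangoldt n * nat_power n s)"

lemma summable_norm_mangoldt_series:
  "Re s > 1 \<Longrightarrow> summable (\<lambda>n. norm (mangoldt n * nat_power n s))"
  using summable_mangoldt_powr[of "Re s"] by (simp add: norm_mult norm_nat_power)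

text \<open>The function \<open>zeta_factor\<close> is \<open>(s - 1) \<zeta>(s)\<close>; the factor \<open>s - 1\<close> removes the pole, and the
  telescoping correction makes the series converge for \<open>Re s > 0\<close>.\<close>

definition zeta_factor_term :: "nat \<Rightarrow> complex \<Rightarrow> complex" where
  "zeta_factor_term n s = (s - 1) * nat_power (Suc n) s + nat_power (Suc (Suc n)) (s - 1) - nat_power (Suc n) (s - 1)"

definition zeta_factor :: "complex \<Rightarrow> complex" where
  "zeta_factor s = 1 + (\<Sum>n. zeta_factor_term n s)"

text \<open>The term is the remainder in the first-order Taylor expansion of the power function with
  exponent \<open>1 - s\<close> from \<open>n + 1\<close> to \<open>n + 2\<close>. The second
  derivative has the coefficient \<open>(1 - s) * (- s)\<close> and the exponent
  \<open>- s - 1\<close>.\<close>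

lemma zeta_factor_term_bound:
  assumes s: "Re s > 0"
  shows "norm (zeta_factor_term n s) \<le> norm s * norm (s - 1) * real (Suc n) powr (- Re s - 1)"
proof -
  define m where "m = real (Suc n)"
  have m: "m > 0" by (simp add: m_def)
  define f :: "nat \<Rightarrow> complex \<Rightarrow> complex" where
    "f = (\<lambda>i z. if i = 0 then exp ((1 - s) * Ln z) else if i = 1 then (1 - s) * exp (- s * Ln z)
        else (1 - s) * (- s) * exp ((- s - 1) * Ln z))"
  define S where "S = closed_segment (complex_of_real m) (complex_of_real (m + 1))"
  have S: "\<exists>x. z = complex_of_real x \<and> x \<ge> m" if "z \<in> S" for z
    using that unfolding S_def closed_segment_of_real by (auto simp: closed_segment_eq_real_ivl)
  have Sz: "z \<notin> \<real>\<^sub>\<le>\<^sub>0" "exp (Ln z) = z" if z: "z \<in> S" for z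
  proof -
    obtain x where "z = complex_of_real x" "x > 0" using S[OF z] m by fastforce
    then show "z \<notin> \<real>\<^sub>\<le>\<^sub>0" "exp (Ln z) = z" by auto
  qed
  have d: "(f i has_field_derivative f (Suc i) z) (at z within S)" if z: "z \<in> S" and i: "i \<le> 1" for i z
  proof -
    have z0: "z \<noteq> 0" using Sz(1)[OF z] by auto
    have e: "exp (w - Ln z) = exp w / z" for w using Sz(2)[OF z] by (simp add: exp_diff)
    have "(f i has_field_derivative f (Suc i) z) (at z)"
    proof (cases "i = 0")
      case True
      have "exp (- s * Ln z) = exp ((1 - s) * Ln z) / z"
        unfolding e[symmetric] by (simp add: algebra_simps)
      then show ?thesis using True Sz(1)[OF z] z0 unfolding f_def
        by (auto intro!: derivative_eq_intros simp: field_simps)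
    next
      case False
      then have i1: "i = 1" using i by simp
      have "exp ((- s - 1) * Ln z) = exp (- s * Ln z) / z"
        unfolding e[symmetric] by (simp add: algebra_simps)
      then show ?thesis using i1 Sz(1)[OF z] z0 unfolding f_def
        by (auto intro!: derivative_eq_intros simp: field_simps)
    qed
    then show ?thesis by (rule has_field_derivative_at_within)
  qed
  have B: "norm (f (Suc 1) z) \<le> norm s * norm (s - 1) * m powr (- Re s - 1)" if z: "z \<in> S" for z
  proof -
    obtain x where x: "z = complex_of_real x" "x \<ge> m" using S[OF z] by auto
    have x0: "x > 0" using x m by simp
    have "norm (f (Suc 1) z) = norm (s - 1) * norm s * exp ((- Re s - 1) * ln x)"
      using x0 unfolding f_def x(1) by (simp add: norm_mult norm_minus_commute Ln_of_real)
    also have "\<dots> \<le> norm (s - 1) * norm s * exp ((- Re s - 1) * ln m)"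
      using s x(2) m by (intro mult_left_mono) (auto intro: mult_left_mono_neg)
    also have "exp ((- Re s - 1) * ln m) = m powr (- Re s - 1)" using m by (simp add: powr_def)
    finally have "norm (f (Suc 1) z) \<le> norm (s - 1) * norm s * m powr (- Re s - 1)"
      .
    then show ?thesis by (simp only: mult_ac)
  qed
  have "norm (f 0 (complex_of_real (m + 1)) - (\<Sum>i\<le>1. f i (complex_of_real m) * (complex_of_real (m + 1) - complex_of_real m) ^ i / fact i))
     \<le> (norm s * norm (s - 1) * m powr (- Re s - 1)) * norm (complex_of_real (m + 1) - complex_of_real m) ^ Suc 1 / fact 1"
    by (rule complex_Taylor[of S 1 f]) (use d B in \<open>auto simp: S_def\<close>)
  also have "f 0 (complex_of_real (m + 1)) - (\<Sum>i\<le>1. f i (complex_of_real m) * (complex_of_real (m + 1) - complex_of_real m) ^ i / fact i) = zeta_factor_term n s"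
  proof -
    have L: "Ln (complex_of_real m) = ln (real (Suc n))" "Ln (complex_of_real (m + 1)) = ln (real (Suc (Suc n)))"
      using Ln_of_real[of m] Ln_of_real[of "m + 1"] m by (simp_all add: m_def add_ac)
    have "f 0 (complex_of_real (m + 1)) = nat_power (Suc (Suc n)) (s - 1)"
      "f 0 (complex_of_real m) = nat_power (Suc n) (s - 1)"
      "f 1 (complex_of_real m) = (1 - s) * nat_power (Suc n) s"
      unfolding f_def L nat_power_def by (simp_all add: algebra_simps)
    then show ?thesis by (simp add: zeta_factor_term_def algebra_simps)
  qed
  finally show ?thesis by (simp add: m_def)
qed

lemma zeta_factor_holomorphic_sums:
  "zeta_factor holomorphic_on {s. Re s > 0}"
  "Re s > 0 \<Longrightarrow> (\<lambda>n. zeta_factor_term n s) sums (zeta_factor s - 1)"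
proof -
  let ?S = "{s. Re s > 0}"
  have "\<exists>g g'. \<forall>x \<in> ?S. ((\<lambda>n. zeta_factor_term n x) sums g x) \<and> ((\<lambda>n. deriv (zeta_factor_term n) x) sums g' x) \<and> (g has_field_derivative g' x) (at x)"
  proof (rule series_and_derivative_comparison_local)
    show "open ?S" by (rule open_halfspace_Re_gt)
    show "(zeta_factor_term n has_field_derivative deriv (zeta_factor_term n) x) (at x)" for n x
    proof -
      have "zeta_factor_term n holomorphic_on UNIV"
        unfolding zeta_factor_term_def[abs_def] nat_power_def by (auto intro!: holomorphic_intros)
      then show ?thesis
        by (metis UNIV_I field_differentiable_derivI holomorphic_on_imp_differentiable_at open_UNIV)
    qed
    fix x assume "x \<in> ?S"
    then have x: "Re x > 0" by simp
    define r where "r = Re x / 2"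
    define B where "B = (norm x + r) * (norm x + r + 1)"
    have r: "r > 0" using x by (simp add: r_def)
    have "norm (zeta_factor_term n y) \<le> B * real (Suc n) powr (- (r + 1))" if "y \<in> ball x r \<inter> ?S" for n y
    proof -
      have "\<bar>Re x - Re y\<bar> < r" "norm (y - x) < r"
        using that abs_Re_le_cmod[of "x - y"] by (auto simp: dist_norm norm_minus_commute)
      then have "Re x - Re y < r" "norm y \<le> norm x + r"
        using norm_triangle_sub[of y x] by linarith+
      then have y: "Re y > r" "norm y \<le> norm x + r" by (simp_all add: r_def field_simps)
      have "norm (y - 1) \<le> norm x + r + 1" using y(2) norm_triangle_ineq4[of y 1] by simp
      then have "norm y * norm (y - 1) \<le> B" unfolding B_def using y(2) r by (intro mult_mono) auto
      moreover have "real (Suc n) powr (- Re y - 1) \<le> real (Suc n) powr (- (r + 1))"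
        using y(1) by (intro powr_mono) auto
      ultimately have "norm y * norm (y - 1) * real (Suc n) powr (- Re y - 1) \<le> B * real (Suc n) powr (- (r + 1))"
        using r by (intro mult_mono) (auto simp: B_def)
      then show ?thesis using zeta_factor_term_bound[of y n] that by simp
    qed
    moreover have "summable (\<lambda>n. B * real (Suc n) powr (- (r + 1)))"
      using summable_nat_powr[of "r + 1"] r
      by (intro summable_mult) (subst summable_Suc_iff, simp)
    ultimately show "\<exists>d h. 0 < d \<and> summable h \<and> (\<forall>\<^sub>F n in sequentially. \<forall>y\<in>ball x d \<inter> ?S. norm (zeta_factor_term n y) \<le> h n)"
      using r by (intro exI[of _ r] exI[of _ "\<lambda>n. B * real (Suc n) powr (- (r + 1))"]) auto
  qed
  then obtain g g' where g: "\<And>x. Re x > 0 \<Longrightarrow> (\<lambda>n. zeta_factor_term n x) sums g x"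
    "\<And>x. Re x > 0 \<Longrightarrow> (g has_field_derivative g' x) (at x)" by auto
  have eq: "zeta_factor x = 1 + g x" if "Re x > 0" for x
    using g(1)[OF that] by (simp add: zeta_factor_def sums_iff)
  have "(\<lambda>x. 1 + g x) holomorphic_on ?S"
    unfolding holomorphic_on_open[OF open_halfspace_Re_gt]
    using g(2) by (auto intro!: exI derivative_eq_intros)
  then show "zeta_factor holomorphic_on ?S"
    by (rule holomorphic_transform) (simp add: eq)
  show "Re s > 0 \<Longrightarrow> (\<lambda>n. zeta_factor_term n s) sums (zeta_factor s - 1)"
    using eq[of s] g(1)[of s] by simp
qed

lemma zeta_factor_1: "zeta_factor 1 = 1"
  by (simp add: zeta_factor_def zeta_factor_term_def nat_power_def)

section \<open>Dirichlet series and the logarithmic derivative for Re s > 1\<close>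

lemma zeta_sums:
  obtains \<zeta> \<zeta>' where
    "\<And>s. Re s > 1 \<Longrightarrow> (\<lambda>n. nat_power n s) sums \<zeta> s"
    "\<And>s. Re s > 1 \<Longrightarrow> (\<lambda>n. - of_real (ln (real n)) * nat_power n s) sums \<zeta>' s"
    "\<And>s. Re s > 1 \<Longrightarrow> (\<zeta> has_field_derivative \<zeta>' s) (at s)"
proof -
  let ?S = "{s. Re s > 1}"
  have "\<exists>g g'. \<forall>x \<in> ?S. ((\<lambda>n. nat_power n x) sums g x) \<and> ((\<lambda>n. - of_real (ln (real n)) * nat_power n x) sums g' x) \<and> (g has_field_derivative g' x) (at x)"
  proof (rule series_and_derivative_comparison_local)
    show "open ?S" by (rule open_halfspace_Re_gt)
    show "(nat_power n has_field_derivative - of_real (ln (real n)) * nat_power n x) (at x)" for n x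
      by (rule nat_power_DERIV)
    fix x assume "x \<in> ?S"
    then have x: "Re x > 1" by simp
    define r where "r = (Re x - 1) / 2"
    have r: "r > 0" using x by (simp add: r_def)
    have "norm (nat_power n y) \<le> real n powr (- (r + 1))" if "y \<in> ball x r \<inter> ?S" for n y
    proof -
      have "\<bar>Re x - Re y\<bar> < r"
        using that abs_Re_le_cmod[of "x - y"] by (auto simp: dist_norm norm_minus_commute)
      then have "Re x - Re y < r" by linarith
      then have "Re y > 1 + r" by (simp add: r_def field_simps)
      then show ?thesis unfolding norm_nat_power
        by (cases "n = 0") (auto intro!: powr_mono)
    qed
    then show "\<exists>d h. 0 < d \<and> summable h \<and> (\<forall>\<^sub>F n in sequentially. \<forall>y\<in>ball x d \<inter> ?S. norm (nat_power n y) \<le> h n)"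
      using r summable_nat_powr[of "r + 1"]
      by (intro exI[of _ r] exI[of _ "\<lambda>n. real n powr (- (r + 1))"]) auto
  qed
  then show ?thesis using that by auto
qed

text \<open>For \<open>Re s > 1\<close> the correction terms telescope to \<open>- 1\<close>, which
  cancels the leading 1 in the definition.\<close>

lemma zeta_factor_eq:
  assumes s: "Re s > 1" and \<zeta>: "(\<lambda>n. nat_power n s) sums z"
  shows "zeta_factor s = (s - 1) * z"
proof -
  have lim: "(\<lambda>n. nat_power (Suc n) (s - 1)) \<longlonglongrightarrow> 0"
  proof (rule tendsto_norm_zero_cancel)
    show "(\<lambda>n. norm (nat_power (Suc n) (s - 1))) \<longlonglongrightarrow> 0"
      unfolding norm_nat_power using s by real_asymp
  qed
  have 1: "(\<lambda>n. nat_power (Suc (Suc n)) (s - 1) - nat_power (Suc n) (s - 1)) sums (0 - nat_power (Suc 0) (s - 1))"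
    by (rule telescope_sums[OF lim])
  have "(\<lambda>n. nat_power (Suc n) s) sums z"
    using \<zeta> by (subst sums_Suc_iff) simp
  then have "(\<lambda>n. (s - 1) * nat_power (Suc n) s) sums ((s - 1) * z)" by (rule sums_mult)
  from sums_add[OF this 1] have "(\<lambda>n. zeta_factor_term n s) sums ((s - 1) * z - 1)"
    by (simp add: zeta_factor_term_def algebra_simps)
  moreover have "(\<lambda>n. zeta_factor_term n s) sums (zeta_factor s - 1)"
    using zeta_factor_holomorphic_sums(2) s by simp
  ultimately show ?thesis by (metis sums_unique2 diff_add_cancel)
qed

text \<open>The identity \<open>\<Sum>d | d dvd n. mangoldt d = ln n\<close> as a product of
  Dirichlet series: the absolutely convergent double sum over \<open>(d, m)\<close> is regrouped by
  \<open>n = d * m\<close>. Index 0 is removed so that pairs correspond bijectively to numbers with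
  a chosen divisor.\<close>

lemma dirichlet_convolution:
  assumes s: "Re s > 1" and z: "(\<lambda>n. nat_power n s) sums z"
  shows "(\<lambda>n. of_real (ln (real n)) * nat_power n s) sums (mangoldt_series s * z)"
proof -
  let ?N = "{0::nat<..}"
  define \<alpha> where "\<alpha> = (\<lambda>n. mangoldt n * nat_power n s)"
  define \<beta> where "\<beta> = (\<lambda>n. nat_power n s)"
  have sa: "summable (\<lambda>n. norm (\<alpha> n))" using summable_norm_mangoldt_series[OF s] by (simp add: \<alpha>_def)
  have sb: "summable (\<lambda>n. norm (\<beta> n))" using summable_nat_powr[OF s] by (simp add: \<beta>_def norm_nat_power)
  have neutral: "(f has_sum S) UNIV \<longleftrightarrow> (f has_sum S) ?N" if "f 0 = 0" for f :: "nat \<Rightarrow> complex" and S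
    using that by (intro has_sum_cong_neutral) (auto simp: not_less)
  have ha: "(\<alpha> has_sum mangoldt_series s) ?N"
  proof -
    have "\<alpha> sums mangoldt_series s"
      using summable_norm_cancel[OF sa] by (simp add: mangoldt_series_def \<alpha>_def summable_sums)
    from norm_summable_imp_has_sum[OF sa this] show ?thesis by (subst (asm) neutral) (simp_all add: \<alpha>_def)
  qed
  have hb: "(\<beta> has_sum z) ?N"
    using norm_summable_imp_has_sum[OF sb] z by (subst neutral[symmetric]) (simp_all add: \<beta>_def)
  have na: "(\<lambda>n. norm (\<alpha> n)) summable_on ?N" "(\<lambda>n. norm (\<beta> n)) summable_on ?N"
    using norm_summable_imp_summable_on[of "\<lambda>n. norm (\<alpha> n)"] norm_summable_imp_summable_on[of "\<lambda>n. norm (\<beta> n)"] sa sb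
    by (auto intro: summable_on_subset_banach)
  have abs: "(\<lambda>p. norm (case p of (d, m) \<Rightarrow> \<alpha> d * \<beta> m)) summable_on (?N \<times> ?N)"
  proof (subst Infinite_Sum.abs_summable_on_Sigma_iff, intro conjI ballI)
    show "(\<lambda>y. norm (case (x, y) of (d, m) \<Rightarrow> \<alpha> d * \<beta> m)) summable_on ?N" for x
      using na by (simp add: norm_mult summable_on_cmult_right)
    have "(\<lambda>x. norm (norm (\<alpha> x) * (\<Sum>\<^sub>\<infinity>y\<in>?N. norm (\<beta> y)))) summable_on ?N"
      using na by (simp add: abs_mult summable_on_cmult_left)
    then show "(\<lambda>x. norm (\<Sum>\<^sub>\<infinity>y\<in>?N. norm (case (x, y) of (d, m) \<Rightarrow> \<alpha> d * \<beta> m))) summable_on ?N"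
      using na by (simp add: norm_mult infsum_cmult_right)
  qed
  have sumf: "(\<lambda>(d, m). \<alpha> d * \<beta> m) summable_on (?N \<times> ?N)"
    using abs by (rule abs_summable_summable)
  have "((\<lambda>(d, m). \<alpha> d * \<beta> m) has_sum (mangoldt_series s * z)) (?N \<times> ?N)"
    by (rule has_sum_SigmaI[OF _ _ sumf, where g = "\<lambda>d. \<alpha> d * z"])
       (auto intro!: has_sum_cmult_right has_sum_cmult_left ha hb)
  moreover have bij: "bij_betw (\<lambda>(n, d). (d, n div d)) (Sigma ?N (\<lambda>n. {d. d dvd n})) (?N \<times> ?N)"
    by (rule bij_betwI[of _ _ _ "\<lambda>(d, m). (d * m, d)"]) (auto elim!: dvdE intro!: Nat.gr0I)
  ultimately have "((\<lambda>p. case (case p of (n, d) \<Rightarrow> (d, n div d)) of (d, m) \<Rightarrow> \<alpha> d * \<beta> m) has_sum (mangoldt_series s * z)) (Sigma ?N (\<lambda>n. {d. d dvd n}))"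
    by (subst has_sum_reindex_bij_betw[OF bij])
  then have "((\<lambda>n. \<Sum>d | d dvd n. \<alpha> d * \<beta> (n div d)) has_sum (mangoldt_series s * z)) ?N"
  proof (rule has_sum_SigmaD)
    fix n :: nat assume "n \<in> ?N"
    then show "((\<lambda>d. case (case (n, d) of (n, d) \<Rightarrow> (d, n div d)) of (d, m) \<Rightarrow> \<alpha> d * \<beta> m) has_sum (\<Sum>d | d dvd n. \<alpha> d * \<beta> (n div d))) {d. d dvd n}"
      by (simp add: has_sum_finite)
  qed
  moreover have "(\<Sum>d | d dvd n. \<alpha> d * \<beta> (n div d)) = of_real (ln (real n)) * nat_power n s" if "n \<in> ?N" for n
  proof -
    have "(\<Sum>d | d dvd n. \<alpha> d * \<beta> (n div d)) = (\<Sum>d | d dvd n. mangoldt d * nat_power n s)"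
      by (intro sum.cong refl) (auto simp: \<alpha>_def \<beta>_def nat_power_mult[symmetric] mult.assoc)
    also have "\<dots> = (\<Sum>d | d dvd n. mangoldt d) * nat_power n s" by (simp add: sum_distrib_right)
    finally show ?thesis using that by (simp add: mangoldt_sum)
  qed
  ultimately have "((\<lambda>n. of_real (ln (real n)) * nat_power n s) has_sum (mangoldt_series s * z)) ?N"
    using has_sum_cong by (metis (no_types, lifting))
  then have "((\<lambda>n. of_real (ln (real n)) * nat_power n s) has_sum (mangoldt_series s * z)) UNIV"
    by (subst neutral) simp_all
  then show ?thesis by (rule has_sum_imp_sums)
qed

text \<open>The formula is multiplied out instead of divided by \<open>zeta_factor\<close>, because
  the nonvanishing of \<open>zeta_factor\<close> is deduced from it.\<close>

lemma deriv_zeta_factor: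
  assumes s: "Re s > 1"
  shows "deriv zeta_factor s = zeta_factor s * (1 / (s - 1) - mangoldt_series s)"
proof -
  obtain \<zeta> \<zeta>' where z: "\<And>s. Re s > 1 \<Longrightarrow> (\<lambda>n. nat_power n s) sums \<zeta> s"
    "\<And>s. Re s > 1 \<Longrightarrow> (\<lambda>n. - of_real (ln (real n)) * nat_power n s) sums \<zeta>' s"
    "\<And>s. Re s > 1 \<Longrightarrow> (\<zeta> has_field_derivative \<zeta>' s) (at s)"
    by (rule zeta_sums) blast
  have "(\<lambda>n. - (of_real (ln (real n)) * nat_power n s)) sums (- (mangoldt_series s * \<zeta> s))"
    by (intro sums_minus dirichlet_convolution s z)
  then have \<zeta>': "\<zeta>' s = - (mangoldt_series s * \<zeta> s)" using z(2)[OF s] sums_unique2 by fastforce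
  have "((\<lambda>s. (s - 1) * \<zeta> s) has_field_derivative (\<zeta> s + (s - 1) * \<zeta>' s)) (at s)"
    by (auto intro!: derivative_eq_intros z(3) s)
  moreover have "open {s. Re s > 1}" by (rule open_halfspace_Re_gt)
  ultimately have "(zeta_factor has_field_derivative (\<zeta> s + (s - 1) * \<zeta>' s)) (at s)"
    by (rule has_field_derivative_transform_within_open) (use s zeta_factor_eq[OF _ z(1)] in auto)
  then have "deriv zeta_factor s = \<zeta> s + (s - 1) * \<zeta>' s" by (rule DERIV_imp_deriv)
  moreover have "s \<noteq> 1" using s by auto
  ultimately show ?thesis
    unfolding \<zeta>' zeta_factor_eq[OF s z(1)[OF s]] by (simp add: right_diff_distrib)
qed

section \<open>Nonvanishing for Re s \<ge> 1\<close>

lemma holomorphic_log_deriv_limit: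
  assumes hol: "f holomorphic_on S" and S: "open S" "connected S" and s0: "s0 \<in> S" and nz: "z1 \<in> S" "f z1 \<noteq> 0"
  obtains m :: nat where "m = 0 \<longrightarrow> f s0 \<noteq> 0"
    "\<forall>\<^sub>F t in at_right 0. f (s0 + of_real t) \<noteq> 0"
    "((\<lambda>t::real. of_real t * deriv f (s0 + of_real t) / f (s0 + of_real t)) \<longlongrightarrow> of_nat m) (at_right 0)"
proof -
  \<comment> \<open>\<open>m\<close> is the order of the zero at \<open>s0\<close>, with
    \<open>m = 0\<close> and \<open>g = f\<close> if there is none. Then \<open>f' / f\<close>
    equals \<open>m / (w - s0)\<close> plus a function continuous at \<open>s0\<close>, and
    multiplication by \<open>t\<close> isolates \<open>m\<close>.\<close>
  obtain g r m where r: "r > 0" "ball s0 r \<subseteq> S" and g: "g holomorphic_on ball s0 r"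
    and fg: "\<And>w. w \<in> ball s0 r \<Longrightarrow> f w = (w - s0) ^ m * g w"
    and gnz: "\<And>w. w \<in> ball s0 r \<Longrightarrow> g w \<noteq> 0"
    and m: "m = 0 \<longrightarrow> f s0 \<noteq> 0"
  proof (cases "f s0 = 0")
    case True
    have nc: "\<not> f constant_on S" using True s0 nz unfolding constant_on_def by metis
    obtain g r n where "0 < n" "0 < r" "ball s0 r \<subseteq> S" "g holomorphic_on ball s0 r"
      "\<And>w. w \<in> ball s0 r \<Longrightarrow> f w = (w - s0) ^ n * g w" "\<And>w. w \<in> ball s0 r \<Longrightarrow> g w \<noteq> 0"
      by (rule holomorphic_factor_zero_nonconstant[OF hol S s0 True nc]) blast
    then show ?thesis by (intro that[of r g n]) auto
  next
    case False
    have "continuous_on S f" using hol by (rule holomorphic_on_imp_continuous_on)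
    then have "isCont f s0" using S(1) s0 by (simp add: continuous_on_eq_continuous_at)
    then have "\<forall>\<^sub>F w in nhds s0. f w \<noteq> 0"
      unfolding isCont_def using False tendsto_imp_eventually_ne[of f "f s0" "at s0" 0]
      by (auto simp: eventually_at_filter elim: eventually_mono)
    moreover have "\<forall>\<^sub>F w in nhds s0. w \<in> S" using S(1) s0 by (rule eventually_nhds_in_open)
    ultimately have "\<forall>\<^sub>F w in nhds s0. f w \<noteq> 0 \<and> w \<in> S" by (rule eventually_conj)
    then obtain r where r: "r > 0" "\<And>w. dist w s0 < r \<Longrightarrow> f w \<noteq> 0 \<and> w \<in> S"
      by (auto simp: eventually_nhds_metric)
    then have sub: "ball s0 r \<subseteq> S" "\<And>w. w \<in> ball s0 r \<Longrightarrow> f w \<noteq> 0" by (auto simp: dist_commute)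
    show ?thesis
      by (rule that[of r f 0]) (use r(1) sub holomorphic_on_subset[OF hol sub(1)] False in auto)
  qed
  have ev: "\<forall>\<^sub>F t in at_right 0. 0 < t \<and> t < r"
    using r(1) eventually_at_right_less[of 0] eventually_at_right[of 0 r] by (auto simp: eventually_at_right_field)
  have inb: "s0 + of_real t \<in> ball s0 r" if "0 < t" "t < r" for t
    using that by (simp add: dist_norm)
  have fnz: "\<forall>\<^sub>F t in at_right 0. f (s0 + of_real t) \<noteq> 0"
    using ev by eventually_elim (use inb fg gnz in auto)
  have eq: "of_real t * deriv f (s0 + of_real t) / f (s0 + of_real t) = of_nat m + of_real t * (deriv g (s0 + of_real t) / g (s0 + of_real t))"
    if t: "0 < t" "t < r" for t
  proof -
    define w where "w = s0 + complex_of_real t"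
    have w: "w \<in> ball s0 r" "g w \<noteq> 0" "w - s0 = of_real t" using inb[OF t] gnz by (auto simp: w_def)
    have dg: "(g has_field_derivative deriv g w) (at w)"
      using g w(1) by (intro holomorphic_derivI[of g "ball s0 r"]) auto
    have "((\<lambda>w. (w - s0) ^ m * g w) has_field_derivative (of_nat m * (w - s0) ^ (m - 1) * g w + (w - s0) ^ m * deriv g w)) (at w)"
      by (auto intro!: derivative_eq_intros dg)
    then have "(f has_field_derivative (of_nat m * (w - s0) ^ (m - 1) * g w + (w - s0) ^ m * deriv g w)) (at w)"
      by (rule has_field_derivative_transform_within_open[of _ _ _ "ball s0 r"]) (use w fg in auto)
    then have df: "deriv f w = of_nat m * (w - s0) ^ (m - 1) * g w + (w - s0) ^ m * deriv g w" by (rule DERIV_imp_deriv)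
    have "of_real t * deriv f w / f w = of_nat m + of_real t * (deriv g w / g w)"
    proof (cases m)
      case 0
      then show ?thesis unfolding df fg[OF w(1)] using w(2) t by simp
    next
      case (Suc k)
      then show ?thesis unfolding df fg[OF w(1)] w(3) using w(2) t by (simp add: field_simps)
    qed
    then show ?thesis by (simp add: w_def)
  qed
  have "((\<lambda>t. of_nat m + of_real t * (deriv g (s0 + of_real t) / g (s0 + of_real t))) \<longlongrightarrow> of_nat m + of_real 0 * (deriv g s0 / g s0)) (at_right 0)"
  proof -
    have "continuous_on (ball s0 r) g" "continuous_on (ball s0 r) (deriv g)"
      using g holomorphic_deriv[OF g open_ball] by (auto intro: holomorphic_on_imp_continuous_on)
    then have c: "isCont g s0" "isCont (deriv g) s0"
      using r(1) by (auto simp: continuous_on_eq_continuous_at)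
    have l: "((\<lambda>t. s0 + complex_of_real t) \<longlongrightarrow> s0) (at_right 0)"
      by (auto intro!: tendsto_eq_intros)
    have "g s0 \<noteq> 0" using gnz r(1) by simp
    then show ?thesis
      by (intro tendsto_intros isCont_tendsto_compose[OF c(1) l] isCont_tendsto_compose[OF c(2) l])
  qed
  then have "((\<lambda>t. of_nat m + of_real t * (deriv g (s0 + of_real t) / g (s0 + of_real t))) \<longlongrightarrow> of_nat m) (at_right 0)" by simp
  then have "((\<lambda>t::real. of_real t * deriv f (s0 + of_real t) / f (s0 + of_real t)) \<longlongrightarrow> of_nat m) (at_right 0)"
    by (rule Lim_transform_eventually) (use ev eq in \<open>auto elim!: eventually_mono\<close>)
  with m fnz show ?thesis by (rule that)
qed

text \<open>Here \<open>m\<close> is the order of the zero of \<open>zeta_factor\<close> at \<open>s0\<close>.\<close>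

lemma mangoldt_series_limit:
  assumes s0: "Re s0 \<ge> 1"
  obtains m :: nat where "m = 0 \<longrightarrow> zeta_factor s0 \<noteq> 0"
    "((\<lambda>t::real. of_real t * mangoldt_series (s0 + of_real t)) \<longlongrightarrow> (if s0 = 1 then 1 else 0) - of_nat m) (at_right 0)"
proof -
  let ?S = "{s. Re s > 0}"
  obtain m :: nat where m: "m = 0 \<longrightarrow> zeta_factor s0 \<noteq> 0"
    "\<forall>\<^sub>F t in at_right 0. zeta_factor (s0 + of_real t) \<noteq> 0"
    "((\<lambda>t::real. of_real t * deriv zeta_factor (s0 + of_real t) / zeta_factor (s0 + of_real t)) \<longlongrightarrow> of_nat m) (at_right 0)"
    by (rule holomorphic_log_deriv_limit[OF zeta_factor_holomorphic_sums(1) open_halfspace_Re_gt, of s0 1])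
       (use s0 in \<open>auto simp: zeta_factor_1 convex_halfspace_Re_gt intro!: convex_connected\<close>)
  have pole: "((\<lambda>t::real. of_real t / (s0 + of_real t - 1)) \<longlongrightarrow> (if s0 = 1 then 1 else 0)) (at_right 0)"
  proof (cases "s0 = 1")
    case True
    have "\<forall>\<^sub>F t in at_right 0. 1 = complex_of_real t / (s0 + of_real t - 1)"
      using eventually_at_right_less[of "0::real"] by eventually_elim (simp add: True)
    then show ?thesis using True by (intro Lim_transform_eventually[OF tendsto_const]) simp_all
  next
    case False
    then show ?thesis by (auto intro!: tendsto_eq_intros)
  qed
  have "((\<lambda>t::real. of_real t / (s0 + of_real t - 1) - of_real t * deriv zeta_factor (s0 + of_real t) / zeta_factor (s0 + of_real t))
      \<longlongrightarrow> (if s0 = 1 then 1 else 0) - of_nat m) (at_right 0)"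
    by (intro tendsto_diff pole m)
  moreover have "\<forall>\<^sub>F t in at_right 0. of_real t / (s0 + of_real t - 1) - of_real t * deriv zeta_factor (s0 + of_real t) / zeta_factor (s0 + of_real t)
     = of_real t * mangoldt_series (s0 + of_real t)"
    using m(2) eventually_at_right_less[of "0::real"]
  proof eventually_elim
    case (elim t)
    then have "deriv zeta_factor (s0 + of_real t) = zeta_factor (s0 + of_real t) * (1 / (s0 + of_real t - 1) - mangoldt_series (s0 + of_real t))"
      using s0 by (intro deriv_zeta_factor) simp
    then have "of_real t * deriv zeta_factor (s0 + of_real t) / zeta_factor (s0 + of_real t)
       = of_real t * (1 / (s0 + of_real t - 1) - mangoldt_series (s0 + of_real t))"
      using elim by simp
    then show ?case by (simp only:) (simp add: right_diff_distrib)
  qed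
  ultimately have "((\<lambda>t::real. of_real t * mangoldt_series (s0 + of_real t)) \<longlongrightarrow> (if s0 = 1 then 1 else 0) - of_nat m) (at_right 0)"
    by (rule Lim_transform_eventually)
  with m(1) show ?thesis by (rule that)
qed

lemma Re_mangoldt_series_sums:
  assumes "\<sigma> > 1"
  shows "(\<lambda>n. mangoldt n * real n powr (- \<sigma>) * cos (y * ln (real n))) sums Re (mangoldt_series (Complex \<sigma> y))"
proof -
  have "(\<lambda>n. mangoldt n * nat_power n (Complex \<sigma> y)) sums mangoldt_series (Complex \<sigma> y)"
    using summable_norm_cancel[OF summable_norm_mangoldt_series[of "Complex \<sigma> y"]] assms
    by (simp add: mangoldt_series_def summable_sums)
  then have "(\<lambda>n. Re (mangoldt n * nat_power n (Complex \<sigma> y))) sums Re (mangoldt_series (Complex \<sigma> y))"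
    by (rule sums_Re)
  moreover have "Re (mangoldt n * nat_power n (Complex \<sigma> y)) = mangoldt n * real n powr (- \<sigma>) * cos (y * ln (real n))" for n
  proof -
    have "Re (mangoldt n * nat_power n (Complex \<sigma> y)) = mangoldt n * Re (nat_power n (Complex \<sigma> y))"
      by (simp add: mangoldt_def)
    moreover have "Re (nat_power n (Complex \<sigma> y)) = real n powr (- \<sigma>) * cos (y * ln (real n))"
      by (simp add: nat_power_def Re_exp powr_def)
    ultimately show ?thesis by (simp only: mult.assoc)
  qed
  ultimately show ?thesis by (simp only:)
qed

text \<open>Applied term by term, \<open>3 + 4 * cos \<alpha> + cos (2 * \<alpha>) = 2 * (1 + cos
  \<alpha>)\<^sup>2\<close> is nonnegative, and so are the von Mangoldt weights.\<close>

lemma mangoldt_series_341: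
  assumes "\<sigma> > 1"
  shows "3 * Re (mangoldt_series (Complex \<sigma> 0)) + 4 * Re (mangoldt_series (Complex \<sigma> y)) + Re (mangoldt_series (Complex \<sigma> (2 * y))) \<ge> 0"
proof -
  have "(\<lambda>n. 3 * (mangoldt n * real n powr (- \<sigma>) * cos (0 * ln (real n))) + 4 * (mangoldt n * real n powr (- \<sigma>) * cos (y * ln (real n)))
     + mangoldt n * real n powr (- \<sigma>) * cos (2 * y * ln (real n))) sums
     (3 * Re (mangoldt_series (Complex \<sigma> 0)) + 4 * Re (mangoldt_series (Complex \<sigma> y)) + Re (mangoldt_series (Complex \<sigma> (2 * y))))"
    by (intro sums_add sums_mult Re_mangoldt_series_sums assms)
  moreover have "3 * (mangoldt n * real n powr (- \<sigma>) * cos (0 * ln (real n))) + 4 * (mangoldt n * real n powr (- \<sigma>) * cos (y * ln (real n)))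
     + mangoldt n * real n powr (- \<sigma>) * cos (2 * y * ln (real n)) \<ge> 0" for n
  proof -
    define c where "c = cos (y * ln (real n))"
    have "cos (2 * y * ln (real n)) = 2 * c\<^sup>2 - 1" unfolding c_def using cos_double_cos[of "y * ln (real n)"] by (simp add: mult.assoc)
    then have "3 * (mangoldt n * real n powr (- \<sigma>) * cos (0 * ln (real n))) + 4 * (mangoldt n * real n powr (- \<sigma>) * cos (y * ln (real n)))
     + mangoldt n * real n powr (- \<sigma>) * cos (2 * y * ln (real n)) = mangoldt n * real n powr (- \<sigma>) * (2 * (1 + c)\<^sup>2)"
      unfolding c_def[symmetric] by (simp only:) (simp add: power2_eq_square algebra_simps)
    also have "\<dots> \<ge> 0" by (intro mult_nonneg_nonneg) (auto simp: mangoldt_nonneg)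
    finally show ?thesis .
  qed
  ultimately show ?thesis by (rule sums_le[OF _ sums_zero, rotated])
qed

text \<open>For \<open>Re s > 1\<close> the series stays bounded near \<open>s\<close>, so the order
  \<open>m\<close> in \<open>mangoldt_series_limit\<close> is 0. On the line \<open>Re s = 1\<close>
  the inequality of \<open>mangoldt_series_341\<close>, multiplied by \<open>t\<close> and taken to
  the limit, becomes \<open>0 \<le> 3 * (1 - m0) - 4 * m1 - m2\<close> with the orders at 1,
  \<open>s\<close> and the point of twice the height; hence \<open>4 * m1 \<le> 3\<close>.\<close>

theorem zeta_factor_nonzero:
  assumes "Re s \<ge> 1"
  shows "zeta_factor s \<noteq> 0"
proof (cases "Re s = 1")
  case False
  then have s: "Re s > 1" using assms by simp
  obtain m where m: "m = 0 \<longrightarrow> zeta_factor s \<noteq> 0"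
    "((\<lambda>t::real. of_real t * mangoldt_series (s + of_real t)) \<longlongrightarrow> (if s = 1 then 1 else 0) - of_nat m) (at_right 0)"
    using mangoldt_series_limit[OF assms] .
  define B where "B = (\<Sum>n. mangoldt n * real n powr (- Re s))"
  have bound: "norm (mangoldt_series (s + of_real t)) \<le> B" if t: "t > 0" for t
  proof -
    have sm: "summable (\<lambda>n. norm (mangoldt n * nat_power n (s + of_real t)))"
      using s t by (intro summable_norm_mangoldt_series) simp
    have "norm (mangoldt_series (s + of_real t)) \<le> (\<Sum>n. norm (mangoldt n * nat_power n (s + of_real t)))"
      unfolding mangoldt_series_def by (rule summable_norm[OF sm])
    also have "\<dots> \<le> B"
      unfolding B_def
    proof (rule suminf_le[OF _ sm summable_mangoldt_powr[OF s]])
      show "norm (mangoldt n * nat_power n (s + of_real t)) \<le> mangoldt n * real n powr (- Re s)" for n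
        using t by (cases "n = 0") (auto simp: norm_mult norm_nat_power mangoldt_nonneg intro!: mult_left_mono powr_mono)
    qed
    finally show ?thesis .
  qed
  have "((\<lambda>t::real. of_real t * mangoldt_series (s + of_real t)) \<longlongrightarrow> 0) (at_right 0)"
  proof (rule Lim_null_comparison)
    show "\<forall>\<^sub>F t in at_right 0. norm (of_real t * mangoldt_series (s + of_real t)) \<le> t * B"
      using eventually_at_right_less[of "0::real"]
      by eventually_elim (auto simp: norm_mult intro!: mult_left_mono bound)
    show "((\<lambda>t. t * B) \<longlongrightarrow> 0) (at_right 0)" by (auto intro!: tendsto_eq_intros)
  qed
  from tendsto_unique[OF trivial_limit_at_right_real this m(2)]
  have "(0::complex) = (if s = 1 then 1 else 0) - of_nat m" .
  moreover have "s \<noteq> 1" using s by auto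
  ultimately show ?thesis using m(1) by simp
next
  case True
  show ?thesis
  proof (cases "s = 1")
    case True
    then show ?thesis by (simp add: zeta_factor_1)
  next
    case False
    define y where "y = Im s"
    have s: "s = Complex 1 y" using True by (simp add: y_def complex_eq_iff)
    have y: "y \<noteq> 0"
    proof
      assume "y = 0"
      then have "s = 1" using s by (simp add: complex_eq_iff)
      then show False using False by simp
    qed
    have lim: "\<exists>m::nat. (m = 0 \<longrightarrow> zeta_factor (Complex 1 u) \<noteq> 0) \<and> ((\<lambda>t::real. t * Re (mangoldt_series (Complex (1 + t) u))) \<longlongrightarrow> (if u = 0 then 1 else 0) - of_nat m) (at_right 0)" for u
    proof -
      have "Re (Complex 1 u) \<ge> 1" by simp
      from mangoldt_series_limit[OF this]
      obtain m :: nat where m: "m = 0 \<longrightarrow> zeta_factor (Complex 1 u) \<noteq> 0"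
        "((\<lambda>t::real. of_real t * mangoldt_series (Complex 1 u + of_real t)) \<longlongrightarrow> (if Complex 1 u = 1 then 1 else 0) - of_nat m) (at_right 0)"
        .
      have "Complex 1 u + of_real t = Complex (1 + t) u" for t by (simp add: complex_eq_iff)
      moreover have "Complex 1 u = 1 \<longleftrightarrow> u = 0" by (simp add: complex_eq_iff)
      ultimately have "((\<lambda>t::real. Re (of_real t * mangoldt_series (Complex (1 + t) u))) \<longlongrightarrow> Re ((if u = 0 then 1 else 0) - of_nat m)) (at_right 0)"
        using m(2) by (intro tendsto_Re) simp
      moreover have "Re ((if u = 0 then 1 else 0) - of_nat m) = (if u = 0 then 1 else 0) - of_nat m" by simp
      ultimately show ?thesis using m(1) by (intro exI[of _ m]) simp
    qed
    from lim[of 0] obtain m0 :: nat where m0: "((\<lambda>t::real. t * Re (mangoldt_series (Complex (1 + t) 0))) \<longlongrightarrow> (if (0::real) = 0 then 1 else 0) - of_nat m0) (at_right 0)"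
      by (elim exE conjE)
    from lim[of y] obtain m1 :: nat where m1: "m1 = 0 \<longrightarrow> zeta_factor s \<noteq> 0" "((\<lambda>t::real. t * Re (mangoldt_series (Complex (1 + t) y))) \<longlongrightarrow> (if y = 0 then 1 else 0) - of_nat m1) (at_right 0)"
      unfolding s[symmetric] by (elim exE conjE)
    from lim[of "2 * y"] obtain m2 :: nat where m2: "((\<lambda>t::real. t * Re (mangoldt_series (Complex (1 + t) (2 * y)))) \<longlongrightarrow> (if 2 * y = 0 then 1 else 0) - of_nat m2) (at_right 0)"
      by (elim exE conjE)
    have "((\<lambda>t. 3 * (t * Re (mangoldt_series (Complex (1 + t) 0))) + 4 * (t * Re (mangoldt_series (Complex (1 + t) y))) + t * Re (mangoldt_series (Complex (1 + t) (2 * y))))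
       \<longlongrightarrow> 3 * ((if (0::real) = 0 then 1 else 0) - real m0) + 4 * ((if y = 0 then 1 else 0) - real m1) + ((if 2 * y = 0 then 1 else 0) - real m2)) (at_right 0)"
      by (intro tendsto_add tendsto_mult tendsto_const m0 m1 m2)
    moreover have "\<forall>\<^sub>F t in at_right 0. 3 * (t * Re (mangoldt_series (Complex (1 + t) 0))) + 4 * (t * Re (mangoldt_series (Complex (1 + t) y))) + t * Re (mangoldt_series (Complex (1 + t) (2 * y))) \<ge> 0"
      using eventually_at_right_less[of "0::real"]
    proof eventually_elim
      case (elim t)
      then have "0 \<le> t * (3 * Re (mangoldt_series (Complex (1 + t) 0)) + 4 * Re (mangoldt_series (Complex (1 + t) y)) + Re (mangoldt_series (Complex (1 + t) (2 * y))))"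
        using mangoldt_series_341[of "1 + t" y] by (intro mult_nonneg_nonneg) auto
      then show ?case by (simp add: algebra_simps)
    qed
    ultimately have "0 \<le> 3 * ((if (0::real) = 0 then 1 else 0) - real m0) + 4 * ((if y = 0 then 1 else 0) - real m1) + ((if 2 * y = 0 then 1 else 0) - real m2)"
      by (rule tendsto_lowerbound) simp
    then have "4 * real m1 \<le> 3" using y by simp
    then have "m1 = 0" by linarith
    then show ?thesis using m1(1) by simp
  qed
qed

section \<open>The Wiener--Ikehara upper bound\<close>

definition psi :: "real \<Rightarrow> real" where
  "psi x = (\<Sum>n | real n \<le> x. mangoldt n)"

lemma finite_real_le [simp]: "finite {n::nat. real n \<le> x}"
  by (rule finite_subset[of _ "{..nat \<lfloor>x\<rfloor>}"]) (auto simp: le_nat_floor)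

lemma psi_mono: "x \<le> y \<Longrightarrow> psi x \<le> psi y"
  unfolding psi_def by (intro sum_mono2) (auto simp: mangoldt_nonneg)

lemma psi_nonneg: "psi x \<ge> 0"
  unfolding psi_def by (intro sum_nonneg) (auto simp: mangoldt_nonneg)

text \<open>\<open>psi x / x\<close> in the variable \<open>u = ln x\<close>, in which the Mellin
  transform becomes a Laplace transform and the Fourier arguments apply on the whole line.\<close>

definition psi_ratio :: "real \<Rightarrow> real" where
  "psi_ratio u = psi (exp u) * exp (- u)"

lemma psi_ratio_nonneg: "psi_ratio u \<ge> 0"
  by (simp add: psi_ratio_def psi_nonneg)

lemma
  fixes w :: complex
  assumes w: "Re w > 0"
  shows exp_tail_integrable: "set_integrable lborel {c..} (\<lambda>u. exp (- (w * of_real u)))"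
    and exp_tail_integral: "(LBINT u:{c..}. exp (- (w * of_real u))) = exp (- (w * of_real c)) / w"
proof -
  have w0: "w \<noteq> 0" using w by auto
  have "set_integrable lborel {c..} (\<lambda>u. exp (- (u * Re w)))"
  proof -
    have "((\<lambda>u. exp (- Re w * u)) has_integral exp (- Re w * c) / Re w) {c..}"
      using has_integral_exp_minus_to_infinity[OF w, of c] by simp
    then have "(\<lambda>u. exp (- Re w * u)) absolutely_integrable_on {c..}"
      by (intro nonnegative_absolutely_integrable_1) auto
    then have "set_integrable lebesgue {c..} (\<lambda>u. exp (- Re w * u))" .
    then have "set_integrable lborel {c..} (\<lambda>u. exp (- Re w * u))"
      unfolding set_integrable_def by (subst (asm) integrable_completion) auto
    then show ?thesis by (simp add: mult.commute)
  qed
  then show int: "set_integrable lborel {c..} (\<lambda>u. exp (- (w * of_real u)))"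
    unfolding set_integrable_def
    by (rule Bochner_Integration.integrable_bound) (auto simp: mult.commute intro!: AE_I2 split: split_indicator)
  have lim1: "((\<lambda>b. LBINT u:{c..b}. exp (- (w * of_real u))) \<longlongrightarrow> (LBINT u:{c..}. exp (- (w * of_real u)))) at_top"
    by (rule tendsto_set_lebesgue_integral_at_top[OF _ int]) auto
  have lim2: "((\<lambda>b. LBINT u:{c..b}. exp (- (w * of_real u))) \<longlongrightarrow> exp (- (w * of_real c)) / w - 0) at_top"
  proof (rule Lim_transform_eventually)
    show "((\<lambda>b. exp (- (w * of_real c)) / w - exp (- (w * of_real b)) / w) \<longlongrightarrow> exp (- (w * of_real c)) / w - 0) at_top"
    proof (intro tendsto_diff tendsto_const, rule tendsto_norm_zero_cancel)
      show "((\<lambda>b. norm (exp (- (w * of_real b)) / w)) \<longlongrightarrow> 0) at_top"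
        using w w0 unfolding norm_divide norm_exp_eq_Re by simp real_asymp
    qed
    show "\<forall>\<^sub>F b in at_top. exp (- (w * of_real c)) / w - exp (- (w * of_real b)) / w = (LBINT u:{c..b}. exp (- (w * of_real u)))"
      using eventually_ge_at_top[of c]
    proof eventually_elim
      case (elim b)
      have "((\<lambda>u. exp (- (w * of_real u))) has_integral (- exp (- (w * of_real b)) / w - (- exp (- (w * of_real c)) / w))) {c..b}"
      proof (rule fundamental_theorem_of_calculus[OF elim])
        fix u
        have "((\<lambda>z. - exp (- (w * z)) / w) has_field_derivative exp (- (w * of_real u))) (at (of_real u))"
          using w0 by (auto intro!: derivative_eq_intros)
        then have "((\<lambda>u. - exp (- (w * of_real u)) / w) has_vector_derivative exp (- (w * of_real u))) (at u)"
          by (rule has_vector_derivative_real_field)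
        then show "((\<lambda>u. - exp (- (w * of_real u)) / w) has_vector_derivative exp (- (w * of_real u))) (at u within {c..b})"
          by (rule has_vector_derivative_at_within)
      qed
      moreover have "set_integrable lborel {c..b} (\<lambda>u. exp (- (w * of_real u)))"
        by (rule borel_integrable_atLeastAtMost') (intro continuous_intros)
      then have "(LBINT u:{c..b}. exp (- (w * of_real u))) = integral {c..b} (\<lambda>u. exp (- (w * of_real u)))"
        by (rule set_borel_integral_eq_integral)
      ultimately show ?case by (simp add: integral_unique)
    qed
  qed
  show "(LBINT u:{c..}. exp (- (w * of_real u))) = exp (- (w * of_real c)) / w"
    using tendsto_unique[OF trivial_limit_at_top_linorder lim1 lim2] by simp
qed

text \<open>\<open>psi\<close> is a sum of steps at the integers, so the Laplace transform is
  integrated term by term: step \<open>n\<close> contributes the tail integral from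
  \<open>ln n\<close> on. The integral may run over the whole line because \<open>psi_ratio\<close>
  vanishes for negative arguments.\<close>

lemma
  fixes s :: complex
  assumes s: "Re s > 0"
  shows psi_ratio_exp_integrable: "integrable lborel (\<lambda>u. psi_ratio u * exp (- (s * of_real u)))"
    and psi_ratio_exp_integral: "(\<integral>u. psi_ratio u * exp (- (s * of_real u)) \<partial>lborel) = mangoldt_series (1 + s) / (1 + s)"
proof -
  define w where "w = 1 + s"
  have w: "Re w > 1" "w \<noteq> 0" using s by (auto simp: w_def complex_eq_iff)
  define f where "f = (\<lambda>(n::nat) u. of_real (mangoldt n) * (indicat_real {ln (real n)..} u *\<^sub>R exp (- (w * complex_of_real u))))"
  have fi: "integrable lborel (f n)" for n
    unfolding f_def using exp_tail_integrable[of w "ln (real n)"] w unfolding set_integrable_def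
    by (intro integrable_mult_right) simp
  have fint: "(\<integral>u. f n u \<partial>lborel) = mangoldt n * nat_power n w / w" for n
  proof -
    have "(\<integral>u. f n u \<partial>lborel) = of_real (mangoldt n) * (LBINT u:{ln (real n)..}. exp (- (w * of_real u)))"
      unfolding f_def set_lebesgue_integral_def by (simp only: integral_mult_right_zero)
    also have "\<dots> = of_real (mangoldt n) * (exp (- (w * of_real (ln (real n)))) / w)"
      using exp_tail_integral[of w "ln (real n)"] w by simp
    also have "\<dots> = mangoldt n * nat_power n w / w"
      by (cases "n = 0") (auto simp: nat_power_def)
    finally show ?thesis .
  qed
  have nint: "(\<integral>u. norm (f n u) \<partial>lborel) = mangoldt n * real n powr (- Re w) / Re w" for n
  proof -
    have "norm (f n u) = mangoldt n * (indicat_real {ln (real n)..} u *\<^sub>R exp (- (Re w * u)))" for u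
      by (auto simp: f_def norm_mult mangoldt_nonneg split: split_indicator)
    then have "complex_of_real (\<integral>u. norm (f n u) \<partial>lborel) = (\<integral>u. of_real (mangoldt n * (indicat_real {ln (real n)..} u *\<^sub>R exp (- (Re w * u)))) \<partial>lborel)"
      by (simp only: integral_complex_of_real)
    also have "\<dots> = of_real (mangoldt n) * (LBINT u:{ln (real n)..}. exp (- (of_real (Re w) * complex_of_real u)))"
    proof -
      have "complex_of_real (mangoldt n * (indicat_real {ln (real n)..} u *\<^sub>R exp (- (Re w * u)))) =
        of_real (mangoldt n) * (indicat_real {ln (real n)..} u *\<^sub>R exp (- (of_real (Re w) * complex_of_real u)))" for u
        by (simp add: scaleR_conv_of_real exp_of_real[symmetric])
      then show ?thesis unfolding set_lebesgue_integral_def by (simp only: integral_mult_right_zero)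
    qed
    also have "\<dots> = of_real (mangoldt n) * (exp (- (of_real (Re w) * of_real (ln (real n)))) / of_real (Re w))"
      using exp_tail_integral[of "of_real (Re w)" "ln (real n)"] w by simp
    also have "\<dots> = of_real (mangoldt n * real n powr (- Re w) / Re w)"
      by (cases "n = 0") (auto simp: powr_def exp_of_real[symmetric])
    finally show ?thesis using of_real_eq_iff by blast
  qed
  have f0: "f n u = 0" if "n \<notin> {n. real n \<le> exp u}" for n u
  proof -
    have "exp u < real n" using that by simp
    then have "u < ln (real n)" by (metis exp_gt_zero ln_exp ln_less_cancel_iff order_less_trans)
    then show ?thesis by (simp add: f_def)
  qed
  have sums: "(\<lambda>n. f n u) sums (psi_ratio u * exp (- (s * of_real u)))" for u
  proof -
    have "(\<lambda>n. f n u) sums (\<Sum>n | real n \<le> exp u. f n u)"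
      by (intro sums_finite f0) auto
    also have "(\<Sum>n | real n \<le> exp u. f n u) = (\<Sum>n | real n \<le> exp u. of_real (mangoldt n) * exp (- (w * of_real u)))"
    proof (intro sum.cong refl)
      fix n :: nat assume n: "n \<in> {n. real n \<le> exp u}"
      show "f n u = of_real (mangoldt n) * exp (- (w * of_real u))"
      proof (cases "n = 0")
        case False
        then have "ln (real n) \<le> u" using n by (metis mem_Collect_eq ln_exp ln_le_cancel_iff exp_gt_zero of_nat_0_less_iff gr0I)
        then show ?thesis by (simp add: f_def)
      qed (simp add: f_def)
    qed
    also have "\<dots> = of_real (psi (exp u)) * exp (- (w * of_real u))"
      unfolding psi_def of_real_sum sum_distrib_right ..
    also have "\<dots> = psi_ratio u * exp (- (s * of_real u))"
    proof -
      have "exp (- (w * of_real u)) = of_real (exp (- u)) * exp (- (s * of_real u))"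
        unfolding exp_of_real[symmetric] exp_add[symmetric] by (simp add: w_def algebra_simps)
      then show ?thesis by (simp add: psi_ratio_def)
    qed
    finally show ?thesis .
  qed
  have A: "AE u in lborel. summable (\<lambda>n. norm (f n u))"
  proof (intro AE_I2)
    show "summable (\<lambda>n. norm (f n u))" for u
      by (rule summable_finite[OF finite_real_le[of "exp u"]]) (drule f0, simp)
  qed
  have B: "summable (\<lambda>n. \<integral>u. norm (f n u) \<partial>lborel)"
    unfolding nint using summable_mangoldt_powr[OF w(1)] by (rule summable_divide)
  have eq: "(\<lambda>u. \<Sum>n. f n u) = (\<lambda>u. psi_ratio u * exp (- (s * of_real u)))"
    using sums by (auto simp: sums_iff)
  show "integrable lborel (\<lambda>u. psi_ratio u * exp (- (s * of_real u)))"
    using integrable_suminf[OF fi A B] unfolding eq .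
  have "(\<integral>u. psi_ratio u * exp (- (s * of_real u)) \<partial>lborel) = (\<Sum>n. mangoldt n * nat_power n w / w)"
    using integral_suminf[OF fi A B] unfolding eq fint .
  also have "\<dots> = mangoldt_series w / w"
    unfolding mangoldt_series_def
    by (rule suminf_divide) (rule summable_norm_cancel[OF summable_norm_mangoldt_series[OF w(1)]])
  finally show "(\<integral>u. psi_ratio u * exp (- (s * of_real u)) \<partial>lborel) = mangoldt_series (1 + s) / (1 + s)"
    by (simp add: w_def)
qed

text \<open>For \<open>Re s > 0\<close> this is the Laplace transform of \<open>psi_ratio\<close>
  minus the pole \<open>1 / s\<close>. Expressing it by \<open>zeta_factor\<close> keeps it
  meaningful on the line \<open>Re s = 0\<close>, including 0; the summand 1 comes from
  \<open>1 / s = (1 / s + 1) / (1 + s)\<close>.\<close>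

definition regular_part :: "complex \<Rightarrow> complex" where
  "regular_part s = - (deriv zeta_factor (1 + s) / zeta_factor (1 + s) + 1) / (1 + s)"

lemma regular_part_eq:
  assumes s: "Re s > 0"
  shows "regular_part s = mangoldt_series (1 + s) / (1 + s) - 1 / s"
proof -
  have s0: "s \<noteq> 0" "1 + s \<noteq> 0" using s by (auto simp: complex_eq_iff)
  have "zeta_factor (1 + s) \<noteq> 0" by (rule zeta_factor_nonzero) (use s in simp)
  then have "deriv zeta_factor (1 + s) / zeta_factor (1 + s) = 1 / s - mangoldt_series (1 + s)"
    using deriv_zeta_factor[of "1 + s"] s by simp
  then have "regular_part s = - (1 / s - mangoldt_series (1 + s) + 1) / (1 + s)"
    unfolding regular_part_def by (simp only:)
  then show ?thesis using s0 by (simp add: field_simps minus_divide_left)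
qed

text \<open>The nonvanishing of \<open>zeta_factor\<close> on the line \<open>Re s = 1\<close>
  enters here: it is what allows the boundary \<open>Re s = 0\<close>.\<close>

lemma regular_part_continuous: "continuous_on {s. Re s \<ge> 0} regular_part"
proof -
  have hol: "zeta_factor holomorphic_on {s. Re s > 0}" by (rule zeta_factor_holomorphic_sums)
  have c1: "continuous_on {s. Re s > 0} zeta_factor" "continuous_on {s. Re s > 0} (deriv zeta_factor)"
    using hol holomorphic_deriv[OF hol open_halfspace_Re_gt] by (auto intro: holomorphic_on_imp_continuous_on)
  have "continuous_on {s. Re s \<ge> 0} (\<lambda>s. zeta_factor (1 + s))" "continuous_on {s. Re s \<ge> 0} (\<lambda>s. deriv zeta_factor (1 + s))"
    by (rule continuous_on_compose2[OF c1(1)] continuous_on_compose2[OF c1(2)]; auto intro!: continuous_intros)+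
  moreover have "1 + s \<noteq> 0" if "Re s \<ge> 0" for s using that by (auto simp: complex_eq_iff)
  ultimately show ?thesis
    unfolding regular_part_def
    by (intro continuous_intros) (auto intro!: zeta_factor_nonzero)
qed

lemma
  assumes \<sigma>: "\<sigma> > 0"
  shows psi_error_integrable: "integrable lborel (\<lambda>u. (psi_ratio u - indicator {0..} u) * exp (- (\<sigma> * u)))"
    and psi_error_fourier: "(\<integral>u. complex_of_real ((psi_ratio u - indicator {0..} u) * exp (- (\<sigma> * u))) * iexp (- (t * u)) \<partial>lborel) = regular_part (Complex \<sigma> t)"
proof -
  have i1: "integrable lborel (\<lambda>u. psi_ratio u * exp (- (s * complex_of_real u)))" if "Re s > 0" for s
    using psi_ratio_exp_integrable[OF that] .
  have i2: "integrable lborel (\<lambda>u. indicat_real {0..} u *\<^sub>R exp (- (s * complex_of_real u)))" if "Re s > 0" for s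
    using exp_tail_integrable[OF that, of 0] unfolding set_integrable_def .
  have eq: "complex_of_real ((psi_ratio u - indicator {0..} u) * exp (- (\<sigma> * u))) * iexp (- (t * u))
     = psi_ratio u * exp (- (Complex \<sigma> t * complex_of_real u)) - indicat_real {0..} u *\<^sub>R exp (- (Complex \<sigma> t * complex_of_real u))" for u t
  proof -
    have "complex_of_real (exp (- (\<sigma> * u))) * iexp (- (t * u)) = exp (- (Complex \<sigma> t * complex_of_real u))"
      unfolding exp_of_real[symmetric] exp_add[symmetric]
      by (rule arg_cong[where f = exp]) (simp add: complex_eq_iff)
    then show ?thesis by (simp add: scaleR_conv_of_real left_diff_distrib mult.assoc)
  qed
  have "integrable lborel (\<lambda>u. complex_of_real ((psi_ratio u - indicator {0..} u) * exp (- (\<sigma> * u))) * iexp (- (0 * u)))"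
    unfolding eq by (intro Bochner_Integration.integrable_diff i1 i2) (use \<sigma> in simp_all)
  then show "integrable lborel (\<lambda>u. (psi_ratio u - indicator {0..} u) * exp (- (\<sigma> * u)))"
    by (simp only: mult_zero_left minus_zero of_real_0 mult_zero_right exp_zero mult_1_right complex_of_real_integrable_eq)
  have "(\<integral>u. complex_of_real ((psi_ratio u - indicator {0..} u) * exp (- (\<sigma> * u))) * iexp (- (t * u)) \<partial>lborel)
    = (\<integral>u. psi_ratio u * exp (- (Complex \<sigma> t * complex_of_real u)) \<partial>lborel) - (\<integral>u. indicat_real {0..} u *\<^sub>R exp (- (Complex \<sigma> t * complex_of_real u)) \<partial>lborel)"
    unfolding eq by (intro Bochner_Integration.integral_diff i1 i2) (use \<sigma> in simp_all)
  also have "\<dots> = regular_part (Complex \<sigma> t)"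
    using psi_ratio_exp_integral[of "Complex \<sigma> t"] exp_tail_integral[of "Complex \<sigma> t" 0] \<sigma>
    by (simp add: regular_part_eq set_lebesgue_integral_def)
  finally show "(\<integral>u. complex_of_real ((psi_ratio u - indicator {0..} u) * exp (- (\<sigma> * u))) * iexp (- (t * u)) \<partial>lborel) = regular_part (Complex \<sigma> t)" .
qed

text \<open>By Fubini, weighting a Fourier transform with \<open>k\<close> is the same as convolving
  the original function with the transform of \<open>k\<close>.\<close>

lemma fourier_swap:
  fixes k f :: "real \<Rightarrow> real"
  assumes k: "integrable lborel k" and f: "integrable lborel f"
  shows "(\<integral>t. complex_of_real (k t) * iexp (y * t) * (\<integral>u. complex_of_real (f u) * iexp (- (t * u)) \<partial>lborel) \<partial>lborel)
    = (\<integral>u. complex_of_real (f u) * (\<integral>t. complex_of_real (k t) * iexp ((y - u) * t) \<partial>lborel) \<partial>lborel)"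
proof -
  have [measurable]: "k \<in> borel_measurable borel" "f \<in> borel_measurable borel" using k f by auto
  define h where "h = (\<lambda>t u. complex_of_real (k t) * (complex_of_real (f u) * iexp ((y - u) * t)))"
  have hm: "case_prod h \<in> borel_measurable (lborel \<Otimes>\<^sub>M lborel)"
    unfolding h_def by measurable
  have nh: "norm (h t u) = \<bar>k t\<bar> * \<bar>f u\<bar>" for t u by (simp add: h_def norm_mult)
  have "integrable (lborel \<Otimes>\<^sub>M lborel) (case_prod h)"
  proof (rule lborel_pair.Fubini_integrable[OF hm])
    show "integrable lborel (\<lambda>t. \<integral>u. norm (case_prod h (t, u)) \<partial>lborel)"
      using k f by (simp add: nh)
    show "AE t in lborel. integrable lborel (\<lambda>u. case_prod h (t, u))"
    proof (intro AE_I2)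
      fix t
      have "integrable lborel (\<lambda>u. \<bar>k t\<bar> * \<bar>f u\<bar>)" using f by simp
      then show "integrable lborel (\<lambda>u. case_prod h (t, u))"
      proof (rule Bochner_Integration.integrable_bound)
        show "(\<lambda>u. case_prod h (t, u)) \<in> borel_measurable lborel" by (simp add: h_def)
        show "AE u in lborel. norm (case_prod h (t, u)) \<le> norm (\<bar>k t\<bar> * \<bar>f u\<bar>)" by (simp add: nh)
      qed
    qed
  qed
  from lborel_pair.Fubini_integral[OF this]
  have "(\<integral>t. (\<integral>u. h t u \<partial>lborel) \<partial>lborel) = (\<integral>u. (\<integral>t. h t u \<partial>lborel) \<partial>lborel)" by simp
  moreover have "(\<integral>u. h t u \<partial>lborel) = complex_of_real (k t) * iexp (y * t) * (\<integral>u. complex_of_real (f u) * iexp (- (t * u)) \<partial>lborel)" for t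
  proof -
    have "h t u = (complex_of_real (k t) * iexp (y * t)) * (complex_of_real (f u) * iexp (- (t * u)))" for u
    proof -
      have "iexp ((y - u) * t) = iexp (y * t) * iexp (- (t * u))"
        unfolding exp_add[symmetric] by (rule arg_cong[where f = exp]) (simp add: algebra_simps)
      then show ?thesis by (simp add: h_def)
    qed
    then show ?thesis by (simp only: integral_mult_right_zero)
  qed
  moreover have "(\<integral>t. h t u \<partial>lborel) = complex_of_real (f u) * (\<integral>t. complex_of_real (k t) * iexp ((y - u) * t) \<partial>lborel)" for u
  proof -
    have "h t u = complex_of_real (f u) * (complex_of_real (k t) * iexp ((y - u) * t))" for t
      by (simp add: h_def)
    then show ?thesis by (simp only: integral_mult_right_zero)
  qed
  ultimately show ?thesis by (simp only:)
qed

section \<open>The Fejer kernel and the Riemann--Lebesgue lemma\<close>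

definition fejer_weight :: "real \<Rightarrow> real \<Rightarrow> real" where
  "fejer_weight l t = max 0 (1 - \<bar>t\<bar> / l)"

text \<open>The value at \<open>0\<close> is the junk value \<open>0\<close> instead of \<open>1\<close>; only integrals of this function matter.\<close>

definition fejer_kernel :: "real \<Rightarrow> real" where
  "fejer_kernel x = 2 * (1 - cos x) / x\<^sup>2"

lemma fejer_weight_bounds: "0 \<le> fejer_weight l t" "l > 0 \<Longrightarrow> fejer_weight l t \<le> 1"
  by (auto simp: fejer_weight_def)

lemma fejer_weight_eq_0: "l > 0 \<Longrightarrow> \<bar>t\<bar> \<ge> l \<Longrightarrow> fejer_weight l t = 0"
  by (simp add: fejer_weight_def field_simps)

lemma fejer_weight_continuous [continuous_intros]: "continuous_on S (fejer_weight l)"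
  unfolding fejer_weight_def[abs_def] by (cases "l = 0") (auto intro!: continuous_intros)

lemma continuous_compact_support_integrable:
  fixes f :: "real \<Rightarrow> complex"
  assumes f: "continuous_on UNIV f" and 0: "\<And>t. t \<notin> {-l..l} \<Longrightarrow> f t = 0"
  shows "integrable lborel f"
proof -
  have "set_integrable lborel {-l..l} f"
    by (intro borel_integrable_atLeastAtMost' continuous_on_subset[OF f]) auto
  moreover have "indicator {-l..l} t *\<^sub>R f t = f t" for t using 0[of t] by (auto split: split_indicator)
  ultimately show ?thesis unfolding set_integrable_def by simp
qed

lemma fejer_weight_integrable:
  assumes l: "l > 0"
  shows "integrable lborel (fejer_weight l)"
proof -
  have "integrable lborel (\<lambda>t. complex_of_real (fejer_weight l t))"
    by (rule continuous_compact_support_integrable[of _ l])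
       (use l fejer_weight_eq_0 in \<open>auto intro!: continuous_intros\<close>)
  then show ?thesis unfolding complex_of_real_integrable_eq .
qed

lemma fejer_fourier:
  assumes l: "l > 0" and v: "v \<noteq> 0"
  shows "(\<integral>t. complex_of_real (fejer_weight l t) * iexp (v * t) \<partial>lborel) = l * fejer_kernel (l * v)"
proof -
  define f where "f = (\<lambda>t. complex_of_real (fejer_weight l t) * iexp (v * t))"
  have f0: "f t = 0" if "t \<notin> {-l..l}" for t
    using that fejer_weight_eq_0[OF l, of t] by (auto simp: f_def)
  have fint: "integrable lborel f"
    by (rule continuous_compact_support_integrable[OF _ f0]) (auto simp: f_def intro!: continuous_intros)
  \<comment> \<open>\<open>P\<close> and \<open>Q\<close> are antiderivatives, found by integration
    by parts, of the integrand on the right and on the left half of the triangle.\<close>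
  define P where "P = (\<lambda>z::complex. ((1 - z / l) / (\<i> * v) - 1 / (l * v\<^sup>2)) * exp (\<i> * (v * z)))"
  define Q where "Q = (\<lambda>z::complex. ((1 + z / l) / (\<i> * v) + 1 / (l * v\<^sup>2)) * exp (\<i> * (v * z)))"
  have "(f has_integral (P (complex_of_real l) - P (complex_of_real 0))) {0..l}"
  proof (rule fundamental_theorem_of_calculus)
    fix t assume t: "t \<in> {0..l}"
    have "(P has_field_derivative (1 - complex_of_real t / l) * exp (\<i> * (v * complex_of_real t))) (at (complex_of_real t))"
      unfolding P_def using l v
      by (auto intro!: derivative_eq_intros simp: field_simps power2_eq_square)
    then have "((\<lambda>t. P (complex_of_real t)) has_vector_derivative (1 - complex_of_real t / l) * exp (\<i> * (v * complex_of_real t))) (at t)"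
      by (rule has_vector_derivative_real_field)
    moreover have "f t = (1 - complex_of_real t / l) * exp (\<i> * (v * complex_of_real t))"
      using t l by (simp add: f_def fejer_weight_def max_def field_simps)
    ultimately show "((\<lambda>t. P (complex_of_real t)) has_vector_derivative f t) (at t within {0..l})"
      by (simp add: has_vector_derivative_at_within)
  qed (use l in simp)
  moreover have "(f has_integral (Q (complex_of_real 0) - Q (complex_of_real (- l)))) {-l..0}"
  proof (rule fundamental_theorem_of_calculus)
    fix t assume t: "t \<in> {-l..0}"
    have "(Q has_field_derivative (1 + complex_of_real t / l) * exp (\<i> * (v * complex_of_real t))) (at (complex_of_real t))"
      unfolding Q_def using l v
      by (auto intro!: derivative_eq_intros simp: field_simps power2_eq_square)
    then have "((\<lambda>t. Q (complex_of_real t)) has_vector_derivative (1 + complex_of_real t / l) * exp (\<i> * (v * complex_of_real t))) (at t)"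
      by (rule has_vector_derivative_real_field)
    moreover have "f t = (1 + complex_of_real t / l) * exp (\<i> * (v * complex_of_real t))"
      using t l by (simp add: f_def fejer_weight_def max_def field_simps)
    ultimately show "((\<lambda>t. Q (complex_of_real t)) has_vector_derivative f t) (at t within {-l..0})"
      by (simp add: has_vector_derivative_at_within)
  qed (use l in simp)
  ultimately have "(f has_integral ((Q (complex_of_real 0) - Q (complex_of_real (- l))) + (P (complex_of_real l) - P (complex_of_real 0)))) {-l..l}"
    by (intro has_integral_combine[of "-l" 0 l]) (use l in auto)
  moreover have "(Q (complex_of_real 0) - Q (complex_of_real (- l))) + (P (complex_of_real l) - P (complex_of_real 0)) = complex_of_real (l * fejer_kernel (l * v))"
  proof -
    have e: "exp (\<i> * (v * complex_of_real l)) + exp (\<i> * (v * complex_of_real (- l))) = 2 * cos (l * v)"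
    proof -
      have "complex_of_real (cos (l * v)) = (exp (\<i> * complex_of_real (l * v)) + exp (- (\<i> * complex_of_real (l * v)))) / 2"
        using cos_exp_eq[of "complex_of_real (l * v)"] unfolding cos_of_real .
      then show ?thesis by (simp add: mult_ac)
    qed
    have "(Q (complex_of_real 0) - Q (complex_of_real (- l))) + (P (complex_of_real l) - P (complex_of_real 0))
       = (2 - (exp (\<i> * (v * complex_of_real l)) + exp (\<i> * (v * complex_of_real (- l))))) / (l * v\<^sup>2)"
      unfolding P_def Q_def using l v by (simp add: diff_divide_distrib add_divide_distrib algebra_simps)
    also have "\<dots> = complex_of_real (l * fejer_kernel (l * v))"
      unfolding e using l v by (simp add: fejer_kernel_def power2_eq_square field_simps)
    finally show ?thesis .
  qed
  ultimately have "(f has_integral complex_of_real (l * fejer_kernel (l * v))) {-l..l}" by simp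
  then have "(f has_integral complex_of_real (l * fejer_kernel (l * v))) UNIV"
    by (rule has_integral_on_superset) (use f0 in auto)
  moreover have "(f has_integral (integral\<^sup>L lborel f)) UNIV"
    by (rule has_integral_integral_lborel[OF fint])
  ultimately show ?thesis unfolding f_def by (rule has_integral_unique[rotated])
qed

lemma fejer_kernel_eq: "fejer_kernel x = 4 * (sin (x / 2))\<^sup>2 / x\<^sup>2"
  using cos_double_sin[of "x / 2"] by (simp add: fejer_kernel_def)

lemma fejer_kernel_nonneg: "fejer_kernel x \<ge> 0"
  by (simp add: fejer_kernel_eq)

lemma fejer_kernel_le_1: "fejer_kernel x \<le> 1"
proof (cases "x = 0")
  case False
  have "\<bar>sin (x / 2)\<bar>\<^sup>2 \<le> \<bar>x / 2\<bar>\<^sup>2" by (intro power_mono abs_sin_x_le_abs_x) auto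
  then have "4 * (sin (x / 2))\<^sup>2 \<le> x\<^sup>2" by (simp add: power2_eq_square)
  then show ?thesis using False by (simp add: fejer_kernel_eq)
qed (simp add: fejer_kernel_def)

lemma fejer_kernel_measurable [measurable]: "fejer_kernel \<in> borel_measurable borel"
  unfolding fejer_kernel_def[abs_def] by measurable

lemma fejer_kernel_integrable: "integrable lborel fejer_kernel"
proof (rule Bochner_Integration.integrable_bound)
  show "integrable lborel (\<lambda>x::real. 5 * inverse (1 + x\<^sup>2))"
    using integrable_inverse_1_plus_square unfolding set_integrable_def einterval_eq
    by (intro integrable_mult_right) simp
  show "AE x in lborel. norm (fejer_kernel x) \<le> norm (5 * inverse (1 + x\<^sup>2))"
  proof (intro AE_I2)
    fix x :: real
    have "(sin (x / 2))\<^sup>2 \<le> 1" by (simp add: abs_square_le_1)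
    then have "fejer_kernel x * x\<^sup>2 \<le> 4" by (cases "x = 0") (auto simp: fejer_kernel_eq)
    then have "fejer_kernel x * (1 + x\<^sup>2) \<le> 5" using fejer_kernel_le_1[of x] by (simp add: distrib_left)
    moreover have "1 + x\<^sup>2 > 0" by (simp add: add_pos_nonneg)
    ultimately have "fejer_kernel x \<le> 5 * inverse (1 + x\<^sup>2)" by (simp add: divide_inverse[symmetric] pos_le_divide_eq)
    then show "norm (fejer_kernel x) \<le> norm (5 * inverse (1 + x\<^sup>2))" using fejer_kernel_nonneg[of x] by simp
  qed
qed simp

text \<open>In \<open>psi_upper\<close> the mass of the kernel occurs on both sides and is divided
  out. Positivity is visible on \<open>{1..2}\<close>, where the kernel is at least
  \<open>(1 - cos 1) / 2\<close>.\<close>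

lemma fejer_kernel_integral_pos: "(\<integral>x. fejer_kernel x \<partial>lborel) > 0"
proof -
  have c: "cos (1::real) < 1" using cos_monotone_0_pi[of 0 1] pi_gt3 by simp
  have "(\<integral>x. indicator {1..2::real} x * ((1 - cos 1) / 2) \<partial>lborel) \<le> (\<integral>x. fejer_kernel x \<partial>lborel)"
  proof (rule integral_mono[OF _ fejer_kernel_integrable])
    show "integrable lborel (\<lambda>x. indicat_real {1..2::real} x * ((1 - cos 1) / 2))"
      by (intro integrable_mult_left integrable_real_indicator) (auto simp: emeasure_lborel_Icc_eq)
    show "indicator {1..2::real} x * ((1 - cos 1) / 2) \<le> fejer_kernel x" for x :: real
    proof (cases "x \<in> {1..2}")
      case True
      then have "cos x \<le> cos 1" using pi_gt3 by (intro cos_monotone_0_pi_le) auto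
      moreover have "x\<^sup>2 \<le> 2\<^sup>2" using True by (intro power_mono) auto
      ultimately have "2 * (1 - cos 1) / 2\<^sup>2 \<le> 2 * (1 - cos x) / x\<^sup>2" using True c by (intro frac_le) auto
      moreover have "2 * (1 - cos (1::real)) / 2\<^sup>2 = (1 - cos 1) / 2" by simp
      ultimately have "(1 - cos 1) / 2 \<le> fejer_kernel x" unfolding fejer_kernel_def by linarith
      then show ?thesis using True by simp
    qed (simp add: fejer_kernel_nonneg)
  qed
  then show ?thesis using c by simp
qed

text \<open>Translating by the half period \<open>\<pi> / y\<close> changes the sign of \<open>iexp (y * t)\<close>.\<close>

lemma riemann_lebesgue_compact:
  fixes f :: "real \<Rightarrow> complex"
  assumes f: "continuous_on UNIV f" and 0: "\<And>t. t \<notin> {-l..l} \<Longrightarrow> f t = 0"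
  shows "((\<lambda>y. \<integral>t. f t * iexp (y * t) \<partial>lborel) \<longlongrightarrow> 0) at_top"
proof -
  have fint: "integrable lborel f" by (rule continuous_compact_support_integrable[OF f 0])
  have fm [measurable]: "f \<in> borel_measurable borel" using f by (rule borel_measurable_continuous_onI)
  have "compact (f ` {-l..l})" by (intro compact_continuous_image continuous_on_subset[OF f]) auto
  then obtain B where B: "\<And>t. t \<in> {-l..l} \<Longrightarrow> norm (f t) \<le> B" "B > 0"
    by (metis bounded_pos compact_imp_bounded imageI)
  have Bf: "norm (f t) \<le> B" for t using B 0[of t] by (cases "t \<in> {-l..l}") auto
  have lim: "((\<lambda>y. \<integral>t. norm (f t - f (pi / y + 1 * t)) \<partial>lborel) \<longlongrightarrow> integral\<^sup>L lborel (\<lambda>_::real. 0::real)) at_top"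
  proof (rule integral_dominated_convergence_at_top[where s = "\<lambda>y t. norm (f t - f (pi / y + 1 * t))" and f = "\<lambda>_. 0::real"
      and M = lborel and w = "\<lambda>t. indicator {-l-pi..l+pi} t * (2 * B)"])
    show "integrable lborel (\<lambda>t. indicator {-l-pi..l+pi} t * (2 * B))"
      by (intro integrable_mult_left integrable_real_indicator) (auto simp: emeasure_lborel_Icc_eq)
    show "AE t in lborel. ((\<lambda>y. norm (f t - f (pi / y + 1 * t))) \<longlongrightarrow> 0) at_top"
    proof (intro AE_I2)
      fix t
      have "((\<lambda>y. pi / y + 1 * t) \<longlongrightarrow> t) at_top" by real_asymp
      moreover have "isCont f t" using f by (simp add: continuous_on_eq_continuous_at)
      ultimately have "((\<lambda>y. f (pi / y + 1 * t)) \<longlongrightarrow> f t) at_top" by (rule isCont_tendsto_compose[rotated])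
      then have "((\<lambda>y. norm (f t - f (pi / y + 1 * t))) \<longlongrightarrow> norm (f t - f t)) at_top"
        by (intro tendsto_intros)
      then show "((\<lambda>y. norm (f t - f (pi / y + 1 * t))) \<longlongrightarrow> 0) at_top" by simp
    qed
    \<comment> \<open>For \<open>y \<ge> 1\<close> the translation is by at most \<open>pi\<close>,
      which gives one interval for the dominating function.\<close>
    show "\<forall>\<^sub>F y in at_top. AE t in lborel. norm (norm (f t - f (pi / y + 1 * t))) \<le> indicator {-l-pi..l+pi} t * (2 * B)"
      using eventually_ge_at_top[of 1]
    proof eventually_elim
      case (elim y)
      have py: "0 < pi / y" "pi / y \<le> pi" using elim by (auto simp: field_simps)
      show ?case
      proof (intro AE_I2)
        fix t
        show "norm (norm (f t - f (pi / y + 1 * t))) \<le> indicator {-l-pi..l+pi} t * (2 * B)"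
        proof (cases "t \<in> {-l-pi..l+pi}")
          case True
          have "norm (f t - f (pi / y + 1 * t)) \<le> B + B"
            by (rule order.trans[OF norm_triangle_ineq4]) (intro add_mono Bf)
          then show ?thesis using True by simp
        next
          case False
          then have "t \<notin> {-l..l}" "pi / y + 1 * t \<notin> {-l..l}" using py by auto
          then show ?thesis using False by (simp add: 0)
        qed
      qed
    qed
  qed simp_all
  have shift: "norm (\<integral>t. f t * iexp (y * t) \<partial>lborel) \<le> (\<integral>t. norm (f t - f (pi / y + 1 * t)) \<partial>lborel)" if y: "y > 0" for y
  proof -
    have i1: "integrable lborel (\<lambda>t. f t * iexp (y * t))"
      by (rule Bochner_Integration.integrable_bound[OF fint]) (auto simp: norm_mult)
    have fint': "integrable lborel (\<lambda>t. f (pi / y + 1 * t))"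
      using fint by (subst lborel_integrable_real_affine_iff) auto
    have i2: "integrable lborel (\<lambda>t. f (pi / y + 1 * t) * iexp (y * t))"
      by (rule Bochner_Integration.integrable_bound[OF fint']) (auto simp: norm_mult)
    have "(\<integral>t. f t * iexp (y * t) \<partial>lborel) = \<bar>1::real\<bar> *\<^sub>R (\<integral>t. f (pi / y + 1 * t) * iexp (y * (pi / y + 1 * t)) \<partial>lborel)"
      by (rule lborel_integral_real_affine) simp
    also have "\<dots> = (\<integral>t. - (f (pi / y + 1 * t) * iexp (y * t)) \<partial>lborel)"
    proof -
      have "iexp (y * (pi / y + 1 * t)) = - iexp (y * t)" for t
      proof -
        have "iexp (y * (pi / y + 1 * t)) = exp (\<i> * pi) * iexp (y * t)"
          unfolding exp_add[symmetric] by (rule arg_cong[where f = exp]) (use y in \<open>simp add: field_simps\<close>)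
        then show ?thesis by simp
      qed
      then show ?thesis by simp
    qed
    also have "\<dots> = - (\<integral>t. f (pi / y + 1 * t) * iexp (y * t) \<partial>lborel)" by (rule integral_minus)
    finally have "2 * (\<integral>t. f t * iexp (y * t) \<partial>lborel) = (\<integral>t. f t * iexp (y * t) \<partial>lborel) - (\<integral>t. f (pi / y + 1 * t) * iexp (y * t) \<partial>lborel)"
      by simp
    also have "\<dots> = (\<integral>t. f t * iexp (y * t) - f (pi / y + 1 * t) * iexp (y * t) \<partial>lborel)"
      by (rule Bochner_Integration.integral_diff[OF i1 i2, symmetric])
    also have "norm \<dots> \<le> (\<integral>t. norm (f t * iexp (y * t) - f (pi / y + 1 * t) * iexp (y * t)) \<partial>lborel)"
      by (rule integral_norm_bound)
    also have "\<dots> = (\<integral>t. norm (f t - f (pi / y + 1 * t)) \<partial>lborel)"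
      unfolding left_diff_distrib[symmetric] norm_mult by simp
    finally show ?thesis
      using norm_ge_zero[of "\<integral>t. f t * iexp (y * t) \<partial>lborel"] unfolding norm_mult norm_numeral by linarith
  qed
  show ?thesis
  proof (rule Lim_null_comparison)
    show "\<forall>\<^sub>F y in at_top. norm (\<integral>t. f t * iexp (y * t) \<partial>lborel) \<le> (\<integral>t. norm (f t - f (pi / y + 1 * t)) \<partial>lborel)"
      using eventually_gt_at_top[of 0] by eventually_elim (rule shift)
    show "((\<lambda>y. \<integral>t. norm (f t - f (pi / y + 1 * t)) \<partial>lborel) \<longlongrightarrow> 0) at_top" using lim by simp
  qed
qed

text \<open>For \<sigma> > 0 this is the error \<open>psi_ratio - indicator {0..}\<close>, damped by
  \<open>exp (- (\<sigma> * u))\<close> and averaged around \<open>y\<close> against the Fejer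
  kernel. At \<sigma> = 0 it is defined by the boundary values of
  \<open>regular_part\<close>.\<close>

definition smoothed_error :: "real \<Rightarrow> real \<Rightarrow> real \<Rightarrow> complex" where
  "smoothed_error l \<sigma> y = (\<integral>t. complex_of_real (fejer_weight l t) * iexp (y * t) * regular_part (Complex \<sigma> t) \<partial>lborel)"

definition fejer_mass :: "real \<Rightarrow> real" where
  "fejer_mass T = (\<integral>x. indicator {-T..T} x * fejer_kernel x \<partial>lborel)"

lemma fejer_mass_limit: "(\<lambda>n. fejer_mass (real n)) \<longlonglongrightarrow> (\<integral>x. fejer_kernel x \<partial>lborel)"
  unfolding fejer_mass_def
proof (rule integral_dominated_convergence[where w = fejer_kernel])
  show "AE x in lborel. (\<lambda>n. indicator {- real n..real n} x * fejer_kernel x) \<longlonglongrightarrow> fejer_kernel x"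
  proof (intro AE_I2 tendsto_eventually)
    fix x :: real
    obtain N where N: "real N > \<bar>x\<bar>" using reals_Archimedean2 by blast
    show "\<forall>\<^sub>F n in sequentially. indicator {- real n..real n} x * fejer_kernel x = fejer_kernel x"
      using eventually_ge_at_top[of N] by eventually_elim (use N in \<open>auto simp: indicator_def\<close>)
  qed
  show "AE x in lborel. norm (indicator {- real n..real n} x * fejer_kernel x) \<le> fejer_kernel x" for n
    by (intro AE_I2) (auto simp: indicator_def fejer_kernel_nonneg)
qed (use fejer_kernel_integrable in auto)

text \<open>As \<open>psi\<close> is monotone, \<open>psi_ratio\<close> cannot fall by more than the
  factor \<open>exp (- (2 * \<eta>))\<close> on the window from \<open>y\<close> to
  \<open>y + 2 * \<eta>\<close>, whose center is \<open>y + \<eta>\<close>. Outside the window it is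
  nonnegative, and the subtracted indicator costs at most the total mass of the kernel. So a large
  value at \<open>y\<close> forces a large smoothed error.\<close>

lemma psi_ratio_window_positive:
  assumes l: "l > 0" and \<sigma>: "\<sigma> > 0" and y: "y \<ge> 0" and \<eta>: "\<eta> > 0"
  shows "psi_ratio y * exp (- (2 * \<eta>)) * exp (- (\<sigma> * (y + 2 * \<eta>))) * fejer_mass (l * \<eta>)
     \<le> (\<integral>x. fejer_kernel x \<partial>lborel) + norm (smoothed_error l \<sigma> (y + \<eta>))"
proof -
  let ?I = "\<integral>x. fejer_kernel x \<partial>lborel"
  define y0 where "y0 = y + \<eta>"
  define E where "E = (\<lambda>u. (psi_ratio u - indicator {0..} u) * exp (- (\<sigma> * u)))"
  define K where "K = (\<lambda>u. l * fejer_kernel (l * (y0 - u)))"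
  define c where "c = psi_ratio y * exp (- (2 * \<eta>)) * exp (- (\<sigma> * (y + 2 * \<eta>)))"
  have Em: "integrable lborel E" unfolding E_def by (rule psi_error_integrable[OF \<sigma>])
  then have [measurable]: "E \<in> borel_measurable borel" by auto
  have Km [measurable]: "K \<in> borel_measurable borel" unfolding K_def by measurable
  have K0: "K u \<ge> 0" for u using l fejer_kernel_nonneg by (simp add: K_def)
  have K1: "K u \<le> l" for u using l mult_left_mono[OF fejer_kernel_le_1, of l] by (simp add: K_def)
  have EK: "integrable lborel (\<lambda>u. E u * K u)"
  proof (rule Bochner_Integration.integrable_bound)
    show "integrable lborel (\<lambda>u. E u * l)" using Em by simp
    show "AE u in lborel. norm (E u * K u) \<le> norm (E u * l)"
      using K0 K1 l by (intro AE_I2) (auto simp: abs_mult intro!: mult_left_mono)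
  qed simp
  have R: "smoothed_error l \<sigma> y0 = of_real (\<integral>u. E u * K u \<partial>lborel)"
  proof -
    have "smoothed_error l \<sigma> y0 = (\<integral>t. complex_of_real (fejer_weight l t) * iexp (y0 * t) * (\<integral>u. complex_of_real (E u) * iexp (- (t * u)) \<partial>lborel) \<partial>lborel)"
      unfolding smoothed_error_def E_def psi_error_fourier[OF \<sigma>] ..
    also have "\<dots> = (\<integral>u. complex_of_real (E u) * (\<integral>t. complex_of_real (fejer_weight l t) * iexp ((y0 - u) * t) \<partial>lborel) \<partial>lborel)"
      by (rule fourier_swap[OF fejer_weight_integrable[OF l] Em])
    also have "\<dots> = (\<integral>u. complex_of_real (E u * K u) \<partial>lborel)"
    proof (rule integral_cong_AE)
      \<comment> \<open>At \<open>u = y0\<close> the kernel has its junk value and the transform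
        formula fails; a single point is a null set.\<close>
      have ae: "AE u in lborel. u \<noteq> y0" by (rule AE_lborel_singleton)
      show "AE u in lborel. complex_of_real (E u) * (\<integral>t. complex_of_real (fejer_weight l t) * iexp ((y0 - u) * t) \<partial>lborel) = complex_of_real (E u * K u)"
        using ae
      proof eventually_elim
        case (elim u)
        then show ?case using fejer_fourier[OF l, of "y0 - u"] by (simp add: K_def)
      qed
    qed (measurable, use fejer_weight_integrable[OF l] in auto)
    also have "\<dots> = of_real (\<integral>u. E u * K u \<partial>lborel)" by (rule integral_complex_of_real)
    finally show ?thesis .
  qed
  have intK: "(\<integral>x. g x * fejer_kernel x \<partial>lborel) = (\<integral>u. g (l * (y0 - u)) * K u \<partial>lborel)" for g :: "real \<Rightarrow> real"
  proof -
    have "(\<integral>x. g x * fejer_kernel x \<partial>lborel) = \<bar>- l\<bar> *\<^sub>R (\<integral>u. g (l * y0 + (- l) * u) * fejer_kernel (l * y0 + (- l) * u) \<partial>lborel)"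
      by (rule lborel_integral_real_affine) (use l in simp)
    also have "\<dots> = (\<integral>u. l * (g (l * y0 + (- l) * u) * fejer_kernel (l * y0 + (- l) * u)) \<partial>lborel)"
      using l by simp
    also have "\<dots> = (\<integral>u. g (l * (y0 - u)) * K u \<partial>lborel)"
      by (intro Bochner_Integration.integral_cong refl) (simp add: K_def algebra_simps)
    finally show ?thesis .
  qed
  have Kint: "integrable lborel K"
  proof -
    have "integrable lborel (\<lambda>u. fejer_kernel (l * y0 + (- l) * u))"
      using fejer_kernel_integrable l by (subst lborel_integrable_real_affine_iff) auto
    then have "integrable lborel (\<lambda>u. l * fejer_kernel (l * y0 + (- l) * u))" by (rule integrable_mult_right)
    then show ?thesis by (simp add: K_def right_diff_distrib)
  qed
  have I: "?I = (\<integral>u. K u \<partial>lborel)"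
    using intK[of "\<lambda>_. 1"] by simp
  have ind: "indicator {- (l * \<eta>)..l * \<eta>} (l * (y0 - u)) = (indicator {y..y + 2 * \<eta>} u :: real)" for u
  proof -
    have "- (l * \<eta>) \<le> l * (y0 - u) \<longleftrightarrow> l * (- \<eta>) \<le> l * (y0 - u)" by simp
    then have "- (l * \<eta>) \<le> l * (y0 - u) \<longleftrightarrow> - \<eta> \<le> y0 - u" using l by (simp only: mult_le_cancel_left_pos)
    moreover have "l * (y0 - u) \<le> l * \<eta> \<longleftrightarrow> y0 - u \<le> \<eta>" using l by (simp only: mult_le_cancel_left_pos)
    ultimately show ?thesis by (auto simp: indicator_def y0_def)
  qed
  have J: "fejer_mass (l * \<eta>) = (\<integral>u. indicator {y..y + 2 * \<eta>} u * K u \<partial>lborel)"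
    using intK[of "indicator {- (l * \<eta>)..l * \<eta>}"] unfolding ind fejer_mass_def .
  have indK: "integrable lborel (\<lambda>u. indicator {y..y + 2 * \<eta>} u * K u)"
    by (rule Bochner_Integration.integrable_bound[OF Kint]) (auto simp: indicator_def)
  have ptw: "c * (indicator {y..y + 2 * \<eta>} u * K u) - K u \<le> E u * K u" for u
  proof -
    have ind_le: "indicator {0..} u * exp (- (\<sigma> * u)) \<le> (1::real)"
      using \<sigma> by (auto simp: indicator_def)
    have "c * indicator {y..y + 2 * \<eta>} u \<le> psi_ratio u * exp (- (\<sigma> * u))"
    proof (cases "u \<in> {y..y + 2 * \<eta>}")
      case True
      have "psi_ratio y * exp (- (2 * \<eta>)) = psi (exp y) * exp (- (y + 2 * \<eta>))"
        by (simp add: psi_ratio_def exp_add[symmetric] mult.assoc)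
      also have "\<dots> \<le> psi (exp u) * exp (- u)"
        using True by (intro mult_mono psi_mono) (auto simp: psi_nonneg)
      finally have "psi_ratio y * exp (- (2 * \<eta>)) \<le> psi_ratio u" by (simp add: psi_ratio_def)
      moreover have "exp (- (\<sigma> * (y + 2 * \<eta>))) \<le> exp (- (\<sigma> * u))"
        using True \<sigma> by simp
      ultimately show ?thesis using True unfolding c_def by (auto intro!: mult_mono simp: psi_ratio_nonneg)
    qed (simp add: psi_ratio_nonneg)
    then have "c * indicator {y..y + 2 * \<eta>} u - 1 \<le> E u"
      using ind_le by (simp add: E_def left_diff_distrib)
    then have "(c * indicator {y..y + 2 * \<eta>} u - 1) * K u \<le> E u * K u" using K0 by (rule mult_right_mono)
    then show ?thesis by (simp add: left_diff_distrib mult.assoc)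
  qed
  have "c * fejer_mass (l * \<eta>) - ?I = (\<integral>u. c * (indicator {y..y + 2 * \<eta>} u * K u) - K u \<partial>lborel)"
    unfolding J I by (subst Bochner_Integration.integral_diff) (use indK Kint in auto)
  also have "\<dots> \<le> (\<integral>u. E u * K u \<partial>lborel)"
    by (rule integral_mono[OF _ EK ptw]) (use indK Kint in auto)
  also have "\<dots> \<le> norm (smoothed_error l \<sigma> y0)" unfolding R by simp
  finally show ?thesis unfolding c_def y0_def by simp
qed

section \<open>Passage to the boundary and the bound for psi\<close>

lemma Complex_continuous [continuous_intros]:
  "continuous_on S f \<Longrightarrow> continuous_on S g \<Longrightarrow> continuous_on S (\<lambda>x. Complex (f x) (g x))"
  unfolding Complex_eq by (intro continuous_intros)

text \<open>The Fejer weight has compact support, so only a compact rectangle touching the line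
  \<open>Re s = 0\<close> matters; there \<open>regular_part\<close> is bounded and convergence is
  dominated.\<close>

lemma smoothed_error_limit:
  assumes l: "l > 0"
  shows "(\<lambda>n. smoothed_error l (inverse (real (Suc n))) y) \<longlonglongrightarrow> smoothed_error l 0 y"
proof -
  have cont: "continuous_on ({0..1} \<times> {-l..l}) (\<lambda>p. regular_part (Complex (fst p) (snd p)))"
    by (rule continuous_on_compose2[OF regular_part_continuous]) (auto intro!: continuous_intros)
  have "compact ((\<lambda>p. regular_part (Complex (fst p) (snd p))) ` ({0..1} \<times> {-l..l}))"
    by (intro compact_continuous_image cont compact_Times) auto
  then have "bounded ((\<lambda>p. regular_part (Complex (fst p) (snd p))) ` ({0..1} \<times> {-l..l}))"
    by (rule compact_imp_bounded)
  then obtain B where B: "B > 0" "\<And>p. p \<in> {0..1} \<times> {-l..l} \<Longrightarrow> norm (regular_part (Complex (fst p) (snd p))) \<le> B"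
    unfolding bounded_pos by blast
  have contt: "continuous_on UNIV (\<lambda>t. regular_part (Complex \<sigma> t))" if "\<sigma> \<ge> 0" for \<sigma>
    by (rule continuous_on_compose2[OF regular_part_continuous]) (use that in \<open>auto intro!: continuous_intros\<close>)
  have mt: "(\<lambda>t. complex_of_real (fejer_weight l t) * iexp (y * t) * regular_part (Complex \<sigma> t)) \<in> borel_measurable lborel" if "\<sigma> \<ge> 0" for \<sigma>
  proof -
    have "continuous_on UNIV (\<lambda>t. complex_of_real (fejer_weight l t) * iexp (y * t) * regular_part (Complex \<sigma> t))"
      by (intro continuous_intros contt that)
    then show ?thesis by (simp add: borel_measurable_continuous_onI)
  qed
  show ?thesis
    unfolding smoothed_error_def
  proof (rule integral_dominated_convergence[where w = "\<lambda>t. indicator {-l..l} t * B"])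
    show "AE t in lborel. (\<lambda>n. complex_of_real (fejer_weight l t) * iexp (y * t) * regular_part (Complex (inverse (real (Suc n))) t))
        \<longlonglongrightarrow> complex_of_real (fejer_weight l t) * iexp (y * t) * regular_part (Complex 0 t)"
    proof (intro AE_I2 tendsto_mult tendsto_const)
      fix t
      have "(\<lambda>n. Complex (inverse (real (Suc n))) t) \<longlonglongrightarrow> Complex 0 t"
        by (intro tendsto_Complex tendsto_const LIMSEQ_inverse_real_of_nat)
      then show "(\<lambda>n. regular_part (Complex (inverse (real (Suc n))) t)) \<longlonglongrightarrow> regular_part (Complex 0 t)"
        by (intro continuous_on_tendsto_compose[OF regular_part_continuous]) auto
    qed
    show "AE t in lborel. norm (complex_of_real (fejer_weight l t) * iexp (y * t) * regular_part (Complex (inverse (real (Suc n))) t)) \<le> indicator {-l..l} t * B" for n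
    proof (intro AE_I2)
      fix t
      show "norm (complex_of_real (fejer_weight l t) * iexp (y * t) * regular_part (Complex (inverse (real (Suc n))) t)) \<le> indicator {-l..l} t * B"
      proof (cases "t \<in> {-l..l}")
        case True
        have "inverse (real (Suc n)) \<le> 1" by (simp add: field_simps)
        then have "norm (regular_part (Complex (inverse (real (Suc n))) t)) \<le> B"
          using B(2)[of "(inverse (real (Suc n)), t)"] True by simp
        then have "fejer_weight l t * norm (regular_part (Complex (inverse (real (Suc n))) t)) \<le> 1 * B"
          using fejer_weight_bounds[of l t] l by (intro mult_mono) auto
        then show ?thesis using True fejer_weight_bounds(1)[of l t] by (simp add: norm_mult)
      next
        case False
        then show ?thesis using fejer_weight_eq_0[OF l, of t] by auto
      qed
    qed
    show "integrable lborel (\<lambda>t. indicator {-l..l} t * B)" by (intro integrable_mult_left integrable_real_indicator) (auto simp: emeasure_lborel_Icc_eq)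
  qed (use mt in auto)
qed

lemma psi_ratio_window:
  assumes l: "l > 0" and y: "y \<ge> 0" and \<eta>: "\<eta> > 0"
  shows "psi_ratio y * exp (- (2 * \<eta>)) * fejer_mass (l * \<eta>) \<le> (\<integral>x. fejer_kernel x \<partial>lborel) + norm (smoothed_error l 0 (y + \<eta>))"
proof (rule LIMSEQ_le)
  show "(\<lambda>n. (\<integral>x. fejer_kernel x \<partial>lborel) + norm (smoothed_error l (inverse (real (Suc n))) (y + \<eta>)))
     \<longlonglongrightarrow> (\<integral>x. fejer_kernel x \<partial>lborel) + norm (smoothed_error l 0 (y + \<eta>))"
    by (intro tendsto_add tendsto_const tendsto_norm smoothed_error_limit l)
  have "(\<lambda>n. exp (- (inverse (real (Suc n)) * (y + 2 * \<eta>)))) \<longlonglongrightarrow> exp (- (0 * (y + 2 * \<eta>)))"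
    by (intro tendsto_exp tendsto_minus tendsto_mult tendsto_const LIMSEQ_inverse_real_of_nat)
  then have "(\<lambda>n. psi_ratio y * exp (- (2 * \<eta>)) * exp (- (inverse (real (Suc n)) * (y + 2 * \<eta>))) * fejer_mass (l * \<eta>))
     \<longlonglongrightarrow> psi_ratio y * exp (- (2 * \<eta>)) * exp (- (0 * (y + 2 * \<eta>))) * fejer_mass (l * \<eta>)"
    by (intro tendsto_mult tendsto_const)
  then show "(\<lambda>n. psi_ratio y * exp (- (2 * \<eta>)) * exp (- (inverse (real (Suc n)) * (y + 2 * \<eta>))) * fejer_mass (l * \<eta>))
     \<longlonglongrightarrow> psi_ratio y * exp (- (2 * \<eta>)) * fejer_mass (l * \<eta>)" by simp
  show "\<exists>N. \<forall>n\<ge>N. psi_ratio y * exp (- (2 * \<eta>)) * exp (- (inverse (real (Suc n)) * (y + 2 * \<eta>))) * fejer_mass (l * \<eta>)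
     \<le> (\<integral>x. fejer_kernel x \<partial>lborel) + norm (smoothed_error l (inverse (real (Suc n))) (y + \<eta>))"
    using psi_ratio_window_positive[OF l _ y \<eta>] by (intro exI[of _ 0]) simp
qed

lemma smoothed_error_at_top:
  assumes l: "l > 0"
  shows "(smoothed_error l 0 \<longlongrightarrow> 0) at_top"
proof -
  have "continuous_on UNIV (\<lambda>t. regular_part (Complex 0 t))"
    by (rule continuous_on_compose2[OF regular_part_continuous]) (auto intro!: continuous_intros)
  then have "((\<lambda>y. \<integral>t. (complex_of_real (fejer_weight l t) * regular_part (Complex 0 t)) * iexp (y * t) \<partial>lborel) \<longlongrightarrow> 0) at_top"
    by (intro riemann_lebesgue_compact[of _ l]) (use l fejer_weight_eq_0 in \<open>auto intro!: continuous_intros\<close>)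
  moreover have "smoothed_error l 0 = (\<lambda>y. \<integral>t. (complex_of_real (fejer_weight l t) * regular_part (Complex 0 t)) * iexp (y * t) \<partial>lborel)"
    unfolding smoothed_error_def by (intro ext Bochner_Integration.integral_cong refl) (simp only: mult_ac)
  ultimately show ?thesis by simp
qed

text \<open>There are three losses of a factor \<open>1 + e\<close>: the possible fall of
  \<open>psi_ratio\<close> on a window of width \<open>2 * \<eta>\<close>, the mass of the kernel
  outside the window, and the smoothed error, which tends to 0 by the Riemann--Lebesgue lemma. The
  width is fixed first, then the scale \<open>l\<close>, then \<open>y\<close> grows.\<close>

theorem psi_upper:
  assumes \<epsilon>: "\<epsilon> > 0"
  shows "\<forall>\<^sub>F x in at_top. psi x \<le> (1 + \<epsilon>) * x"
proof -
  \<comment> \<open>For \<open>e \<le> 1\<close> the cube of \<open>1 + e\<close> is at most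
    \<open>1 + 7 * e\<close>.\<close>
  define e where "e = min 1 \<epsilon> / 7"
  have e: "0 < e" "e \<le> 1" using \<epsilon> by (auto simp: e_def)
  have cube: "(1 + e) * (1 + e) * (1 + e) \<le> 1 + \<epsilon>"
  proof -
    have "e * e \<le> e * 1" "e * e * e \<le> e * 1 * 1" using e by (intro mult_mono; simp)+
    then have "(1 + e) * (1 + e) * (1 + e) \<le> 1 + 7 * e" by (simp add: algebra_simps)
    also have "\<dots> \<le> 1 + \<epsilon>" by (simp add: e_def)
    finally show ?thesis .
  qed
  define I where "I = (\<integral>x. fejer_kernel x \<partial>lborel)"
  have I: "I > 0" unfolding I_def by (rule fejer_kernel_integral_pos)
  define \<eta> where "\<eta> = ln (1 + e) / 2"
  have \<eta>: "\<eta> > 0" "exp (2 * \<eta>) = 1 + e" using e by (auto simp: \<eta>_def)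
  have "I / (1 + e) < I" using I e by (simp add: field_simps)
  then have "\<forall>\<^sub>F n in sequentially. fejer_mass (real n) > I / (1 + e)"
    using fejer_mass_limit unfolding I_def[symmetric] by (rule order_tendstoD(1)[rotated])
  then have "\<forall>\<^sub>F n in sequentially. fejer_mass (real n) > I / (1 + e) \<and> n > 0"
    using eventually_gt_at_top[of 0] by (rule eventually_conj)
  then obtain n :: nat where n: "fejer_mass (real n) > I / (1 + e)" "n > 0"
    by (metis (mono_tags, lifting) eventually_happens' sequentially_bot)
  \<comment> \<open>With this scale the window corresponds to the interval from \<open>- n\<close>
    to \<open>n\<close> in the variable of the unscaled kernel.\<close>
  define l where "l = n / \<eta>"
  have l: "l > 0" "l * \<eta> = real n" using n \<eta> by (auto simp: l_def)
  have shift: "filterlim (\<lambda>y. y + \<eta>) at_top (at_top :: real filter)"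
    by real_asymp
  have "((\<lambda>y. norm (smoothed_error l 0 (y + \<eta>))) \<longlongrightarrow> 0) at_top"
    using filterlim_compose[OF smoothed_error_at_top[OF l(1)] shift] by (rule tendsto_norm_zero)
  then have "\<forall>\<^sub>F y in at_top. norm (smoothed_error l 0 (y + \<eta>)) < e * I"
    using e I by (intro order_tendstoD(2)) auto
  then have ev: "\<forall>\<^sub>F y in at_top. psi_ratio y \<le> 1 + \<epsilon>"
    using eventually_ge_at_top[of 0]
  proof eventually_elim
    case (elim y)
    have "psi_ratio y * exp (- (2 * \<eta>)) * (I / (1 + e)) \<le> psi_ratio y * exp (- (2 * \<eta>)) * fejer_mass (l * \<eta>)"
      using n by (intro mult_left_mono) (auto simp: l psi_ratio_nonneg)
    also have "\<dots> \<le> I + e * I"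
      using psi_ratio_window[OF l(1) elim(2) \<eta>(1)] elim(1) unfolding I_def by simp
    finally have "psi_ratio y * (1 / (1 + e)) * (I / (1 + e)) \<le> (1 + e) * I"
      using \<eta>(2) by (simp add: exp_minus inverse_eq_divide distrib_right)
    then have "psi_ratio y * (1 / (1 + e)) / (1 + e) * I \<le> (1 + e) * I" by simp
    then have "psi_ratio y * (1 / (1 + e)) / (1 + e) \<le> 1 + e" by (simp only: mult_le_cancel_right_pos[OF I])
    moreover have q: "1 + e > 0" using e by simp
    ultimately have "psi_ratio y * (1 / (1 + e)) \<le> (1 + e) * (1 + e)" by (simp only: pos_divide_le_eq)
    then have "psi_ratio y / (1 + e) \<le> (1 + e) * (1 + e)" by simp
    then have "psi_ratio y \<le> (1 + e) * (1 + e) * (1 + e)" by (simp only: pos_divide_le_eq[OF q])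
    then show ?case using cube by linarith
  qed
  have "\<forall>\<^sub>F x in at_top. psi_ratio (ln x) \<le> 1 + \<epsilon>"
    using ev ln_at_top by (rule eventually_compose_filterlim)
  then show ?thesis
    using eventually_gt_at_top[of 0]
    by eventually_elim (simp add: psi_ratio_def exp_minus field_simps)
qed

section \<open>The divisor sum\<close>

text \<open>Every divisor of \<open>p ^ k * m\<close> has the form \<open>p ^ i * d\<close> with
  \<open>d dvd m\<close>. Summing over all pairs, possibly with repetitions, gives a geometric
  series times \<open>sigma_half m\<close>.\<close>

lemma sigma_half_prime_power_mult:
  assumes p: "prime p" and m: "m > 0"
  shows "sigma_half (p ^ k * m) \<le> 1 / (1 - 1 / sqrt (real p)) * sigma_half m"
proof -
  have p2: "p \<ge> 2" using p by (rule prime_ge_2_nat)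
  define x where "x = 1 / sqrt (real p)"
  have x: "0 \<le> x" "x < 1" using p2 by (auto simp: x_def)
  have sub: "{d. d dvd p ^ k * m} \<subseteq> (\<lambda>(i, d). p ^ i * d) ` ({..k} \<times> {d. d dvd m})"
  proof
    fix d assume "d \<in> {d. d dvd p ^ k * m}"
    then obtain b c where "d = b * c" "b dvd p ^ k" "c dvd m" using division_decomp[of d "p ^ k" m] by auto
    moreover obtain i where "i \<le> k" "b = p ^ i" using \<open>b dvd p ^ k\<close> divides_primepow_nat[OF p] by auto
    ultimately show "d \<in> (\<lambda>(i, d). p ^ i * d) ` ({..k} \<times> {d. d dvd m})" by force
  qed
  have fin: "finite ({..k} \<times> {d. d dvd m})" using m by simp
  have "sigma_half (p ^ k * m) \<le> (\<Sum>d\<in>(\<lambda>(i, d). p ^ i * d) ` ({..k} \<times> {d. d dvd m}). 1 / sqrt (real d))"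
    unfolding sigma_half_def by (rule sum_mono2[OF finite_imageI[OF fin] sub]) auto
  also have "\<dots> \<le> (\<Sum>(i, d)\<in>{..k} \<times> {d. d dvd m}. 1 / sqrt (real (p ^ i * d)))"
    using sum_image_le[OF fin, of "\<lambda>d. 1 / sqrt (real d)" "\<lambda>(i, d). p ^ i * d"] by (auto simp: o_def case_prod_unfold)
  also have "\<dots> = (\<Sum>(i, d)\<in>{..k} \<times> {d. d dvd m}. x ^ i * (1 / sqrt (real d)))"
    by (intro sum.cong refl) (auto simp: x_def real_sqrt_mult real_sqrt_power power_divide)
  also have "\<dots> = (\<Sum>i\<le>k. x ^ i) * sigma_half m"
    by (simp add: sigma_half_def sum_product sum.cartesian_product)
  also have "\<dots> \<le> 1 / (1 - x) * sigma_half m"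
  proof (rule mult_right_mono)
    have "(\<Sum>i\<le>k. x ^ i) = (1 - x ^ Suc k) / (1 - x)" using x by (subst sum_gp0) auto
    also have "\<dots> \<le> 1 / (1 - x)" using x by (intro divide_right_mono) auto
    finally show "(\<Sum>i\<le>k. x ^ i) \<le> 1 / (1 - x)" .
    show "0 \<le> sigma_half m" unfolding sigma_half_def by (intro sum_nonneg) auto
  qed
  finally show ?thesis by (simp add: x_def)
qed

lemma sigma_half_le_prod:
  "a > 0 \<Longrightarrow> sigma_half a \<le> (\<Prod>p\<in>prime_factors a. 1 / (1 - 1 / sqrt (real p)))"
proof (induction a rule: less_induct)
  case (less a)
  show ?case
  proof (cases "a = 1")
    case True
    then show ?thesis by (simp add: sigma_half_def)
  next
    case False
    then obtain p where p: "prime p" "p dvd a" using prime_factor_nat by blast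
    obtain m where m: "a = p ^ multiplicity p a * m" "\<not> p dvd m"
      using multiplicity_decompose'[of a p] less.prems p(1) by (metis not_gr_zero not_prime_unit)
    define k where "k = multiplicity p a"
    have k: "k > 0" using p less.prems by (simp add: k_def prime_multiplicity_gt_zero_iff)
    have m0: "m > 0" using m(2) by (cases m) auto
    have "1 < p ^ k" using prime_gt_1_nat[OF p(1)] k by (intro one_less_power)
    then have "m < a" using m(1) m0 unfolding k_def by (metis mult.commute n_less_m_mult_n One_nat_def)
    have pf: "prime_factors a = insert p (prime_factors m)"
    proof -
      have "prime_factors a = prime_factors (p ^ k) \<union> prime_factors m"
        using m(1) m0 prime_gt_0_nat[OF p(1)] unfolding k_def by (metis prime_factors_product zero_less_power less_not_refl2)
      then show ?thesis using p(1) k by (simp add: prime_factors_power prime_prime_factors)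
    qed
    have notin: "p \<notin> prime_factors m" using m(2) by auto
    have pos: "0 \<le> 1 / (1 - 1 / sqrt (real p))" using prime_gt_1_nat[OF p(1)] by simp
    have "sigma_half a \<le> 1 / (1 - 1 / sqrt (real p)) * sigma_half m"
      using sigma_half_prime_power_mult[OF p(1) m0, of k] m(1) unfolding k_def by simp
    also have "\<dots> \<le> 1 / (1 - 1 / sqrt (real p)) * (\<Prod>p\<in>prime_factors m. 1 / (1 - 1 / sqrt (real p)))"
      by (rule mult_left_mono[OF less.IH[OF \<open>m < a\<close> m0] pos])
    also have "\<dots> = (\<Prod>p\<in>prime_factors a. 1 / (1 - 1 / sqrt (real p)))"
      unfolding pf using notin by simp
    finally show ?thesis .
  qed
qed

lemma inverse_one_minus_bound:
  fixes x :: real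
  assumes "0 \<le> x" "x < 1"
  shows "ln (1 / (1 - x)) \<le> x / (1 - x)"
proof -
  have "ln (1 / (1 - x)) \<le> 1 / (1 - x) - 1" using assms by (intro ln_le_minus_one) simp
  also have "\<dots> = x / (1 - x)" using assms by (simp add: field_simps)
  finally show ?thesis .
qed

text \<open>An Euler factor with \<open>x = 1 / sqrt p\<close> has logarithm at most
  \<open>x / (1 - x)\<close>. This is at most \<open>(1 + e) * x\<close> once
  \<open>sqrt p \<ge> 1 + 1 / e\<close>, which determines \<open>P\<close>. For each of the finitely
  many smaller primes it is at most 4, because \<open>x \<le> 3 / 4\<close> already for
  \<open>p = 2\<close>.\<close>

lemma ln_sigma_half_le:
  assumes e: "e > 0"
  obtains C where "\<And>a. a > 0 \<Longrightarrow> ln (sigma_half a) \<le> C + (1 + e) * (\<Sum>p\<in>prime_factors a. 1 / sqrt (real p))"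
proof -
  define P where "P = nat \<lceil>(1 + 1 / e)\<^sup>2\<rceil>"
  have P: "real P \<ge> (1 + 1 / e)\<^sup>2" unfolding P_def by linarith
  have summand: "ln (1 / (1 - 1 / sqrt (real p))) \<le> (if p < P then 4 else 0) + (1 + e) * (1 / sqrt (real p))" if p: "prime p" for p :: nat
  proof -
    define x where "x = 1 / sqrt (real p)"
    have p2: "p \<ge> 2" using p by (rule prime_ge_2_nat)
    then have x: "0 \<le> x" "x < 1" by (auto simp: x_def)
    show ?thesis
    proof (cases "p < P")
      case True
      have "sqrt (real p) \<ge> 4 / 3"
        by (rule real_le_rsqrt) (use p2 in \<open>simp add: power2_eq_square\<close>)
      then have "x \<le> 1 / (4 / 3)" unfolding x_def using p2 by (intro divide_left_mono) auto
      then have "x / (1 - x) \<le> 1 / (1 / 4)" using x by (intro frac_le) auto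
      then have "ln (1 / (1 - x)) \<le> 4" using inverse_one_minus_bound[OF x] by simp
      moreover have "(1 + e) * x \<ge> 0" using e x by simp
      ultimately show ?thesis using True by (simp add: x_def)
    next
      case False
      then have "(1 + 1 / e)\<^sup>2 \<le> real p" using P by linarith
      then have "1 + 1 / e \<le> sqrt (real p)" by (rule real_le_rsqrt)
      moreover have e1: "1 + 1 / e > 0" using e by (simp add: add_pos_pos)
      ultimately have "x \<le> 1 / (1 + 1 / e)" unfolding x_def using p2 by (intro divide_left_mono mult_pos_pos) auto
      also have "\<dots> = e / (1 + e)" using e by (simp add: field_simps)
      finally have "x * (1 + e) \<le> e" using e by (simp add: pos_le_divide_eq)
      then have "1 \<le> (1 + e) * (1 - x)" by (simp add: algebra_simps)
      then have "x * 1 \<le> x * ((1 + e) * (1 - x))" using x by (intro mult_left_mono) auto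
      then have "x / (1 - x) \<le> (1 + e) * x" using x by (simp add: pos_divide_le_eq mult_ac)
      then show ?thesis using inverse_one_minus_bound[OF x] False by (simp add: x_def)
    qed
  qed
  show ?thesis
  proof (rule that)
    fix a :: nat assume a: "a > 0"
    have posf: "1 / (1 - 1 / sqrt (real p)) > 0" if "p \<in> prime_factors a" for p
    proof -
      have "prime p" using that by (rule in_prime_factors_imp_prime)
      then have "p > 1" by (rule prime_gt_1_nat)
      then show ?thesis by simp
    qed
    have "ln (sigma_half a) \<le> ln (\<Prod>p\<in>prime_factors a. 1 / (1 - 1 / sqrt (real p)))"
      using sigma_half_le_prod[OF a] sigma_half_ge_1[OF a] posf by (subst ln_le_cancel_iff) (auto intro!: prod_pos)
    also have "\<dots> = (\<Sum>p\<in>prime_factors a. ln (1 / (1 - 1 / sqrt (real p))))"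
    proof (rule ln_prod)
      fix p assume "p \<in> prime_factors a"
      from less_imp_neq[OF posf[OF this]] show "1 / (1 - 1 / sqrt (real p)) \<noteq> 0" by (rule not_sym)
    qed simp
    also have "\<dots> \<le> (\<Sum>p\<in>prime_factors a. (if p < P then 4 else 0) + (1 + e) * (1 / sqrt (real p)))"
      by (intro sum_mono summand) auto
    also have "\<dots> = (\<Sum>p\<in>prime_factors a. if p < P then 4 else 0) + (1 + e) * (\<Sum>p\<in>prime_factors a. 1 / sqrt (real p))"
      by (simp add: sum.distrib sum_distrib_left)
    also have "(\<Sum>p\<in>prime_factors a. if p < P then 4 else (0::real)) \<le> 4 * P"
    proof -
      have "(\<Sum>p\<in>prime_factors a. if p < P then 4 else (0::real)) = 4 * card (prime_factors a \<inter> {p. p < P})"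
        by (subst sum.If_cases) (auto simp: mult.commute)
      also have "card (prime_factors a \<inter> {p. p < P}) \<le> card {..<P}" by (intro card_mono) auto
      finally show ?thesis by simp
    qed
    finally show "ln (sigma_half a) \<le> 4 * P + (1 + e) * (\<Sum>p\<in>prime_factors a. 1 / sqrt (real p))" by simp
  qed
qed

text \<open>The gain \<open>1 / sqrt p\<close> of a prime per unit of its cost \<open>ln p\<close>;
  as this ratio decreases, small primes are the most profitable.\<close>

definition sqrt_log_weight :: "nat \<Rightarrow> real" where
  "sqrt_log_weight n = 1 / (sqrt n * ln n)"

lemma sqrt_log_weight_pos: "n \<ge> 2 \<Longrightarrow> sqrt_log_weight n > 0"
  by (simp add: sqrt_log_weight_def)

lemma sqrt_log_weight_antimono: "2 \<le> m \<Longrightarrow> m \<le> n \<Longrightarrow> sqrt_log_weight n \<le> sqrt_log_weight m"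
  unfolding sqrt_log_weight_def by (intro divide_left_mono mult_mono mult_pos_pos) auto

text \<open>Lagrangian relaxation: among all sets of primes with \<open>\<Sum> ln p \<le> ln a\<close>, the sum of
  \<open>1 / sqrt p\<close> is largest for the initial segment of the primes, with multiplier \<open>sqrt_log_weight Y\<close>.\<close>

lemma sum_prime_factors_le:
  assumes a: "a > 0" and Y: "Y \<ge> 2"
  shows "(\<Sum>p\<in>prime_factors a. 1 / sqrt (real p))
    \<le> sqrt_log_weight Y * ln a + (\<Sum>n=2..Y. mangoldt n * (sqrt_log_weight n - sqrt_log_weight Y))"
proof -
  let ?g = sqrt_log_weight
  \<comment> \<open>Cost at the multiplier price plus surplus. The total cost is bounded by
    \<open>ln a\<close>; the surplus is nonpositive for \<open>p > Y\<close>, and for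
    \<open>p \<le> Y\<close> it may be summed over all prime powers up to \<open>Y\<close>.\<close>
  have split: "1 / sqrt (real p) = ln p * ?g Y + mangoldt p * (?g p - ?g Y)" if p: "prime p" for p :: nat
    using prime_ge_2_nat[OF p] p by (simp add: sqrt_log_weight_def right_diff_distrib)
  have "(\<Sum>p\<in>prime_factors a. 1 / sqrt (real p)) = (\<Sum>p\<in>prime_factors a. ln p * ?g Y + mangoldt p * (?g p - ?g Y))"
    by (intro sum.cong refl split) auto
  also have "\<dots> = (\<Sum>p\<in>prime_factors a. ln p) * ?g Y + (\<Sum>p\<in>prime_factors a. mangoldt p * (?g p - ?g Y))"
    by (simp add: sum.distrib sum_distrib_right)
  also have "\<dots> \<le> ln a * ?g Y + (\<Sum>n=2..Y. mangoldt n * (?g n - ?g Y))"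
  proof (intro add_mono mult_right_mono)
    have "(\<Sum>p\<in>prime_factors a. ln (real p)) = ln (\<Prod>p\<in>prime_factors a. real p)"
      by (rule ln_prod[symmetric]) (auto intro: prime_gt_0_nat)
    also have "\<dots> \<le> ln (real a)"
    proof (subst ln_le_cancel_iff)
      have "(\<Prod>p\<in>prime_factors a. real p) \<le> (\<Prod>p\<in>prime_factors a. real p ^ multiplicity p a)"
      proof (rule prod_mono)
        fix p assume "p \<in> prime_factors a"
        then have "p \<ge> 1" "multiplicity p a \<ge> 1"
          by (auto simp: prime_factors_multiplicity Suc_le_eq intro: prime_gt_0_nat)
        then show "0 \<le> real p \<and> real p \<le> real p ^ multiplicity p a"
          using power_increasing[of 1 "multiplicity p a" "real p"] by simp
      qed
      also have "\<dots> = real (\<Prod>p\<in>prime_factors a. p ^ multiplicity p a)" by simp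
      also have "\<dots> = real a" using prime_factorization_nat[of a] a by simp
      finally show "(\<Prod>p\<in>prime_factors a. real p) \<le> real a" .
    qed (use a in \<open>auto intro!: prod_pos prime_gt_0_nat\<close>)
    finally show "(\<Sum>p\<in>prime_factors a. ln (real p)) \<le> ln (real a)" .
    show "0 \<le> ?g Y" using sqrt_log_weight_pos[OF Y] by simp
    have "(\<Sum>p\<in>prime_factors a. mangoldt p * (?g p - ?g Y)) \<le> (\<Sum>p\<in>prime_factors a \<inter> {2..Y}. mangoldt p * (?g p - ?g Y))"
    proof -
      have "(\<Sum>p\<in>prime_factors a. mangoldt p * (?g p - ?g Y)) = (\<Sum>p\<in>prime_factors a \<inter> {2..Y}. mangoldt p * (?g p - ?g Y)) + (\<Sum>p\<in>prime_factors a - {2..Y}. mangoldt p * (?g p - ?g Y))"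
        by (rule sum.Int_Diff) simp
      moreover have "(\<Sum>p\<in>prime_factors a - {2..Y}. mangoldt p * (?g p - ?g Y)) \<le> 0"
      proof (rule sum_nonpos)
        fix p assume "p \<in> prime_factors a - {2..Y}"
        then have "prime p" "p \<notin> {2..Y}" by auto
        then have "p > Y" using prime_ge_2_nat[of p] by auto
        then have "?g p \<le> ?g Y" using Y by (intro sqrt_log_weight_antimono) auto
        then show "mangoldt p * (?g p - ?g Y) \<le> 0" by (intro mult_nonneg_nonpos mangoldt_nonneg) simp
      qed
      ultimately show ?thesis by simp
    qed
    also have "\<dots> \<le> (\<Sum>n=2..Y. mangoldt n * (?g n - ?g Y))"
      by (intro sum_mono2) (auto intro!: mult_nonneg_nonneg mangoldt_nonneg sqrt_log_weight_antimono)
    finally show "(\<Sum>p\<in>prime_factors a. mangoldt p * (?g p - ?g Y)) \<le> (\<Sum>n=2..Y. mangoldt n * (?g n - ?g Y))" .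
  qed
  finally show ?thesis by (simp add: mult.commute)
qed

section \<open>Partial summation with the bound for psi\<close>

lemma psi_upper_linear:
  assumes e: "e > 0"
  obtains C where "C \<ge> 0" "\<And>n::nat. psi n \<le> (1 + e) * n + C"
proof -
  obtain X where X: "\<And>x. x \<ge> X \<Longrightarrow> psi x \<le> (1 + e) * x"
    using psi_upper[OF e] by (auto simp: eventually_at_top_linorder)
  show ?thesis
  proof (rule that[of "psi (max 0 X)"])
    show "psi (max 0 X) \<ge> 0" by (rule psi_nonneg)
    fix n :: nat
    show "psi n \<le> (1 + e) * n + psi (max 0 X)"
    proof (cases "real n \<ge> X")
      case True
      then show ?thesis using X[OF True] psi_nonneg[of "max 0 X"] by linarith
    next
      case False
      then have "psi n \<le> psi (max 0 X)" by (intro psi_mono) auto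
      moreover have "(1 + e) * n \<ge> 0" using e by simp
      ultimately show ?thesis by linarith
    qed
  qed
qed

lemma psi_nat: "psi (real n) = (\<Sum>k\<le>n. mangoldt k)"
  unfolding psi_def by (intro sum.cong) auto

text \<open>Abel summation carried out as an induction on \<open>Y\<close>: the step adds
  \<open>psi Y\<close> times the drop of the weight, which is nonnegative, so \<open>psi\<close> may
  be replaced by its upper bound. The right-hand side is what the same summation yields for
  \<open>(1 + e) * n + C\<close>.\<close>

lemma mangoldt_weighted_sum_le:
  fixes C e :: real
  assumes C: "C \<ge> 0" "\<And>n::nat. psi n \<le> (1 + e) * n + C" and e: "e \<ge> 0" and Y: "Y \<ge> 2"
  shows "(\<Sum>n=2..Y. mangoldt n * (sqrt_log_weight n - sqrt_log_weight Y))
    \<le> (1 + e) * ((\<Sum>n=2..Y. sqrt_log_weight n) - Y * sqrt_log_weight Y + sqrt_log_weight 2) + C * (sqrt_log_weight 2 - sqrt_log_weight Y)"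
  using Y
proof (induction Y rule: dec_induct)
  case base
  show ?case by simp
next
  case (step Y)
  let ?g = sqrt_log_weight
  have psi_eq: "(\<Sum>n=2..Y. mangoldt n) = psi Y"
  proof -
    have "{..Y} = {0, 1} \<union> {2..Y}" using step.hyps by auto
    then show ?thesis unfolding psi_nat by (simp add: sum.union_disjoint)
  qed
  have "(\<Sum>n=2..Suc Y. mangoldt n * (?g n - ?g (Suc Y))) = (\<Sum>n=2..Y. mangoldt n * (?g n - ?g (Suc Y)))"
    using step.hyps by simp
  also have "\<dots> = (\<Sum>n=2..Y. mangoldt n * (?g n - ?g Y) + mangoldt n * (?g Y - ?g (Suc Y)))"
    by (intro sum.cong refl) (simp add: algebra_simps)
  also have "\<dots> = (\<Sum>n=2..Y. mangoldt n * (?g n - ?g Y)) + psi Y * (?g Y - ?g (Suc Y))"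
    by (simp add: sum.distrib sum_distrib_right[symmetric] psi_eq)
  also have "\<dots> \<le> ((1 + e) * ((\<Sum>n=2..Y. ?g n) - Y * ?g Y + ?g 2) + C * (?g 2 - ?g Y)) + ((1 + e) * Y + C) * (?g Y - ?g (Suc Y))"
    using step by (intro add_mono mult_right_mono C) (auto intro!: sqrt_log_weight_antimono)
  also have "\<dots> = (1 + e) * ((\<Sum>n=2..Suc Y. ?g n) - Suc Y * ?g (Suc Y) + ?g 2) + C * (?g 2 - ?g (Suc Y))"
    using step.hyps by (simp add: algebra_simps)
  finally show ?case .
qed

text \<open>The weight is asymptotically the derivative of \<open>2 * sqrt x / ln x\<close>. Hence
  its quotient by the increments of that function tends to 1, and the bound follows by induction
  from some \<open>M\<close> on, with \<open>C\<close> for the initial part.\<close>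

lemma sum_sqrt_log_weight_le:
  assumes e: "e > 0"
  obtains C where "\<And>Y. Y \<ge> 2 \<Longrightarrow> (\<Sum>n=2..Y. sqrt_log_weight n) \<le> C + (1 + e) * (2 * sqrt Y / ln Y)"
proof -
  define G where "G = (\<lambda>n::nat. 2 * sqrt n / ln n)"
  have "(\<lambda>n. (2 * sqrt (real (Suc n)) / ln (real (Suc n)) - 2 * sqrt (real n) / ln (real n)) * (sqrt (real (Suc n)) * ln (real (Suc n)))) \<longlonglongrightarrow> 1"
    by real_asymp
  moreover have "1 / (1 + e) < 1" using e by simp
  ultimately have "\<forall>\<^sub>F n in sequentially. (2 * sqrt (real (Suc n)) / ln (real (Suc n)) - 2 * sqrt (real n) / ln (real n)) * (sqrt (real (Suc n)) * ln (real (Suc n))) > 1 / (1 + e)"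
    by (rule order_tendstoD(1))
  then obtain N where N: "\<And>n. n \<ge> N \<Longrightarrow> (G (Suc n) - G n) * (sqrt (real (Suc n)) * ln (real (Suc n))) > 1 / (1 + e)"
    unfolding G_def eventually_sequentially by blast
  define M where "M = max 2 N"
  have step: "sqrt_log_weight (Suc n) \<le> (1 + e) * (G (Suc n) - G n)" if n: "n \<ge> M" for n
  proof -
    have pos: "sqrt (real (Suc n)) * ln (real (Suc n)) > 0" using n by (simp add: M_def)
    have "1 < (1 + e) * ((G (Suc n) - G n) * (sqrt (real (Suc n)) * ln (real (Suc n))))"
      using N[of n] n e by (simp add: M_def pos_divide_less_eq mult.commute)
    then show ?thesis using pos unfolding sqrt_log_weight_def by (simp add: pos_divide_le_eq mult.assoc)
  qed
  define C where "C = (\<Sum>n=2..M. sqrt_log_weight n)"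
  have G0: "G n \<ge> 0" if "n \<ge> 2" for n using that by (simp add: G_def)
  have big: "(\<Sum>n=2..Y. sqrt_log_weight n) \<le> C + (1 + e) * G Y" if "Y \<ge> M" for Y
    using that
  proof (induction Y rule: dec_induct)
    case base
    have "(1 + e) * G M \<ge> 0" using G0[of M] e by (simp add: M_def)
    then show ?case by (simp add: C_def)
  next
    case (step Y)
    have "(\<Sum>n=2..Suc Y. sqrt_log_weight n) = (\<Sum>n=2..Y. sqrt_log_weight n) + sqrt_log_weight (Suc Y)"
      using step.hyps by (simp add: M_def)
    then show ?case using step.IH \<open>M \<le> Y \<Longrightarrow> sqrt_log_weight (Suc Y) \<le> (1 + e) * (G (Suc Y) - G Y)\<close> step.hyps by (simp add: algebra_simps)
  qed
  show ?thesis
  proof (rule that)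
    fix Y :: nat assume Y: "Y \<ge> 2"
    show "(\<Sum>n=2..Y. sqrt_log_weight n) \<le> C + (1 + e) * (2 * sqrt Y / ln Y)"
    proof (cases "Y \<ge> M")
      case True
      then show ?thesis using big[OF True] by (simp add: G_def)
    next
      case False
      then have "(\<Sum>n=2..Y. sqrt_log_weight n) \<le> C"
        unfolding C_def by (intro sum_mono2) (auto intro: less_imp_le sqrt_log_weight_pos)
      moreover have "(1 + e) * (2 * sqrt Y / ln Y) \<ge> 0"
        using Y e by (intro mult_nonneg_nonneg) auto
      ultimately show ?thesis by linarith
    qed
  qed
qed

text \<open>The choice \<open>Y = nat \<lfloor>ln a\<rfloor>\<close> is the extremal one, since the
  primes up to \<open>Y\<close> have a product of about \<open>exp Y\<close>. The cost term, at most
  \<open>sqrt_log_weight Y * (Y + 1)\<close>, is then cancelled by the boundary term of the Abel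
  summation up to a constant, and the sum of the weights remains. The shift in
  \<open>ln (ln a - 1)\<close> accounts for rounding.\<close>

lemma sum_prime_factors_asymp:
  assumes e: "e > 0"
  obtains C where "\<And>a::nat. ln a \<ge> 3 \<Longrightarrow>
    (\<Sum>p\<in>prime_factors a. 1 / sqrt (real p)) \<le> C + (1 + e) * ((1 + e) * (2 * sqrt (ln a) / ln (ln a - 1)))"
proof -
  let ?g = sqrt_log_weight
  obtain C1 where C1: "C1 \<ge> 0" "\<And>n::nat. psi n \<le> (1 + e) * n + C1" by (rule psi_upper_linear[OF e]) blast
  obtain C2 where C2: "\<And>Y. Y \<ge> 2 \<Longrightarrow> (\<Sum>n=2..Y. ?g n) \<le> C2 + (1 + e) * (2 * sqrt Y / ln Y)"
    by (rule sum_sqrt_log_weight_le[OF e]) blast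
  show ?thesis
  proof (rule that)
    fix a :: nat assume a: "ln a \<ge> 3"
    define Y where "Y = nat \<lfloor>ln a\<rfloor>"
    have Y: "Y \<ge> 2" "real Y \<le> ln a" "ln a \<le> real Y + 1" using a unfolding Y_def by linarith+
    have a0: "a > 0" using a by (cases a) auto
    have g: "0 < ?g Y" "?g Y \<le> ?g 2" using Y sqrt_log_weight_pos sqrt_log_weight_antimono by auto
    have "(\<Sum>p\<in>prime_factors a. 1 / sqrt (real p)) \<le> ?g Y * ln a + (\<Sum>n=2..Y. mangoldt n * (?g n - ?g Y))"
      by (rule sum_prime_factors_le[OF a0 Y(1)])
    also have "\<dots> \<le> ?g Y * (real Y + 1) + ((1 + e) * ((\<Sum>n=2..Y. ?g n) - Y * ?g Y + ?g 2) + C1 * (?g 2 - ?g Y))"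
      using Y g e by (intro add_mono mult_left_mono mangoldt_weighted_sum_le C1) auto
    also have "\<dots> \<le> ?g 2 + (1 + e) * ((\<Sum>n=2..Y. ?g n) + ?g 2) + C1 * ?g 2"
    proof -
      have "0 \<le> e * (Y * ?g Y)" "0 \<le> C1 * ?g Y" using e g C1 by auto
      then show ?thesis using g by (simp add: algebra_simps)
    qed
    also have "\<dots> \<le> ?g 2 + (1 + e) * ((C2 + (1 + e) * (2 * sqrt Y / ln Y)) + ?g 2) + C1 * ?g 2"
      using C2[OF Y(1)] e C1(1) g by (intro add_mono mult_left_mono order.refl) auto
    also have "\<dots> \<le> ?g 2 + (1 + e) * ((C2 + (1 + e) * (2 * sqrt (ln a) / ln (ln a - 1))) + ?g 2) + C1 * ?g 2"
    proof -
      have "2 * sqrt Y / ln Y \<le> 2 * sqrt (ln a) / ln (ln a - 1)"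
        using Y a by (intro frac_le) auto
      then show ?thesis using e by (intro add_right_mono add_left_mono mult_left_mono) auto
    qed
    also have "\<dots> = (?g 2 + (1 + e) * (C2 + ?g 2) + C1 * ?g 2) + (1 + e) * ((1 + e) * (2 * sqrt (ln a) / ln (ln a - 1)))"
      by (simp add: algebra_simps)
    finally show "(\<Sum>p\<in>prime_factors a. 1 / sqrt (real p)) \<le> (?g 2 + (1 + e) * (C2 + ?g 2) + C1 * ?g 2) + (1 + e) * ((1 + e) * (2 * sqrt (ln a) / ln (ln a - 1)))" .
  qed
qed

text \<open>The least \<open>\<epsilon> \<ge> 0\<close> for which \<open>ln a \<cdot> sigma_half a\<close> is bounded by the power of \<open>a\<close> in the theorem.\<close>

definition exponent_excess :: "nat \<Rightarrow> real" where
  "exponent_excess a = max 0 (ln (ln a * sigma_half a) * ln (ln a) / sqrt (ln a) - 2)"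

text \<open>Three approximations lose a factor \<open>1 + e\<close> each: the logarithm of the Euler
  factors, the bound for \<open>psi\<close>, and the sum of the weights. After multiplication by
  \<open>ln L / sqrt L\<close> with \<open>L = ln a\<close> the terms \<open>ln L\<close> and
  \<open>C\<close> tend to 0 and only \<open>k\<close> survives.\<close>

lemma exponent_excess_tendsto_0: "exponent_excess \<longlonglongrightarrow> 0"
proof (rule order_tendstoI)
  fix u :: real assume "u < 0"
  then show "\<forall>\<^sub>F a in sequentially. u < exponent_excess a"
    by (intro always_eventually) (auto simp: exponent_excess_def less_max_iff_disj)
next
  fix u :: real assume u: "0 < u"
  \<comment> \<open>Twice the cube of \<open>1 + e\<close> is at most \<open>2 + 14 * e\<close>, so
    this leaves half of \<open>u\<close> to spare for a strict inequality.\<close>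
  define e where "e = min 1 u / 28"
  have e: "0 < e" "e \<le> 1" using u by (auto simp: e_def)
  define k where "k = 2 * ((1 + e) * (1 + e) * (1 + e))"
  have k: "k < 2 + u"
  proof -
    have "e * e \<le> e * 1" "e * e * e \<le> e * 1 * 1" using e by (intro mult_mono; simp)+
    then have "k \<le> 2 + 14 * e" by (simp add: k_def algebra_simps)
    also have "\<dots> < 2 + u" using u by (simp add: e_def)
    finally show ?thesis .
  qed
  obtain C1 where C1: "\<And>a. a > 0 \<Longrightarrow> ln (sigma_half a) \<le> C1 + (1 + e) * (\<Sum>p\<in>prime_factors a. 1 / sqrt (real p))"
    by (rule ln_sigma_half_le[OF e(1)]) blast
  obtain C2 where C2: "\<And>a::nat. ln a \<ge> 3 \<Longrightarrow>
    (\<Sum>p\<in>prime_factors a. 1 / sqrt (real p)) \<le> C2 + (1 + e) * ((1 + e) * (2 * sqrt (ln a) / ln (ln a - 1)))"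
    by (rule sum_prime_factors_asymp[OF e(1)]) blast
  define C where "C = C1 + (1 + e) * C2"
  have "((\<lambda>L. (ln L + C + k * (sqrt L / ln (L - 1))) * ln L / sqrt L) \<longlongrightarrow> k) at_top"
    by real_asymp
  then have "\<forall>\<^sub>F L in at_top. (ln L + C + k * (sqrt L / ln (L - 1))) * ln L / sqrt L < 2 + u"
    using k by (rule order_tendstoD(2))
  moreover have "filterlim (\<lambda>a::nat. ln (real a)) at_top sequentially" by real_asymp
  ultimately have ev1: "\<forall>\<^sub>F a in sequentially. (ln (ln (real a)) + C + k * (sqrt (ln (real a)) / ln (ln (real a) - 1))) * ln (ln (real a)) / sqrt (ln (real a)) < 2 + u"
    by (rule eventually_compose_filterlim)
  have ev2: "\<forall>\<^sub>F a in sequentially. ln (real a) \<ge> 3" by real_asymp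
  show "\<forall>\<^sub>F a in sequentially. exponent_excess a < u"
    using ev1 ev2 eventually_gt_at_top[of 0]
  proof eventually_elim
    case (elim a)
    define L where "L = ln (real a)"
    have L: "L \<ge> 3" using elim by (simp add: L_def)
    have "ln (ln a * sigma_half a) = ln L + ln (sigma_half a)"
      using L sigma_half_ge_1[OF elim(3)] unfolding L_def by (subst ln_mult) auto
    also have "\<dots> \<le> ln L + (C1 + (1 + e) * (\<Sum>p\<in>prime_factors a. 1 / sqrt (real p)))"
      using C1[OF elim(3)] by simp
    also have "\<dots> \<le> ln L + (C1 + (1 + e) * (C2 + (1 + e) * ((1 + e) * (2 * sqrt L / ln (L - 1)))))"
      using C2[of a] elim(2) e unfolding L_def by (intro add_mono mult_left_mono) auto
    also have "\<dots> = ln L + C + k * (sqrt L / ln (L - 1))"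
      by (simp add: C_def k_def algebra_simps add_divide_distrib)
    finally have "ln (ln a * sigma_half a) * ln L / sqrt L \<le> (ln L + C + k * (sqrt L / ln (L - 1))) * ln L / sqrt L"
      using L by (intro divide_right_mono mult_right_mono) auto
    also have "\<dots> < 2 + u" using elim(1) unfolding L_def .
    finally show ?case using u unfolding exponent_excess_def L_def by auto
  qed
qed

text \<open>\<open>exponent_excess\<close> was defined by solving this inequality; turning it back
  requires \<open>ln (ln a) > 0\<close>, which holds because 3 exceeds \<open>exp 1\<close>.\<close>

lemma log_sigma_half_le_powr:
  fixes a :: nat
  assumes a: "a \<ge> 3"
  shows "ln a * sigma_half a \<le> a powr ((2 + exponent_excess a) / (sqrt (ln a) * ln (ln a)))"
proof -
  define L where "L = ln (real a)"
  have "exp 1 < (272 / 100 :: real)" by (rule e_less_272)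
  also have "\<dots> < real a" using a by simp
  finally have "exp 1 < real a" .
  then have "ln (exp 1) < ln (real a)" using a by (subst ln_less_cancel_iff) auto
  then have L: "L > 1" unfolding L_def by simp
  then have lnL: "ln L > 0" by simp
  have E: "ln a * sigma_half a > 0" using L sigma_half_ge_1[of a] a unfolding L_def by (intro mult_pos_pos) auto
  have "ln (ln a * sigma_half a) * ln L / sqrt L \<le> 2 + exponent_excess a"
    unfolding exponent_excess_def L_def by linarith
  then have "ln (ln a * sigma_half a) \<le> (2 + exponent_excess a) / (sqrt L * ln L) * L"
  proof -
    assume h: "ln (ln a * sigma_half a) * ln L / sqrt L \<le> 2 + exponent_excess a"
    have "ln (ln a * sigma_half a) = (ln (ln a * sigma_half a) * ln L / sqrt L) * (sqrt L / ln L)"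
      using L lnL by simp
    also have "\<dots> \<le> (2 + exponent_excess a) * (sqrt L / ln L)"
      using h L lnL by (intro mult_right_mono) auto
    also have "sqrt L / ln L = L / (sqrt L * ln L)"
      using L by (simp add: real_div_sqrt divide_divide_eq_left[symmetric])
    finally show ?thesis by simp
  qed
  then have "exp (ln (ln a * sigma_half a)) \<le> exp ((2 + exponent_excess a) / (sqrt L * ln L) * L)"
    by simp
  then show ?thesis using E a unfolding L_def by (simp add: powr_def)
qed

theorem theorem2:
  "\<exists>(C::real) (\<epsilon> :: nat \<Rightarrow> real). \<epsilon> \<longlonglongrightarrow> 0 \<and>
     (\<forall>(a::nat) (b::nat) (\<delta>::real). a \<ge> 3 \<longrightarrow> b \<ge> 1 \<longrightarrow> 0 < \<delta> \<longrightarrow> \<delta> < 1 / 2 \<longrightarrow>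
        \<bar>real (A a b \<delta>) - 2 * \<delta> * real b\<bar>
          \<le> C * \<bar>sqrt (real a) * ln (real a)
                 + real b * real a powr (- 1 / 2 + (2 + \<epsilon> a) / (sqrt (ln (real a)) * ln (ln (real a))))\<bar>)"
proof -
  obtain C :: real where C: "C > 0" and main: "\<And>a b \<delta>. a \<ge> 3 \<Longrightarrow> 0 < \<delta> \<Longrightarrow> \<delta> < 1 / 2 \<Longrightarrow>
       \<bar>real (A a b \<delta>) - 2 * \<delta> * b\<bar> \<le> C * (sqrt a * ln a + b / sqrt a * (ln a * sigma_half a))"
    by (rule A_discrepancy) blast
  show ?thesis
  proof (intro exI conjI allI impI)
    show "exponent_excess \<longlonglongrightarrow> 0" by (rule exponent_excess_tendsto_0)
    fix a b :: nat and \<delta> :: real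
    assume a: "a \<ge> 3" and \<delta>: "0 < \<delta>" "\<delta> < 1 / 2"
    define t where "t = (2 + exponent_excess a) / (sqrt (ln (real a)) * ln (ln (real a)))"
    have "b / sqrt a * (ln a * sigma_half a) \<le> b / sqrt a * a powr t"
      unfolding t_def by (intro mult_left_mono log_sigma_half_le_powr a) auto
    also have "\<dots> = b * a powr (- 1 / 2 + t)"
    proof -
      have "real a powr (- 1 / 2 + t) = real a powr (- 1 / 2) * real a powr t" by (rule powr_add)
      moreover have "real a powr (- 1 / 2) = inverse (sqrt a)"
        using a powr_minus[of "real a" "1 / 2"] by (simp add: powr_half_sqrt)
      ultimately show ?thesis by (simp only: divide_inverse mult.assoc)
    qed
    finally have le: "b / sqrt a * (ln a * sigma_half a) \<le> b * a powr (- 1 / 2 + t)" .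
    have "\<bar>real (A a b \<delta>) - 2 * \<delta> * b\<bar> \<le> C * (sqrt a * ln a + b / sqrt a * (ln a * sigma_half a))"
      by (rule main[OF a \<delta>])
    also have "\<dots> \<le> C * (sqrt a * ln a + b * a powr (- 1 / 2 + t))"
      using C le by (intro mult_left_mono add_left_mono) auto
    also have "\<dots> \<le> C * \<bar>sqrt a * ln a + b * a powr (- 1 / 2 + t)\<bar>"
      using C by (intro mult_left_mono) auto
    finally show "\<bar>real (A a b \<delta>) - 2 * \<delta> * real b\<bar>
          \<le> C * \<bar>sqrt (real a) * ln (real a)
                 + real b * real a powr (- 1 / 2 + (2 + exponent_excess a) / (sqrt (ln (real a)) * ln (ln (real a))))\<bar>"
      unfolding t_def .
  qed
qed

end
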